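(* Let $B$ be a proper board of size $2n+1$ with $n$ gourds. Then any configuration of the $n$ numbered (or colored) gourds on $B$ can be transformed into any other configuration of the same gourds using $O(n^2)$ moves. This bound is worst-case optimal: there are instances requiring $\Omega(n^2)$ moves.
   Context: A board is a finite, connected set of cells of the regular hexagonal tiling of the plane; two cells are adjacent if they share a side. The board graph $G_B$ has the cells as vertices, with edges between adjacent cells. A board is proper if all of the following hold: - it has $2n+1$ cells; - it is hole-free (the complement of the union of its cells is connected); - $G_B$ is 2-connected; - it is not the Star of David board: the 13-cell board consisting of a central cell, its 6 neighbors, and the 6 further cells each adjacent to two consecutive neighbors of the central cell. A gourd is a piece covering two adjacent cells with two distinguishable ends, carrying numbers or colors. A configuration places the $n$ gourds on pairwise disjoint pairs of adjacent cells, specifying which end lies on which cell, leaving one empty cell $e$. Suppose a gourd has ends $a$ on cell $p$ and $b$ on cell $q$. A move is one of: - Slide: $p,q,e$ are consecutive along a straight grid line. The gourd moves to $a$ on $q$, $b$ on $e$. - Turn: $q$ is adjacent to $p$ and $e$, with a $120^\circ$ angle at $q$. The gourd moves to $a$ on $q$, $b$ on $e$. - Pivot: $e$ is adjacent to both $p$ and $q$. One end stays fixed and the other moves to $e$. *)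

theory Defs
  imports "HOL-Analysis.Analysis" "HOL-Library.Landau_Symbols" "HOL-Library.Multiset"
begin

text \<open>
  Cells are given by axial coordinates: the cell \<open>(x, y)\<close> is the regular hexagon with inradius
  \<open>1/2\<close> (hence circumradius \<open>1 / sqrt 3\<close>) centred at \<open>x + y * cis (pi / 3)\<close>.
\<close>

type_synonym cell = "int \<times> int"

definition cell_center :: "cell \<Rightarrow> complex" where
  "cell_center c = of_int (fst c) + of_int (snd c) * cis (pi / 3)"

definition hexagon :: "cell \<Rightarrow> complex set" where
  "hexagon c = convex hull
     {cell_center c + of_real (1 / sqrt 3) * cis (pi / 6 + of_nat k * (pi / 3)) | k. k < (6::nat)}"

definition adjacent :: "cell \<Rightarrow> cell \<Rightarrow> bool" where
  "adjacent c d \<longleftrightarrow> d - c \<in> {(1, 0), (0, 1), (-1, 1), (-1, 0), (0, -1), (1, -1)}"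

definition rot60 :: "cell \<Rightarrow> cell" where
  "rot60 v = (- snd v, fst v + snd v)"

lemma cell_center_rot60: "cell_center (rot60 v) = cis (pi / 3) * cell_center v"
  by (simp add: cell_center_def rot60_def complex_eq_iff cos_60 sin_60 algebra_simps)

lemma adjacent_iff_dist: "adjacent c d \<longleftrightarrow> dist (cell_center c) (cell_center d) = 1"
proof -
  obtain a b where ab: "d - c = (a, b)"
    by fastforce
  then have d: "d = (fst c + a, snd c + b)"
    by (metis add.commute diff_add_cancel fst_conv fst_add prod.collapse snd_add snd_conv)
  have "(dist (cell_center c) (cell_center d))\<^sup>2 = (a + b / 2)\<^sup>2 + (b * (sqrt 3 / 2))\<^sup>2"
    unfolding dist_norm cmod_power2
    by (simp add: d cell_center_def cos_60 sin_60 power2_eq_square algebra_simps)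
  also have "\<dots> = of_int (a * a + a * b + b * b)"
    by (simp add: power2_eq_square field_simps)
  finally have sq: "(dist (cell_center c) (cell_center d))\<^sup>2 = of_int (a * a + a * b + b * b)" .
  have "dist (cell_center c) (cell_center d) = 1 \<longleftrightarrow> (dist (cell_center c) (cell_center d))\<^sup>2 = 1"
    by (simp add: power2_eq_1_iff) (smt (verit) zero_le_dist)
  also have "\<dots> \<longleftrightarrow> a * a + a * b + b * b = 1"
    unfolding sq by linarith
  also have "\<dots> \<longleftrightarrow> (a, b) \<in> {(1, 0), (0, 1), (-1, 1), (-1, 0), (0, -1), (1, -1)}"
  proof
    assume eq: "a * a + a * b + b * b = 1"
    have bound: "\<bar>x\<bar> \<le> 1" if "x * x + x * y + y * y = 1" for x y :: int
    proof (rule ccontr)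
      assume "\<not> \<bar>x\<bar> \<le> 1"
      then have "2 * 2 \<le> \<bar>x\<bar> * \<bar>x\<bar>"
        by (intro mult_mono) auto
      moreover have "0 \<le> (2 * y + x) * (2 * y + x)"
        by simp
      ultimately show False
        using that by (simp add: algebra_simps)
    qed
    have "\<bar>a\<bar> \<le> 1" "\<bar>b\<bar> \<le> 1"
      using bound[of a b] bound[of b a] eq by (simp_all add: algebra_simps)
    then have "a \<in> {-1, 0, 1}" "b \<in> {-1, 0, 1}"
      by auto
    then show "(a, b) \<in> {(1, 0), (0, 1), (-1, 1), (-1, 0), (0, -1), (1, -1)}"
      using eq by auto
  qed auto
  finally show ?thesis
    by (simp add: adjacent_def ab)
qed

definition board_graph :: "cell set \<Rightarrow> (cell \<times> cell) set" where
  "board_graph B = {(c, d). c \<in> B \<and> d \<in> B \<and> adjacent c d}"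

definition board_connected :: "cell set \<Rightarrow> bool" where
  "board_connected B \<longleftrightarrow> B \<noteq> {} \<and> (\<forall>c\<in>B. \<forall>d\<in>B. (c, d) \<in> (board_graph B)\<^sup>*)"

definition board :: "cell set \<Rightarrow> bool" where
  "board B \<longleftrightarrow> finite B \<and> board_connected B"

text \<open>Deleting the vertex \<open>c\<close> from \<open>board_graph B\<close> gives \<open>board_graph (B - {c})\<close>.\<close>

definition two_connected :: "cell set \<Rightarrow> bool" where
  "two_connected B \<longleftrightarrow> card B > 2 \<and> board_connected B \<and> (\<forall>c\<in>B. board_connected (B - {c}))"

definition hole_free :: "cell set \<Rightarrow> bool" where
  "hole_free B \<longleftrightarrow> connected (- (\<Union>c\<in>B. hexagon c))"

text \<open>Two neighbours of \<open>c\<close> are consecutive around \<open>c\<close> iff they are adjacent to each other.\<close>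

definition star_of_david :: "cell \<Rightarrow> cell set" where
  "star_of_david c = {c} \<union> {d. adjacent c d} \<union>
     {d. \<exists>u v. adjacent c u \<and> adjacent c v \<and> adjacent u v \<and> adjacent d u \<and> adjacent d v}"

definition proper_board :: "nat \<Rightarrow> cell set \<Rightarrow> bool" where
  "proper_board n B \<longleftrightarrow> board B \<and> card B = 2 * n + 1 \<and> hole_free B \<and> two_connected B \<and>
     (\<forall>c. B \<noteq> star_of_david c)"

text \<open>
  A gourd is the pair of labels (numbers or colours) on its first and second end. The element
  \<open>((a, b), p, q)\<close> of a configuration is a gourd \<open>(a, b)\<close> whose first end, labelled \<open>a\<close>, lies
  on \<open>p\<close> and whose second end, labelled \<open>b\<close>, lies on \<open>q\<close>. Gourds with the same labels are
  interchangeable; the two ends of a gourd are told apart even if their labels agree.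
\<close>

type_synonym 'l gourd = "'l \<times> 'l"

type_synonym 'l config = "('l gourd \<times> cell \<times> cell) set"

definition covered :: "'l config \<Rightarrow> cell set" where
  "covered C = (\<Union>(g, p, q)\<in>C. {p, q})"

definition configuration :: "cell set \<Rightarrow> 'l gourd multiset \<Rightarrow> 'l config \<Rightarrow> bool" where
  "configuration B G C \<longleftrightarrow>
     finite C \<and>
     (\<forall>(g, p, q)\<in>C. p \<in> B \<and> q \<in> B \<and> adjacent p q) \<and>
     pairwise (\<lambda>(g, p, q) (g', p', q'). {p, q} \<inter> {p', q'} = {}) C \<and>
     image_mset fst (mset_set C) = G"

text \<open>
  \<open>gourd_move e (p, q) (p', q')\<close>: a gourd with first end on \<open>p\<close> and second end on \<open>q\<close> can
  move to first end on \<open>p'\<close> and second end on \<open>q'\<close> when \<open>e\<close> is the empty cell. Slides and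
  turns occur in two versions because either end may lead.
\<close>

definition straight :: "cell \<Rightarrow> cell \<Rightarrow> cell \<Rightarrow> bool" where
  "straight p q e \<longleftrightarrow> adjacent p q \<and> adjacent q e \<and> e - q = q - p"

definition angle120 :: "cell \<Rightarrow> cell \<Rightarrow> cell \<Rightarrow> bool" where
  "angle120 p q e \<longleftrightarrow> adjacent p q \<and> adjacent q e \<and>
     (e - q = rot60 (rot60 (p - q)) \<or> p - q = rot60 (rot60 (e - q)))"

inductive gourd_move :: "cell \<Rightarrow> cell \<times> cell \<Rightarrow> cell \<times> cell \<Rightarrow> bool" for e where
  slide_second: "straight p q e \<Longrightarrow> gourd_move e (p, q) (q, e)"
| slide_first: "straight q p e \<Longrightarrow> gourd_move e (p, q) (e, p)"
| turn_second: "angle120 p q e \<Longrightarrow> gourd_move e (p, q) (q, e)"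
| turn_first: "angle120 q p e \<Longrightarrow> gourd_move e (p, q) (e, p)"
| pivot_second: "adjacent e p \<Longrightarrow> adjacent e q \<Longrightarrow> gourd_move e (p, q) (p, e)"
| pivot_first: "adjacent e p \<Longrightarrow> adjacent e q \<Longrightarrow> gourd_move e (p, q) (e, q)"

definition move :: "cell set \<Rightarrow> 'l config \<Rightarrow> 'l config \<Rightarrow> bool" where
  "move B C C' \<longleftrightarrow> (\<exists>g x y. \<exists>e \<in> B - covered C.
     (g, x) \<in> C \<and> gourd_move e x y \<and> C' = insert (g, y) (C - {(g, x)}))"

text \<open>Numbered gourds: no label occurs on more than one of the ends.\<close>

definition numbered :: "'l gourd multiset \<Rightarrow> bool" where
  "numbered G \<longleftrightarrow> (\<forall>l. count (image_mset fst G + image_mset snd G) l \<le> 1)"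

end

theory Submission
  imports Defs "HOL-Combinatorics.Combinatorics"
begin

text \<open>
  Upper bound. A proper board is triangulated as a polygon: it has a set of lattice triangles whose
  dual graph is a tree and whose corners are exactly its cells. Here hole-freeness makes the
  triangles of a 2-connected board simply connected, and the Star of David is the only board on which
  interior cells cannot be avoided by dropping triangles. A parity recursion over the dual tree
  selects triangles glued at corners in a tree-like way (a cactus), in which the \<open>n\<close> gourds can be parked one per
  triangle and the hole can travel anywhere. Two triangles with a common corner can exchange their gourds
  by a conjugated rotation along a closed chain of triangles; such a chain may be long, but its length
  is paid for by the triangles it uses, so any two triangles are joined by exchanges of total cost
  \<open>O(n)\<close>, and sorting the gourds costs \<open>O(n\<^sup>2)\<close>. Augmenting paths of matchings park the gourds, and a
  gourd is reversed by three pivots within its triangle.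

  Lower bound. On a strip of width two, a move changes the distance of a gourd to its target column by
  at most one, and reversing the order of the gourds requires total displacement of order \<open>n\<^sup>2\<close>.
\<close>

text \<open>Absence of inner cells makes every dual edge a bridge, because both ends of the crossed
  lattice edge then touch the connected outside. The recursion is governed by parity: a side with an
  odd number of cells strictly beyond its base edge is covered by one cactus, an even side only by
  two disjoint ones rooted at the two ends of that edge, and the triangle joining two sides is used
  exactly if both are even. Two cactus triangles meeting at a corner often lie on a five-cycle of
  cells, where a rotation is already the exchange. The obstacle is a corner at which exactly four
  triangles of the current side meet; there the exchange needs the closed chain around the skipped
  triangles, at a cost proportional to its length. Each such event uses up a turn at an end of the
  chain, and at most five triangles of a chain fit around a cell. Hence the factor
  \<open>1 + a + b\<close> of the account stays at most 9, and with 60 units for each turn this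
  gives the constant 540. Orientation is ignored until the end: every shift of a two-cell set is
  realised by some legal move, whatever it does to the ends.\<close>

section \<open>Triangles of the lattice as left sides of directed edges\<close>

definition la :: "cell \<Rightarrow> cell \<Rightarrow> cell" where
  "la x z = x + rot60 (z - x)"

text \<open>\<open>la x z\<close> is the common neighbour to the left of the directed edge from
  \<open>x\<close> to \<open>z\<close>. An edge therefore lies on the two triangles
  \<open>tri x z\<close> and \<open>tri z x\<close>, and crossing it amounts to swapping the
  arguments.\<close>

definition tri :: "cell \<Rightarrow> cell \<Rightarrow> cell set" where
  "tri x z = {x, z, la x z}"

lemma adjacent_coords:
  "adjacent (a, b) (c, d) \<longleftrightarrow> (c - a, d - b) \<in> {(1, 0), (0, 1), (-1, 1), (-1, 0), (0, -1), (1, -1)}"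
  by (simp add: adjacent_def)

lemma la_coords: "la (a, b) (c, d) = (a + b - d, c + d - a)"
  by (simp add: la_def rot60_def)

lemma adjacentE:
  assumes "adjacent x z"
  obtains a b where "x = (a, b)" "z = (a + 1, b)" | a b where "x = (a, b)" "z = (a, b + 1)"
    | a b where "x = (a, b)" "z = (a - 1, b + 1)" | a b where "x = (a, b)" "z = (a - 1, b)"
    | a b where "x = (a, b)" "z = (a, b - 1)" | a b where "x = (a, b)" "z = (a + 1, b - 1)"
proof -
  obtain a b c d where xz: "x = (a, b)" "z = (c, d)" by fastforce
  have "(c - a, d - b) \<in> {(1, 0), (0, 1), (-1, 1), (-1, 0), (0, -1), (1, -1)}"
    using assms by (simp add: xz adjacent_coords)
  then have "c = a + 1 \<and> d = b \<or> c = a \<and> d = b + 1 \<or> c = a - 1 \<and> d = b + 1 \<or>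
    c = a - 1 \<and> d = b \<or> c = a \<and> d = b - 1 \<or> c = a + 1 \<and> d = b - 1"
    by simp presburger
  then show ?thesis using that xz by blast
qed

lemma adjacent_sym: "adjacent x z \<longleftrightarrow> adjacent z x"
proof -
  have "adjacent z x" if "adjacent x z" for x z
    using that by (cases rule: adjacentE) (simp_all add: adjacent_coords)
  then show ?thesis by blast
qed

lemma adjacent_irrefl [simp]: "\<not> adjacent x x"
  by (cases x) (auto simp: adjacent_coords)

lemma adjacent_neq: "adjacent x z \<Longrightarrow> x \<noteq> z"
  by auto

lemma la_adjacent:
  assumes "adjacent x z"
  shows "adjacent x (la x z)" "adjacent (la x z) x" "adjacent z (la x z)" "adjacent (la x z) z"
  using assms by (cases rule: adjacentE; simp add: adjacent_coords la_coords)+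

lemma la_la [simp]: "la z (la x z) = x" "la (la x z) x = z"
  by (cases x; cases z; simp add: la_coords)+

lemma la_neq: "adjacent x z \<Longrightarrow> la x z \<noteq> x" "adjacent x z \<Longrightarrow> la x z \<noteq> z"
  using la_adjacent adjacent_neq by blast+

lemma la_neq_swap: "adjacent x z \<Longrightarrow> la x z \<noteq> la z x"
  by (cases rule: adjacentE) (auto simp: la_coords)

lemma adjacent_cases:
  "adjacent (a, b) y \<longleftrightarrow>
     y \<in> {(a + 1, b), (a, b + 1), (a - 1, b + 1), (a - 1, b), (a, b - 1), (a + 1, b - 1)}"
  by (cases y) (simp add: adjacent_coords diff_eq_eq add.commute)

lemma clique_la:
  assumes "adjacent x z" "adjacent x w" "adjacent z w"
  shows "w = la x z \<or> w = la z x"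
proof -
  obtain a b where x: "x = (a, b)" by fastforce
  show ?thesis
    using assms(1,2)[unfolded x adjacent_cases] assms(3)
    by (elim insertE emptyE) (simp_all add: x la_coords adjacent_coords)
qed

lemma tri_rot: "tri z (la x z) = tri x z" "tri (la x z) x = tri x z"
  by (auto simp: tri_def)

lemma tri_eq_iff:
  assumes "adjacent x z" "adjacent v u"
  shows "tri v u = tri x z \<longleftrightarrow> (v, u) \<in> {(x, z), (z, la x z), (la x z, x)}"
proof
  assume eq: "tri v u = tri x z"
  have "v \<in> tri x z" "u \<in> tri x z" "la v u \<in> tri x z" using eq by (auto simp: tri_def)
  then have "v \<in> {x, z, la x z}" "u \<in> {x, z, la x z}" "la v u \<in> {x, z, la x z}"
    by (auto simp: tri_def)
  then show "(v, u) \<in> {(x, z), (z, la x z), (la x z, x)}"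
    using assms la_neq[OF assms(1)] la_neq[OF assms(2)] la_neq_swap[OF assms(1)]
      la_neq_swap[OF la_adjacent(3)[OF assms(1)]] la_neq_swap[OF la_adjacent(2)[OF assms(1)]]
    by auto
qed (auto simp: tri_rot)

lemma tri_neq_swap: "adjacent x z \<Longrightarrow> tri x z \<noteq> tri z x"
  using tri_eq_iff[of x z z x] la_neq(1)[of x z] la_neq(2)[of x z] adjacent_sym[of x z] adjacent_neq[of x z]
  by (simp split del: if_split) blast?

lemma card_tri: "adjacent x z \<Longrightarrow> card (tri x z) = 3"
  using la_neq[of x z] by (auto simp: tri_def card_insert_if dest: adjacent_neq)

definition lat :: "cell set set" where
  "lat = {tri x z | x z. adjacent x z}"

text \<open>The triangles around \<open>v\<close> are \<open>tri v z\<close> for the neighbours \<open>z\<close> of \<open>v\<close>.\<close>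

lemma lat_at:
  assumes "t \<in> lat" "v \<in> t" obtains z where "adjacent v z" "t = tri v z"
proof -
  obtain x z where t: "t = tri x z" "adjacent x z" using assms(1) by (auto simp: lat_def)
  then have "v = x \<or> v = z \<or> v = la x z" using assms(2) by (auto simp: tri_def)
  then show ?thesis
    using that[of z] that[of "la x z"] that[of x] t la_adjacent[OF t(2)] tri_rot[of z x] tri_rot[of x z]
    by auto
qed

lemma lat_edge:
  assumes "t \<in> lat" "p \<in> t" "q \<in> t" "p \<noteq> q"
  shows "adjacent p q" "t = tri p q \<or> t = tri q p"
proof -
  obtain z where z: "adjacent p z" "t = tri p z" using lat_at[OF assms(1,2)] .
  then have "q = z \<or> q = la p z" using assms by (auto simp: tri_def)
  then show "adjacent p q" "t = tri p q \<or> t = tri q p"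
    using z la_adjacent(1)[OF z(1)] tri_rot(2)[of p z] by auto
qed

subsection \<open>Rings\<close>

text \<open>Counterclockwise turns about \<open>r\<close> by 60 degrees.
  \<open>tri r (ring r s i)\<close> runs through the six triangles at \<open>r\<close>, and
  consecutive ones share the spoke to \<open>ring r s (i + 1)\<close>.\<close>

definition ring :: "cell \<Rightarrow> cell \<Rightarrow> nat \<Rightarrow> cell" where
  "ring r s i = (la r ^^ i) s"

lemma ring_0 [simp]: "ring r s 0 = s" by (simp add: ring_def)
lemma ring_Suc: "ring r s (Suc i) = la r (ring r s i)" by (simp add: ring_def)

lemma la_6: "la r (la r (la r (la r (la r (la r s))))) = s"
  by (cases r; cases s) (simp add: la_coords)

lemma ring_adjacent: "adjacent r s \<Longrightarrow> adjacent r (ring r s i)"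
  by (induction i) (auto simp: ring_Suc la_adjacent)

lemma neighbour_ring:
  assumes "adjacent r s" "adjacent r x"
  shows "x \<in> {s, la r s, la r (la r s), la r (la r (la r s)),
    la r (la r (la r (la r s))), la r (la r (la r (la r (la r s))))}"
proof -
  obtain a b where r: "r = (a, b)" by fastforce
  show ?thesis
    using assms[unfolded r adjacent_cases] unfolding r
    by (elim insertE emptyE) (simp_all add: la_coords)
qed

lemma ring_distinct:
  assumes "adjacent r s"
  shows "distinct [r, s, la r s, la r (la r s), la r (la r (la r s)),
    la r (la r (la r (la r s))), la r (la r (la r (la r (la r s))))]"
  using assms by (cases rule: adjacentE) (auto simp: la_coords)

lemma la_back: "la (la r s) r = s" "la s r = la r (la r (la r (la r (la r s))))"
  by (cases r; cases s; simp add: la_coords)+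

declare split_paired_All [simp del] split_paired_Ex [simp del]

lemma ring_6: "ring r s 6 = s"
  by (simp add: ring_def numeral_eq_Suc la_6[simplified])

lemma ring_add: "ring r s (i + j) = ring r (ring r s i) j"
  by (simp add: ring_def funpow_add add.commute[of i])

lemma ring_inj:
  assumes "adjacent r s" "i < 6" "j < 6"
  shows "ring r s i = ring r s j \<longleftrightarrow> i = j"
proof -
  let ?xs = "[s, la r s, la r (la r s), la r (la r (la r s)),
    la r (la r (la r (la r s))), la r (la r (la r (la r (la r s))))]"
  have nth: "ring r s i = ?xs ! i" if "i < 6" for i
  proof -
    have "i = 0 \<or> i = 1 \<or> i = 2 \<or> i = 3 \<or> i = 4 \<or> i = 5" using that by linarith
    then show ?thesis by (elim disjE) (simp_all add: ring_def numeral_eq_Suc)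
  qed
  have "distinct ?xs"
    using ring_distinct[OF assms(1)] unfolding distinct.simps(2)[of r] by (rule conjunct2)
  moreover have "i < length ?xs" "j < length ?xs" using assms(2,3) by simp_all
  ultimately show ?thesis
    unfolding nth[OF assms(2)] nth[OF assms(3)] by (rule nth_eq_iff_index_eq)
qed

lemma ring_prev: "la s r = ring r s 5" "la (ring r s (Suc i)) r = ring r s i"
proof -
  show "la s r = ring r s 5" by (subst la_back(2)) (simp add: ring_def numeral_eq_Suc)
  show "la (ring r s (Suc i)) r = ring r s i" by (simp add: ring_Suc la_back(1))
qed

lemma neighbour_ringE:
  assumes "adjacent r s" "adjacent r x"
  obtains i where "i < 6" "x = ring r s i"
proof -
  have "x \<in> {ring r s 0, ring r s 1, ring r s 2, ring r s 3, ring r s 4, ring r s 5}"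
    using neighbour_ring[OF assms] by (simp add: ring_def numeral_eq_Suc)
  then show ?thesis using that[of 0] that[of 1] that[of 2] that[of 3] that[of 4] that[of 5] by auto
qed

lemma tri_ring_prev: "tri (ring r s (Suc i)) r = tri r (ring r s i)"
  by (simp add: ring_Suc tri_rot)

section \<open>Parity cochains on the lattice and walks in the dual graph\<close>

text \<open>\<open>h k\<close> is \<open>b\<close> changed by the parity of the number of
  \<open>e\<close> between \<open>0\<close> and \<open>k\<close>. \<open>P\<close> counts them for
  positive \<open>k\<close> and \<open>N\<close> for negative \<open>k\<close>, so one of the two
  sets is always empty.\<close>

lemma int_antidifference: "\<exists>h :: int \<Rightarrow> bool. h 0 = b \<and> (\<forall>k. h (k + 1) = (h k \<noteq> e k))"
proof -
  define P where "P k = {j. 0 \<le> j \<and> j < k \<and> e j}" for k :: int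
  define N where "N k = {j. k \<le> j \<and> j < 0 \<and> e j}" for k :: int
  define h where "h k = (b \<noteq> (odd (card (P k)) \<noteq> odd (card (N k))))" for k
  have fin: "finite (P k)" "finite (N k)" for k
    by (rule finite_subset[of _ "{0..<k}"]; force simp: P_def)
      (rule finite_subset[of _ "{k..<0}"]; force simp: N_def)
  have "h (k + 1) = (h k \<noteq> e k)" for k
  proof (cases "k \<ge> 0")
    case True
    then have "P (k + 1) = (if e k then insert k (P k) else P k)" "N (k + 1) = {}" "N k = {}"
      "k \<notin> P k"
      by (auto simp: P_def N_def le_less)
    then show ?thesis using fin by (auto simp: h_def)
  next
    case False
    then have "N k = (if e k then insert k (N (k + 1)) else N (k + 1))" "P (k + 1) = {}" "P k = {}"
      "k \<notin> N (k + 1)"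
      by (auto simp: P_def N_def add1_zle_eq le_less)
    then show ?thesis using fin by (auto simp: h_def)
  qed
  moreover have "P 0 = {}" "N 0 = {}" by (auto simp: P_def N_def)
  then have "h 0 = b" by (simp add: h_def)
  ultimately show ?thesis by blast
qed

text \<open>The first cohomology of the triangular lattice modulo 2 vanishes.\<close>

lemma even_edges_coboundary:
  fixes E :: "cell \<Rightarrow> cell \<Rightarrow> bool"
  assumes sym: "\<And>p q. E p q = E q p"
    and even: "\<And>x z. adjacent x z \<Longrightarrow> (E x z \<noteq> E z (la x z)) = E (la x z) x"
  shows "\<exists>f :: cell \<Rightarrow> bool. \<forall>p q. adjacent p q \<longrightarrow> E p q = (f p \<noteq> f q)"
proof -
  obtain h0 where h0: "\<And>x. h0 (x + 1) = (h0 x \<noteq> E (x, 0) (x + 1, 0))"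
    using int_antidifference[of False "\<lambda>x. E (x, 0) (x + 1, 0)"] by auto
  have "\<forall>x. \<exists>H. H 0 = h0 x \<and> (\<forall>y. H (y + 1) = (H y \<noteq> E (x, y) (x, y + 1)))"
    by (intro allI int_antidifference)
  then obtain H where H0: "\<And>x. H x 0 = h0 x"
    and H: "\<And>x y. H x (y + 1) = (H x y \<noteq> E (x, y) (x, y + 1))"
    by metis
  have t1: "(E (x, y) (x + 1, y) \<noteq> E (x + 1, y) (x, y + 1)) = E (x, y + 1) (x, y)" for x y
    using even[of "(x, y)" "(x + 1, y)"] by (simp add: adjacent_coords la_coords add.commute)
  have t2: "(E (x + 1, y + 1) (x, y + 1) \<noteq> E (x, y + 1) (x + 1, y)) = E (x + 1, y) (x + 1, y + 1)"
    for x y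
    using even[of "(x + 1, y + 1)" "(x, y + 1)"] by (simp add: adjacent_coords la_coords add.commute)
  \<comment> \<open>The potential \<open>H\<close> integrates \<open>E\<close> along the row
    \<open>y = 0\<close> and then along every column. \<open>R\<close> says that it is also right on
    horizontal edges; the two triangles of a unit rhombus carry this from row to row. Diagonal edges
    then follow from a single triangle.\<close>
  define R where "R x y \<longleftrightarrow> H (x + 1) y = (H x y \<noteq> E (x, y) (x + 1, y))" for x y
  have R_step: "R x (y + 1) = R x y" for x y
    using t1[of x y] t2[of x y] H[of x y] H[of "x + 1" y] sym[of "(x, y)" "(x, y + 1)"]
      sym[of "(x + 1, y)" "(x, y + 1)"] sym[of "(x, y + 1)" "(x + 1, y + 1)"]
    unfolding R_def by argo
  have R: "R x y" for x y
  proof (induction y rule: int_induct[of _ 0])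
    case base show ?case using h0[of x] by (simp add: R_def H0)
  next
    case (step1 i) then show ?case using R_step[of x i] by simp
  next
    case (step2 i) then show ?case using R_step[of x "i - 1"] by simp
  qed
  define f where "f p = H (fst p) (snd p)" for p
  have "E p q = (f p \<noteq> f q)" if "adjacent p q" for p q
    using that
  proof (cases rule: adjacentE)
    case (1 a b) then show ?thesis using R[of a b] by (auto simp: R_def f_def)
  next
    case (2 a b) then show ?thesis using H[of a b] by (auto simp: f_def)
  next
    case (3 a b) then show ?thesis using R[of "a - 1" b] H[of "a - 1" b] t1[of "a - 1" b]
      sym[of "(a - 1, b)" "(a - 1, b + 1)"]
      by (auto simp: R_def f_def)
  next
    case (4 a b) then show ?thesis using R[of "a - 1" b] sym[of p q] by (auto simp: R_def f_def)
  next
    case (5 a b) then show ?thesis using H[of a "b - 1"] sym[of p q] by (auto simp: f_def)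
  next
    case (6 a b) then show ?thesis using R[of a "b - 1"] H[of a "b - 1"] t1[of a "b - 1"]
      sym[of "(a, b - 1)" "(a, b)"] sym[of p q]
      by (auto simp: R_def f_def)
  qed
  then show ?thesis by blast
qed

text \<open>Steps of the dual graph. \<open>A\<close> selects the edges that may be crossed, so
  walls and permitted corridors are both expressed by the choice of \<open>A\<close>.\<close>

definition dual :: "(cell \<Rightarrow> cell \<Rightarrow> bool) \<Rightarrow> (cell set \<times> cell set) set" where
  "dual A = {(tri p q, tri q p) | p q. adjacent p q \<and> A p q}"

lemma dualI: "adjacent p q \<Longrightarrow> A p q \<Longrightarrow> (tri p q, tri q p) \<in> dual A"
  unfolding dual_def by blast

lemma dual_mono: "(\<And>p q. adjacent p q \<Longrightarrow> A p q \<Longrightarrow> A' p q) \<Longrightarrow> (dual A)\<^sup>* \<subseteq> (dual A')\<^sup>*"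
  unfolding dual_def by (rule rtrancl_mono) blast

lemma dual_sym: "(\<And>p q. A p q \<Longrightarrow> A q p) \<Longrightarrow> sym ((dual A)\<^sup>*)"
proof (rule sym_rtrancl, rule symI)
  assume A: "\<And>p q. A p q \<Longrightarrow> A q p"
  fix s t assume "(s, t) \<in> dual A"
  then obtain p q where "s = tri p q" "t = tri q p" "adjacent p q" "A p q" by (auto simp: dual_def)
  then show "(t, s) \<in> dual A" using A adjacent_sym dualI by metis
qed

lemma xor_edges:
  assumes "x \<noteq> z" "x \<noteq> w" "z \<noteq> w"
  shows "((({x, z} = {a, b}) \<noteq> ({z, w} = {a, b})) \<noteq> ({w, x} = {a, b})) =
    (((a, b) \<in> {(x, z), (z, w), (w, x)}) \<noteq> ((b, a) \<in> {(x, z), (z, w), (w, x)}))"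
  using assms by (cases "a = x"; cases "a = z"; cases "a = w") (auto simp: doubleton_eq_iff)

text \<open>\<open>E\<close> consists of the edges that the walk crosses an odd number of times. One
  step toggles one edge, which flips the parity at exactly the two triangles on it, so everything
  cancels except at the two ends of the walk.\<close>

lemma dual_path_edges:
  assumes "(s, t) \<in> (dual A)\<^sup>*" and "\<And>p q. A p q = A q p"
  shows "\<exists>E. (\<forall>p q. E p q = E q p) \<and> (\<forall>p q. E p q \<longrightarrow> A p q) \<and>
    (\<forall>x z. adjacent x z \<longrightarrow>
      (((E x z \<noteq> E z (la x z)) \<noteq> E (la x z) x) = ((tri x z = s) \<noteq> (tri x z = t))))"
  using assms(1)
proof (induction rule: rtrancl_induct)
  case base
  show ?case by (intro exI[of _ "\<lambda>_ _. False"]) simp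
next
  case (step t t')
  obtain a b where ab: "t = tri a b" "t' = tri b a" "adjacent a b" "A a b"
    using step.hyps(2) by (auto simp: dual_def)
  obtain E where E: "\<And>p q. E p q = E q p" "\<And>p q. E p q \<Longrightarrow> A p q"
    "\<And>x z. adjacent x z \<Longrightarrow>
      (((E x z \<noteq> E z (la x z)) \<noteq> E (la x z) x) = ((tri x z = s) \<noteq> (tri x z = t)))"
    using step.IH by blast
  define F where "F p q \<longleftrightarrow> {p, q} = {a, b}" for p q
  have F: "((F x z \<noteq> F z (la x z)) \<noteq> F (la x z) x) = ((tri x z = t) \<noteq> (tri x z = t'))"
    if xz: "adjacent x z" for x z
  proof -
    have "tri x z = t \<longleftrightarrow> (a, b) \<in> {(x, z), (z, la x z), (la x z, x)}"
      using tri_eq_iff[OF xz ab(3)] ab(1) by metis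
    moreover have "tri x z = t' \<longleftrightarrow> (b, a) \<in> {(x, z), (z, la x z), (la x z, x)}"
      using tri_eq_iff[OF xz, of b a] ab(2,3) adjacent_sym[of a b] by metis
    moreover have "x \<noteq> z" "x \<noteq> la x z" "z \<noteq> la x z"
      using la_neq[OF xz] adjacent_neq[OF xz] by metis+
    ultimately show ?thesis using xor_edges[of x z "la x z" a b] unfolding F_def by metis
  qed
  show ?case
  proof (intro exI[of _ "\<lambda>p q. E p q \<noteq> F p q"] conjI allI impI)
    show "(E p q \<noteq> F p q) = (E q p \<noteq> F q p)" for p q using E(1) by (auto simp: F_def insert_commute)
    show "A p q" if "E p q \<noteq> F p q" for p q
      using that E(2)[of p q] ab(4) assms(2)[of a b] by (auto simp: F_def doubleton_eq_iff)
    show "(((E x z \<noteq> F x z) \<noteq> (E z (la x z) \<noteq> F z (la x z))) \<noteq> (E (la x z) x \<noteq> F (la x z) x))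
      = ((tri x z = s) \<noteq> (tri x z = t'))" if "adjacent x z" for x z
      using E(3)[OF that] F[OF that] by argo
  qed
qed

text \<open>A closed dual path crossing the edge \<open>pq\<close> exactly once separates \<open>p\<close> from \<open>q\<close>.\<close>

lemma dual_cut:
  assumes sym: "\<And>p q. A p q = A q p" and pq: "adjacent p q" "\<not> A p q"
    and path: "(tri p q, tri q p) \<in> (dual A)\<^sup>*"
  obtains f :: "cell \<Rightarrow> bool" where "f p \<noteq> f q"
    "\<And>a b. adjacent a b \<Longrightarrow> \<not> A a b \<Longrightarrow> {a, b} \<noteq> {p, q} \<Longrightarrow> f a = f b"
proof -
  obtain E where E: "\<And>p q. E p q = E q p" "\<And>p q. E p q \<Longrightarrow> A p q"
    "\<And>x z. adjacent x z \<Longrightarrow>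
      (((E x z \<noteq> E z (la x z)) \<noteq> E (la x z) x) = ((tri x z = tri p q) \<noteq> (tri x z = tri q p)))"
    using dual_path_edges[OF path sym] by blast
  \<comment> \<open>Crossing \<open>pq\<close> back closes the walk. The sum of \<open>E\<close> and
    \<open>G\<close> is then even on every triangle, hence the coboundary of some
    \<open>f\<close>.\<close>
  define F where "F a b \<longleftrightarrow> {a, b} = {p, q}" for a b
  have F_sym: "F a b = F b a" for a b by (simp add: F_def insert_commute)
  have "adjacent q p" using pq(1) adjacent_sym[of p q] by simp
  moreover have "F q p" by (simp add: F_def insert_commute)
  ultimately have path': "(tri q p, tri p q) \<in> (dual F)\<^sup>*" by (rule r_into_rtrancl[OF dualI])
  obtain G where G: "\<And>p q. G p q = G q p" "\<And>p q. G p q \<Longrightarrow> F p q"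
    "\<And>x z. adjacent x z \<Longrightarrow>
      (((G x z \<noteq> G z (la x z)) \<noteq> G (la x z) x) = ((tri x z = tri q p) \<noteq> (tri x z = tri p q)))"
    using dual_path_edges[OF path' F_sym] by blast
  have "\<exists>f :: cell \<Rightarrow> bool. \<forall>a b. adjacent a b \<longrightarrow> (E a b \<noteq> G a b) = (f a \<noteq> f b)"
  proof (rule even_edges_coboundary)
    show "(E a b \<noteq> G a b) = (E b a \<noteq> G b a)" for a b using E(1) G(1) by metis
    show "((E x z \<noteq> G x z) \<noteq> (E z (la x z) \<noteq> G z (la x z))) = (E (la x z) x \<noteq> G (la x z) x)"
      if "adjacent x z" for x z
      using E(3)[OF that] G(3)[OF that] by argo
  qed
  then obtain f :: "cell \<Rightarrow> bool" where f: "\<And>a b. adjacent a b \<Longrightarrow> (E a b \<noteq> G a b) = (f a \<noteq> f b)" by blast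
  have "G p q"
  proof -
    have "tri p q \<noteq> tri q p" using tri_neq_swap pq(1) .
    then have "(G p q \<noteq> G q (la p q)) \<noteq> G (la p q) p" using G(3)[OF pq(1)] by simp
    moreover have "\<not> F q (la p q)" "\<not> F (la p q) p"
      using la_neq[OF pq(1)] adjacent_neq[OF pq(1)] by (auto simp: F_def doubleton_eq_iff)
    ultimately show ?thesis using G(2) by blast
  qed
  show ?thesis
  proof
    show "f p \<noteq> f q" using f[OF pq(1)] E(2)[of p q] pq(2) \<open>G p q\<close> by auto
    show "f a = f b" if "adjacent a b" "\<not> A a b" "{a, b} \<noteq> {p, q}" for a b
      using f[OF that(1)] E(2)[of a b] G(2)[of a b] that by (auto simp: F_def)
  qed
qed

lemma ring_path:
  assumes "adjacent r s" "i \<le> j" "\<And>m. i < m \<Longrightarrow> m \<le> j \<Longrightarrow> A (ring r s m) r"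
  shows "(tri r (ring r s i), tri r (ring r s j)) \<in> (dual A)\<^sup>*"
  using assms(2,3)
proof (induction j rule: dec_induct)
  case (step j)
  have "(tri (ring r s (Suc j)) r, tri r (ring r s (Suc j))) \<in> dual A"
    using step ring_adjacent[OF assms(1)] by (intro dualI) (auto simp: adjacent_sym)
  then show ?case using step by (simp add: tri_ring_prev)
qed simp

lemma star_path:
  assumes "adjacent r s" "adjacent r s'" "\<And>x. adjacent r x \<Longrightarrow> A x r"
  shows "(tri r s, tri r s') \<in> (dual A)\<^sup>*"
proof -
  obtain i where "i < 6" "s' = ring r s i" using neighbour_ringE[OF assms(1,2)] .
  then show ?thesis
    using ring_path[OF assms(1), of 0 i A, OF _ assms(3)[OF ring_adjacent[OF assms(1)]]] by simp
qed

section \<open>Dual connectivity and the fans of a set of triangles\<close>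

definition inn :: "cell set set \<Rightarrow> cell \<Rightarrow> cell \<Rightarrow> bool" where
  "inn D p q \<longleftrightarrow> tri p q \<in> D \<and> tri q p \<in> D"

definition linked :: "cell set set \<Rightarrow> bool" where
  "linked D \<longleftrightarrow> (\<forall>s\<in>D. \<forall>t\<in>D. (s, t) \<in> (dual (inn D))\<^sup>*)"

text \<open>A boundary edge with \<open>D\<close> on its left. Turning counterclockwise about
  \<open>v\<close>, it opens a run of triangles of \<open>D\<close>, so uniqueness of
  \<open>z\<close> for every \<open>v\<close> says that the triangles of \<open>D\<close> at
  \<open>v\<close> form a single fan.\<close>

definition start :: "cell set set \<Rightarrow> cell \<Rightarrow> cell \<Rightarrow> bool" where
  "start D v z \<longleftrightarrow> adjacent v z \<and> tri v z \<in> D \<and> tri z v \<notin> D"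

lemma inn_sym: "inn D p q = inn D q p" by (auto simp: inn_def)

text \<open>Clockwise from the triangle at \<open>x\<close>, the run of triangles of
  \<open>D\<close> ends at the first gap. Counted counterclockwise within one full turn, this gap is
  the largest index of a missing triangle, and \<open>z\<close> comes right after it.\<close>

lemma fan_back:
  assumes "adjacent u x" "tri u x \<in> D" "adjacent u y" "tri u y \<notin> D"
  obtains z i where "start D u z" "x = ring u z i" "\<And>m. m \<le> i \<Longrightarrow> tri u (ring u z m) \<in> D"
proof -
  define M where "M = {m. m < 6 \<and> tri u (ring u x m) \<notin> D}"
  obtain i where "i < 6" "y = ring u x i" using neighbour_ringE[OF assms(1,3)] .
  then have "i \<in> M" using assms by (simp add: M_def)
  have "finite M" by (simp add: M_def)
  define m where "m = Max M"
  have m: "m \<in> M" using \<open>i \<in> M\<close> \<open>finite M\<close> Max_in by (auto simp: m_def)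
  have larger: "tri u (ring u x k) \<in> D" if "m < k" "k \<le> 6" for k
  proof (cases "k = 6")
    case True then show ?thesis using assms by (simp add: ring_6)
  next
    case False
    then have "k \<notin> M" using that Max_ge[OF \<open>finite M\<close>, of k] unfolding m_def by linarith
    then show ?thesis using False that by (simp add: M_def)
  qed
  define z where "z = ring u x (Suc m)"
  have "m < 6" using m by (simp add: M_def)
  have rz: "ring u z j = ring u x (Suc m + j)" for j by (simp add: z_def ring_add[symmetric])
  show ?thesis
  proof
    show "start D u z"
      using larger[of "Suc m"] m ring_adjacent[OF assms(1)] unfolding start_def z_def tri_ring_prev
      by (simp add: M_def)
    show "x = ring u z (5 - m)" using \<open>m < 6\<close> by (simp add: rz ring_6)
    show "tri u (ring u z k) \<in> D" if "k \<le> 5 - m" for k using that larger \<open>m < 6\<close> by (simp add: rz)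
  qed
qed

text \<open>If nothing is missing at \<open>u\<close>, the walk goes round the full star; otherwise
  both triangles lie in the run opened by the unique start. Only spokes of \<open>u\<close> are
  crossed, which later keeps the walk off a forbidden edge elsewhere.\<close>

lemma fan_linked:
  assumes uniq: "\<And>z z'. start D u z \<Longrightarrow> start D u z' \<Longrightarrow> z = z'"
    and st: "adjacent u x" "tri u x \<in> D" "adjacent u x'" "tri u x' \<in> D"
  shows "(tri u x, tri u x') \<in> (dual (\<lambda>p q. inn D p q \<and> u \<in> {p, q}))\<^sup>*" (is "_ \<in> (dual ?A)\<^sup>*")
proof (cases "\<exists>y. adjacent u y \<and> tri u y \<notin> D")
  case False
  then have all: "tri u y \<in> D" if "adjacent u y" for y using that by blast
  have "tri y u \<in> D" if "adjacent u y" for y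
  proof -
    have "tri u (la y u) \<in> D" using all la_adjacent(3)[of y u] that by (simp add: adjacent_sym)
    then show ?thesis by (simp add: tri_rot)
  qed
  then show ?thesis using st all by (intro star_path) (auto simp: inn_def)
next
  case True
  then obtain y where y: "adjacent u y" "tri u y \<notin> D" by blast
  obtain z i where z: "start D u z" "x = ring u z i" "\<And>m. m \<le> i \<Longrightarrow> tri u (ring u z m) \<in> D"
    using fan_back[OF st(1,2) y] by blast
  obtain z' i' where z': "start D u z'" "x' = ring u z' i'" "\<And>m. m \<le> i' \<Longrightarrow> tri u (ring u z' m) \<in> D"
    using fan_back[OF st(3,4) y] by blast
  have [simp]: "z' = z" using uniq z(1) z'(1) by blast
  have az: "adjacent u z" using z(1) by (simp add: start_def)
  have path: "(tri u (ring u z 0), tri u (ring u z k)) \<in> (dual ?A)\<^sup>*"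
    if "\<And>m. m \<le> k \<Longrightarrow> tri u (ring u z m) \<in> D" for k
  proof (rule ring_path[OF az])
    fix m assume "0 < m" "m \<le> k"
    then show "inn D (ring u z m) u \<and> u \<in> {ring u z m, u}"
      using that[of m] that[of "m - 1"] tri_ring_prev[of u z "m - 1"] by (simp add: inn_def)
  qed simp
  have "sym ((dual ?A)\<^sup>*)" by (rule dual_sym) (auto simp: inn_def)
  then have "(tri u x, tri u z) \<in> (dual ?A)\<^sup>*" using path[of i] z by (auto dest: symD)
  moreover have "(tri u z, tri u x') \<in> (dual ?A)\<^sup>*" using path[of i'] z' by auto
  ultimately show ?thesis by simp
qed

lemma tri_around: "adjacent r x \<Longrightarrow> tri x r = tri r (la x r)"
  by (simp add: tri_rot)

lemma tri_at_inj: "adjacent r x \<Longrightarrow> adjacent r y \<Longrightarrow> tri r x = tri r y \<longleftrightarrow> x = y"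
  using tri_eq_iff[of r y r x] la_neq[of r y] adjacent_neq[of r y] by auto

lemma tri_lat: "adjacent p q \<Longrightarrow> tri p q \<in> lat"
  by (auto simp: lat_def)

lemma adj_sym: "adjacent p q \<Longrightarrow> adjacent q p"
  by (simp add: adjacent_sym)

subsection \<open>Linked sets of triangles\<close>

lemma linkedD: "linked D \<Longrightarrow> s \<in> D \<Longrightarrow> t \<in> D \<Longrightarrow> (s, t) \<in> (dual (inn D))\<^sup>*"
  by (simp add: linked_def)

lemma sym_inn: "sym ((dual (inn D))\<^sup>*)"
  by (rule dual_sym) (simp add: inn_sym)

lemma inn_mono: "D \<subseteq> D' \<Longrightarrow> (dual (inn D))\<^sup>* \<subseteq> (dual (inn D'))\<^sup>*"
  by (rule dual_mono) (auto simp: inn_def)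

lemma linked_insert:
  assumes "linked D" "adjacent p q" "tri q p \<in> D"
  shows "linked (insert (tri p q) D)" (is "linked ?D")
proof -
  have sub: "(dual (inn D))\<^sup>* \<subseteq> (dual (inn ?D))\<^sup>*" by (rule inn_mono) blast
  have "(tri p q, tri q p) \<in> dual (inn ?D)" using assms by (intro dualI) (auto simp: inn_def)
  then have one: "(tri p q, t) \<in> (dual (inn ?D))\<^sup>*" if "t \<in> D" for t
    using linkedD[OF assms(1,3) that] sub by (meson converse_rtrancl_into_rtrancl subsetD)
  show ?thesis
    unfolding linked_def
  proof (intro ballI)
    fix s t assume "s \<in> ?D" "t \<in> ?D"
    then consider "s = tri p q" "t = tri p q" | "s = tri p q" "t \<in> D" | "s \<in> D" "t = tri p q" | "s \<in> D" "t \<in> D"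
      by blast
    then show "(s, t) \<in> (dual (inn ?D))\<^sup>*"
    proof cases
      case 3 then show ?thesis using one[of s] sym_inn[of ?D] by (auto dest: symD)
    next
      case 4 then show ?thesis using linkedD[OF assms(1)] sub by blast
    qed (use one in auto)
  qed
qed

lemma dual_irrefl: "(t, t) \<notin> dual A"
proof
  assume "(t, t) \<in> dual A"
  then obtain p q where "t = tri p q" "t = tri q p" "adjacent p q" unfolding dual_def by blast
  then show False using tri_neq_swap by metis
qed

text \<open>A walk enters and leaves \<open>\<tau>\<close> through neighbours of
  \<open>\<tau>\<close>. All of these reach the same triangle \<open>c\<close> without using
  \<open>\<tau>\<close>, so every visit can be replaced by a detour via \<open>c\<close>.\<close>

lemma linked_remove:
  assumes "linked D"
    and nb: "\<And>t. t \<in> D \<Longrightarrow> (t, \<tau>) \<in> dual (inn D) \<Longrightarrow> (t, c) \<in> (dual (inn (D - {\<tau>})))\<^sup>*"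
  shows "linked (D - {\<tau>})"
  unfolding linked_def
proof (intro ballI)
  let ?R = "dual (inn (D - {\<tau>}))"
  fix s t assume s: "s \<in> D - {\<tau>}" and t: "t \<in> D - {\<tau>}"
  have in_D: "u \<in> D" "v \<in> D" if "(u, v) \<in> dual (inn D)" for u v
    using that by (auto simp: dual_def inn_def)
  have R: "(u, v) \<in> ?R" if "(u, v) \<in> dual (inn D)" "u \<noteq> \<tau>" "v \<noteq> \<tau>" for u v
    using that by (auto simp: dual_def inn_def)
  have rev: "(v, u) \<in> dual (inn D)" if uv: "(u, v) \<in> dual (inn D)" for u v
  proof -
    obtain p q where "u = tri p q" "v = tri q p" "adjacent p q" "inn D p q"
      using uv unfolding dual_def by blast
    then show ?thesis using dualI[OF adj_sym, of p q "inn D"] inn_sym by simp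
  qed
  have "(t \<noteq> \<tau> \<longrightarrow> (s, t) \<in> ?R\<^sup>*) \<and> (t = \<tau> \<longrightarrow> (s, c) \<in> ?R\<^sup>*)" if "(s, t) \<in> (dual (inn D))\<^sup>*" for t
    using that
  proof (induction rule: rtrancl_induct)
    case base then show ?case using s by simp
  next
    case (step u v)
    show ?case
    proof (cases "u = \<tau>")
      case True
      then have "(s, c) \<in> ?R\<^sup>*" using step by simp
      moreover have "(c, v) \<in> ?R\<^sup>*"
        using nb[OF in_D(2)[OF step.hyps(2)]] rev[OF step.hyps(2)] True sym_inn by (auto dest: symD)
      moreover have "v \<noteq> \<tau>" using step.hyps(2) True dual_irrefl by metis
      ultimately show ?thesis by auto
    next
      case False
      then have su: "(s, u) \<in> ?R\<^sup>*" using step by simp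
      show ?thesis
      proof (cases "v = \<tau>")
        case True
        then show ?thesis using su nb[OF in_D(1)[OF step.hyps(2)]] step.hyps(2) by auto
      next
        case v: False
        then show ?thesis using su R[OF step.hyps(2) False v] by auto
      qed
    qed
  qed
  then show "(s, t) \<in> ?R\<^sup>*" using linkedD[OF assms(1)] s t by blast
qed

lemma dual_nbrs:
  assumes "(t, tri r s) \<in> dual (inn D)" "adjacent r s"
  shows "t \<in> D" "t = tri s r \<or> t = tri (la r s) s \<or> t = tri r (la r s)"
proof -
  obtain p q where pq: "t = tri p q" "tri r s = tri q p" "adjacent p q" "inn D p q"
    using assms(1) by (auto simp: dual_def)
  show "t \<in> D" using pq by (simp add: inn_def)
  have "adjacent q p" using pq(3) by (rule adj_sym)
  then have "(q, p) \<in> {(r, s), (s, la r s), (la r s, r)}" using tri_eq_iff[OF assms(2)] pq(2) by metis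
  then show "t = tri s r \<or> t = tri (la r s) s \<or> t = tri r (la r s)" using pq(1) by auto
qed

text \<open>The long way round: the two neighbours of \<open>tri r y\<close> at \<open>r\<close> are
  joined through the five other triangles at \<open>r\<close>.\<close>

lemma around_path:
  assumes "adjacent r y" "\<And>z. adjacent r z \<Longrightarrow> z \<noteq> y \<Longrightarrow> tri r z \<in> X"
  shows "(tri y r, tri r (la r y)) \<in> (dual (inn (X - {tri r y})))\<^sup>*"
proof -
  have X: "tri r (ring r y i) \<in> X - {tri r y}" if "1 \<le> i" "i \<le> 5" for i
  proof -
    have "ring r y i \<noteq> y" using ring_inj[OF assms(1), of i 0] that by simp
    then show ?thesis
      using assms ring_adjacent[OF assms(1)] tri_at_inj[OF ring_adjacent[OF assms(1)] assms(1)] by auto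
  qed
  have "(tri r (ring r y 1), tri r (ring r y 5)) \<in> (dual (inn (X - {tri r y})))\<^sup>*"
  proof (rule ring_path[OF assms(1)])
    fix m :: nat assume m: "1 < m" "m \<le> 5"
    then obtain k where k: "m = Suc k" "1 \<le> k" by (cases m) auto
    show "inn (X - {tri r y}) (ring r y m) r"
      using X[of m] X[of k] m k by (simp add: inn_def tri_ring_prev)
  qed simp
  then have "(tri r (ring r y 5), tri r (ring r y 1)) \<in> (dual (inn (X - {tri r y})))\<^sup>*"
    using sym_inn by (auto dest: symD)
  moreover have "tri r (ring r y 5) = tri y r" using tri_around[OF assms(1)] ring_prev(1)[of y r] by simp
  ultimately show ?thesis by (simp add: ring_Suc)
qed

subsection \<open>Good triangle sets\<close>

text \<open>A combinatorial disc with corner set \<open>B\<close>: connected, with connected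
  outside, and without pinch points, since the triangles at each corner form one fan.\<close>

definition good :: "cell set \<Rightarrow> cell set set \<Rightarrow> bool" where
  "good B D \<longleftrightarrow> D \<subseteq> lat \<and> finite D \<and> \<Union>D = B \<and> linked D \<and> linked (lat - D) \<and>
     (\<forall>v z z'. start D v z \<longrightarrow> start D v z' \<longrightarrow> z = z')"

definition inner :: "cell set set \<Rightarrow> cell \<Rightarrow> bool" where
  "inner D v \<longleftrightarrow> (\<forall>z. adjacent v z \<longrightarrow> tri v z \<in> D)"

lemma innerD:
  assumes "inner D v" "adjacent p q" "v \<in> tri p q" shows "tri p q \<in> D"
proof -
  obtain z where "adjacent v z" "tri p q = tri v z" using lat_at[OF tri_lat[OF assms(2)] assms(3)] .
  then show ?thesis using assms(1) by (simp add: inner_def)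
qed

lemma good_startD: "good B D \<Longrightarrow> start D v z \<Longrightarrow> start D v z' \<Longrightarrow> z = z'"
  unfolding good_def by blast

text \<open>The other five triangles about the inner apex keep the set linked and still contain
  \<open>r\<close> and \<open>s\<close>, so no cell is lost. Through the boundary edge
  \<open>rs\<close> the deleted triangle joins the outside.\<close>

lemma remove_door:
  assumes g: "good B D" and rs: "adjacent r s" and D: "tri r s \<in> D" "tri s r \<notin> D"
    and w: "inner D (la r s)"
  shows "good B (D - {tri r s})"
proof -
  define w where "w = la r s"
  define \<Delta> where "\<Delta> = tri r s"
  have aw: "adjacent w r" "adjacent r w" "adjacent s w" "adjacent w s"
    using la_adjacent[OF rs] by (auto simp: w_def)
  have \<Delta>w: "\<Delta> = tri w r" by (simp add: \<Delta>_def w_def tri_rot)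
  have wr: "la w r = s" by (simp add: w_def)
  have inD: "tri w z \<in> D" if "adjacent w z" for z
    using w that by (auto simp: inner_def w_def)
  have path: "(tri r w, tri w s) \<in> (dual (inn (D - {\<Delta>})))\<^sup>*"
    using around_path[OF aw(1), of D] inD wr by (simp add: \<Delta>w)
  have linked: "linked (D - {\<Delta>})"
  proof (rule linked_remove[where c = "tri w s"])
    show "linked D" using g by (simp add: good_def)
    fix t assume "t \<in> D" "(t, \<Delta>) \<in> dual (inn D)"
    then have "t = tri w s \<or> t = tri r w"
      using dual_nbrs[of t r s D] rs D by (auto simp: \<Delta>_def w_def)
    then show "(t, tri w s) \<in> (dual (inn (D - {\<Delta>})))\<^sup>*" using path by auto
  qed
  have co: "linked (lat - (D - {\<Delta>}))"
  proof -
    have "lat - (D - {\<Delta>}) = insert (tri r s) (lat - D)"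
      using tri_lat[OF rs] by (auto simp: \<Delta>_def)
    moreover have "tri s r \<in> lat - D" using D tri_lat[OF adj_sym[OF rs]] by simp
    ultimately show ?thesis using linked_insert[OF _ rs, of "lat - D"] g by (simp add: good_def)
  qed
  have neq: "tri w s \<noteq> \<Delta>" "tri r w \<noteq> \<Delta>"
    unfolding \<Delta>w using tri_at_inj[OF aw(4,1)] tri_neq_swap[OF aw(2)] adjacent_neq[OF rs] by auto
  have "tri w s \<in> D - {\<Delta>}" "tri r w \<in> D - {\<Delta>}"
    using inD[OF aw(4)] innerD[OF w[folded w_def] aw(2)] neq by (auto simp: tri_def)
  moreover have "\<Delta> \<subseteq> tri w s \<union> tri r w" by (auto simp: \<Delta>_def tri_def w_def)
  ultimately have un: "\<Union>(D - {\<Delta>}) = \<Union>D" by blast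
  \<comment> \<open>The old start at \<open>r\<close> was \<open>s\<close>; after the removal it is
    the apex, and the formerly inner apex gets its first start, \<open>s\<close>. All other corners
    keep theirs.\<close>
  have cases: "(v, z) = (w, s) \<or> (v, z) = (r, w) \<or> start D v z \<and> v \<noteq> r \<and> v \<noteq> w"
    if st: "start (D - {\<Delta>}) v z" for v z
  proof (cases "tri z v = \<Delta>")
    case True
    have vz: "adjacent v z" using st by (simp add: start_def)
    then have "(z, v) \<in> {(r, s), (s, la r s), (la r s, r)}"
      using True tri_eq_iff[OF rs adj_sym[OF vz]] by (simp add: \<Delta>_def)
    moreover have "(z, v) \<noteq> (r, s)" using st D by (auto simp: start_def)
    ultimately show ?thesis by (auto simp: w_def)
  next
    case False
    then have sD: "start D v z" using st by (auto simp: start_def)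
    have "v \<noteq> r"
    proof
      assume "v = r"
      then have "z = s" using good_startD[OF g sD, of s] rs D by (auto simp: start_def)
      then show False using st \<open>v = r\<close> by (simp add: start_def \<Delta>_def)
    qed
    moreover have "v \<noteq> w"
    proof
      assume "v = w"
      then have "adjacent z w" using sD by (auto simp: start_def intro: adj_sym)
      then have "tri z w \<in> D" using innerD[OF w[folded w_def]] by (auto simp: tri_def)
      then show False using sD \<open>v = w\<close> by (simp add: start_def)
    qed
    ultimately show ?thesis using sD by blast
  qed
  have "z = z'" if "start (D - {\<Delta>}) v z" "start (D - {\<Delta>}) v z'" for v z z'
    using cases[OF that(1)] cases[OF that(2)] good_startD[OF g, of v z z'] adjacent_neq[OF aw(1)] by auto
  then show ?thesis using g linked co un unfolding good_def \<Delta>_def by auto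
qed

text \<open>The single gap among the six triangles at \<open>r\<close> moves from
  \<open>tri r x\<close> to \<open>tri r y\<close>. The outer edge of \<open>tri r y\<close> has to
  lie on the boundary, so that the new gap opens to the outside.\<close>

lemma exchange:
  assumes g: "good B D" and x: "adjacent r x" "tri r x \<notin> D"
    and all: "\<And>z. adjacent r z \<Longrightarrow> z \<noteq> x \<Longrightarrow> tri r z \<in> D"
    and y: "adjacent r y" "y \<noteq> x" "tri (la r y) y \<notin> D"
  shows "good B (insert (tri r x) (D - {tri r y}))"
proof -
  define Z \<tau> where "Z = tri r x" "\<tau> = tri r y"
  define D1 where "D1 = insert Z (D - {\<tau>})"
  have \<tau>Z: "\<tau> \<in> D" "Z \<notin> D" "\<tau> \<noteq> Z"
    using all[OF y(1,2)] y x tri_at_inj[OF y(1) x(1)] by (auto simp: Z_\<tau>_def)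
  have D1eq: "D1 = insert Z D - {\<tau>}" using \<tau>Z by (auto simp: D1_def)
  have ax: "adjacent r (la r x)" "adjacent x (la r x)" "adjacent x r" "adjacent r (la x r)" "adjacent (la r x) r"
    using la_adjacent[OF x(1)] la_adjacent[OF adj_sym[OF x(1)]] adj_sym[OF x(1)] by auto
  have ay: "adjacent r (la r y)" "adjacent y (la r y)" "adjacent y r" "adjacent r (la y r)"
    "adjacent (la r y) y" "adjacent (la r y) r"
    using la_adjacent[OF y(1)] la_adjacent[OF adj_sym[OF y(1)]] adj_sym[OF y(1)] by auto
  have allD1: "tri r z \<in> D1" if "adjacent r z" "z \<noteq> y" for z
    using that all[of z] tri_at_inj[OF that(1) y(1)] by (auto simp: D1_def Z_\<tau>_def)
  have xr: "tri x r \<in> D" "tri r (la r x) \<in> D"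
    using all[OF ax(4)] all[OF ax(1)] tri_around[OF x(1)] la_neq[OF x(1)] la_neq[OF ax(3)] by auto
  have yr: "tri y r \<in> D1" "tri r (la r y) \<in> D1"
    using allD1[OF ay(4)] allD1[OF ay(1)] tri_around[OF y(1)] la_neq[OF y(1)] la_neq[OF ay(3)] by auto
  have out: "r \<notin> tri (la r y) y"
    using la_neq_swap[OF ay(2)] la_neq[OF y(1)] adjacent_neq[OF y(1)] by (auto simp: tri_def)
  then have outZ: "tri (la r y) y \<noteq> Z" by (auto simp: Z_\<tau>_def tri_def)
  have linked: "linked D1"
    unfolding D1eq
  proof (rule linked_remove[where c = "tri r (la r y)"])
    have "linked D" using g by (simp add: good_def)
    then show "linked (insert Z D)" using linked_insert[OF _ x(1) xr(1)] by (simp add: Z_\<tau>_def)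
    fix t assume "t \<in> insert Z D" "(t, \<tau>) \<in> dual (inn (insert Z D))"
    then have "t = tri y r \<or> t = tri r (la r y)"
      using dual_nbrs[of t r y "insert Z D"] y outZ by (auto simp: Z_\<tau>_def)
    moreover have "tri r z \<in> insert Z D" if "adjacent r z" for z
      using all[OF that] by (auto simp: Z_\<tau>_def)
    then have "(tri y r, tri r (la r y)) \<in> (dual (inn (insert Z D - {\<tau>})))\<^sup>*"
      using around_path[OF y(1), of "insert Z D"] by (simp add: Z_\<tau>_def)
    ultimately show "(t, tri r (la r y)) \<in> (dual (inn (insert Z D - {\<tau>})))\<^sup>*" by auto
  qed
  have co: "linked (lat - D1)"
  proof -
    \<comment> \<open>In the outside, \<open>Z\<close> has a neighbour only across its edge opposite
      \<open>r\<close>, so deleting it leaves the outside linked. \<open>\<tau>\<close> is then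
      attached through its own outer edge.\<close>
    have "linked (lat - D - {Z})"
    proof (rule linked_remove[where c = "tri (la r x) x"])
      show "linked (lat - D)" using g by (simp add: good_def)
      fix t assume "t \<in> lat - D" "(t, Z) \<in> dual (inn (lat - D))"
      then have "t = tri (la r x) x"
        using dual_nbrs[of t r x "lat - D"] x(1) xr by (auto simp: Z_\<tau>_def)
      then show "(t, tri (la r x) x) \<in> (dual (inn (lat - D - {Z})))\<^sup>*" by simp
    qed
    moreover have "tri (la r y) y \<in> lat - D - {Z}" using y(3) outZ tri_lat[OF ay(5)] by simp
    ultimately have "linked (insert (tri y (la r y)) (lat - D - {Z}))"
      using linked_insert[OF _ ay(2)] by blast
    moreover have "insert (tri y (la r y)) (lat - D - {Z}) = lat - D1"
      using tri_lat[OF y(1)] \<tau>Z by (auto simp: D1_def Z_\<tau>_def tri_rot)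
    ultimately show ?thesis by simp
  qed
  have un: "\<Union>D1 = \<Union>D"
  proof -
    have "Z \<subseteq> tri x r \<union> tri r (la r x)" by (auto simp: Z_\<tau>_def tri_def)
    moreover have "\<tau> \<subseteq> tri y r \<union> tri r (la r y)" by (auto simp: Z_\<tau>_def tri_def)
    ultimately show ?thesis using xr yr by (auto simp: D1_def)
  qed
  have starts: "start D y (la r y)" "start D x r" "start D r (la r x)"
    using \<tau>Z y x xr ax ay by (auto simp: start_def Z_\<tau>_def tri_rot)
  have cases: "(v, z) = (r, la r y) \<or> (v, z) = (y, r) \<or> (v, z) = (x, la r x) \<or>
      start D v z \<and> v \<noteq> r \<and> v \<noteq> y \<and> v \<noteq> x"
    if st: "start D1 v z" for v z
  proof -
    have vz: "adjacent v z" "adjacent z v" "tri v z \<in> D1" "tri z v \<notin> D1"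
      using st adj_sym by (auto simp: start_def)
    consider "tri v z = Z" | "tri z v = \<tau>" | "tri v z \<in> D" "tri v z \<noteq> \<tau>" "tri z v \<notin> D" "tri z v \<noteq> Z"
      using vz by (auto simp: D1_def)
    then show ?thesis
    proof cases
      case 1
      then have "(v, z) \<in> {(r, x), (x, la r x), (la r x, r)}"
        using tri_eq_iff[OF x(1) vz(1)] by (simp add: Z_\<tau>_def)
      moreover have "la r y = x" if "(v, z) = (r, x)"
      proof -
        have "tri x r = \<tau>" using vz(4) xr that by (auto simp: D1_def)
        then have "la x r = y" using tri_at_inj[OF ax(4) y(1)] tri_around[OF x(1)] by (simp add: Z_\<tau>_def)
        then show ?thesis by auto
      qed
      moreover have "la r x = y" if "(v, z) = (la r x, r)"
      proof -
        have "tri r (la r x) = \<tau>" using vz(4) xr that by (auto simp: D1_def)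
        then show ?thesis using tri_at_inj[OF ax(1) y(1)] by (simp add: Z_\<tau>_def)
      qed
      ultimately show ?thesis by auto
    next
      case 2
      then have "(z, v) \<in> {(r, y), (y, la r y), (la r y, r)}"
        using tri_eq_iff[OF y(1) vz(2)] by (simp add: Z_\<tau>_def)
      moreover have "(z, v) \<noteq> (y, la r y)" using vz(3) y(3) outZ by (auto simp: D1_def)
      ultimately show ?thesis by auto
    next
      case 3
      then have sD: "start D v z" using vz by (simp add: start_def)
      have "v \<noteq> y" using good_startD[OF g sD, of "la r y"] starts 3 by (auto simp: Z_\<tau>_def tri_rot)
      moreover have "v \<noteq> x" using good_startD[OF g sD, of r] starts 3 by (auto simp: Z_\<tau>_def)
      moreover have "v \<noteq> r" using good_startD[OF g sD, of "la r x"] starts 3 by (auto simp: Z_\<tau>_def tri_rot)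
      ultimately show ?thesis using sD by blast
    qed
  qed
  have "z = z'" if "start D1 v z" "start D1 v z'" for v z z'
    using cases[OF that(1)] cases[OF that(2)] good_startD[OF g, of v z z'] y(2)
      adjacent_neq[OF x(1)] adjacent_neq[OF y(1)] by auto
  moreover have "D1 \<subseteq> lat" "finite D1" using g tri_lat[OF x(1)] by (auto simp: D1_def good_def Z_\<tau>_def)
  ultimately show ?thesis
    using g linked co un unfolding good_def D1_def Z_\<tau>_def by auto
qed

lemma card_exchange: "finite D \<Longrightarrow> a \<in> D \<Longrightarrow> b \<notin> D \<Longrightarrow> card (insert b (D - {a})) = card D"
  by (metis Diff_iff card_Suc_Diff1 card_insert_disjoint finite_Diff)

section \<open>Good sets of minimal size and their inner cells\<close>

locale minimal_good =
  fixes B D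
  assumes good: "good B D" and minimal: "\<And>D'. good B D' \<Longrightarrow> card D \<le> card D'"
begin

lemma no_door:
  assumes "adjacent r s" "tri r s \<in> D" "inner D (la r s)"
  shows "tri s r \<in> D"
proof (rule ccontr)
  assume "tri s r \<notin> D"
  then have "good B (D - {tri r s})" using remove_door[OF good] assms by blast
  then have "card D \<le> card (D - {tri r s})" by (rule minimal)
  moreover have "finite D" using good by (simp add: good_def)
  ultimately show False using assms(2) by (metis card_Diff1_less not_less)
qed

text \<open>Across each outer edge of the star of an inner cell lies a further triangle, for
  otherwise the star would contain a triangle removable by \<open>remove_door\<close>. These are the
  tips of a Star of David.\<close>

lemma tip:
  assumes "inner D b" "adjacent r s" "la r s = b"
  shows "tri r s \<in> D" "tri s r \<in> D"
proof -
  show "tri r s \<in> D" using innerD[OF assms(1,2)] assms(3) by (simp add: tri_def)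
  then show "tri s r \<in> D" using no_door assms by blast
qed

text \<open>Shifting the gap of \<open>r\<close> to \<open>tri r y\<close> would give another good
  set of minimal size. One of the triangles next to the new gap would then have a boundary edge and
  an inner apex, contrary to minimality.\<close>

lemma no_exchange:
  assumes x: "adjacent r x" "tri r x \<notin> D" "\<And>z. adjacent r z \<Longrightarrow> z \<noteq> x \<Longrightarrow> tri r z \<in> D"
    and y: "adjacent r y" "y \<noteq> x" and inn: "inner D (la r (la r y)) \<or> inner D (la y r)"
  shows "tri (la r y) y \<in> D"
proof (rule ccontr)
  assume out: "tri (la r y) y \<notin> D"
  define D1 where "D1 = insert (tri r x) (D - {tri r y})"
  have "good B D1" unfolding D1_def by (rule exchange[OF good x y out])
  moreover have "card D1 = card D"
    unfolding D1_def using x y good by (intro card_exchange) (auto simp: good_def)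
  ultimately interpret m: minimal_good B D1 by unfold_locales (use minimal in auto)
  have ay: "adjacent r (la r y)" "adjacent y r" "adjacent r (la y r)" "adjacent (la r y) r"
    using la_adjacent[OF y(1)] la_adjacent[OF adj_sym[OF y(1)]] adj_sym[OF y(1)] by auto
  have neq: "tri r y \<noteq> tri r x" using tri_at_inj[OF y(1) x(1)] y(2) by simp
  then have \<tau>: "tri r y \<notin> D1" by (simp add: D1_def)
  have D1: "tri r z \<in> D1" if "adjacent r z" "z \<noteq> y" for z
    using that x(3)[of z] tri_at_inj[OF that(1) y(1)] by (auto simp: D1_def)
  have inner1: "inner D1 b" if "inner D b" "b \<notin> tri r y" for b
    using that by (auto simp: inner_def D1_def tri_def)
  have ne: "la r (la r y) \<noteq> r" "la r (la r y) \<noteq> la r y" "la r (la r y) \<noteq> y"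
    using la_neq[OF ay(1)] ring_distinct[OF y(1)] by auto
  have ne': "la y r \<noteq> r" "la y r \<noteq> la r y" "la y r \<noteq> y"
    using la_neq[OF ay(2)] la_neq_swap[OF ay(2)] by auto
  show False
  proof (cases "inner D (la r (la r y))")
    case True
    then have "inner D1 (la r (la r y))" using inner1 ne by (simp add: tri_def)
    moreover have "tri r (la r y) \<in> D1" using D1 ay(1) la_neq[OF y(1)] by blast
    ultimately have "tri (la r y) r \<in> D1" using m.no_door ay(1) by blast
    then show False using \<tau> by (simp add: tri_rot)
  next
    case False
    then have "inner D1 (la y r)" using inner1 ne' inn by (simp add: tri_def)
    moreover have "tri y r \<in> D1" using D1[OF ay(3)] ne' tri_around[OF y(1)] by simp
    ultimately have "tri r y \<in> D1" using m.no_door ay(2) by blast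
    then show False using \<tau> by simp
  qed
qed

lemma all_but_one:
  assumes "adjacent r s" "\<not> inner D r"
    "tri r s \<in> D" "tri r (la r s) \<in> D" "tri r (la r (la r s)) \<in> D" "tri r (la r (la r (la r s))) \<in> D"
    "tri r (la r (la r (la r (la r s)))) \<in> D"
  shows "tri r (la s r) \<notin> D" "adjacent r z \<Longrightarrow> z \<noteq> la s r \<Longrightarrow> tri r z \<in> D"
proof -
  have ls: "la s r = la r (la r (la r (la r (la r s))))" by (rule la_back(2))
  show other: "adjacent r z \<Longrightarrow> z \<noteq> la s r \<Longrightarrow> tri r z \<in> D" for z
    using neighbour_ring[OF assms(1), of z] assms(3-) unfolding ls by auto
  show "tri r (la s r) \<notin> D" using other assms(2) unfolding inner_def by metis
qed

text \<open>Counterclockwise, the neighbours of \<open>r\<close> are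
  \<open>b, c, d, e, f, a\<close>. The star and the tips of \<open>b\<close> supply the four
  triangles at \<open>r\<close> that contain \<open>a\<close>, \<open>b\<close> or \<open>c\<close>;
  only the two opposite \<open>b\<close> are in question. Both cannot be present, as
  \<open>r\<close> is not inner. If exactly one were missing, \<open>r\<close> would have a single
  gap, and shifting gaps at \<open>r\<close> and then at \<open>a\<close> or \<open>c\<close> would
  force the missing triangle to be present after all.\<close>

lemma near_inner:
  assumes r: "\<not> inner D r" and b: "inner D b" "adjacent r b"
  shows "tri r (la r (la r b)) \<notin> D" "tri (la (la b r) r) r \<notin> D"
    "\<not> inner D (la r b)" "\<not> inner D (la b r)"
proof -
  define a c where "a = la b r" "c = la r b"
  define d f where "d = la r c" "f = la a r"
  define e where "e = la r d"
  have rb: "adjacent b r" using b(2) by (rule adj_sym)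
  have adj: "adjacent r a" "adjacent a r" "adjacent r c" "adjacent c r" "adjacent a b" "adjacent b c" "adjacent c b"
    using la_adjacent[OF rb] la_adjacent[OF b(2)] by (auto simp: a_c_def)
  have adj2: "adjacent r d" "adjacent d r" "adjacent c d" "adjacent d c" "adjacent r f" "adjacent f r" "adjacent a f" "adjacent f a"
    using la_adjacent[OF adj(3)] la_adjacent[OF adj(2)] by (auto simp: d_f_def)
  have adj3: "adjacent r e" "adjacent e r" "adjacent d e" "adjacent e d"
    using la_adjacent[OF adj2(1)] by (auto simp: e_def)
  have la: "la r a = b" "la r b = c" "la r c = d" "la r d = e" "la r f = a" "la b r = a" "la c r = b"
    "la a r = f" "la d r = c" "la a b = r" "la c d = r" "la b c = r" "la f a = r"
    by (simp_all add: a_c_def d_f_def e_def la_back(1))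
  have f5: "f = la r (la r (la r (la r b)))" "la r e = f"
  proof -
    have "la b r = la r (la r (la r (la r (la r b))))" by (rule la_back(2))
    then have "la r (la r (la r (la r (la r b)))) = a" by (simp add: la)
    then show "f = la r (la r (la r (la r b)))"
      using la_back(1)[of r "la r (la r (la r (la r b)))"] by (simp add: la)
    then show "la r e = f" by (simp add: la)
  qed
  have D: "tri r a \<in> D" "tri r b \<in> D" "tri r c \<in> D" "tri r f \<in> D"
    using tip[OF b(1) adj(1) la(1)] tip[OF b(1) adj(4) la(7)] innerD[OF b(1,2)] la(8) tri_around[OF adj(1)]
    by (auto simp: tri_def)
  have te: "tri f r = tri r e" using tri_around[OF adj2(5)] f5(2) la_back(1)[of r e] by simp
  have nb: "z \<in> {a, b, c, d, e, f}" if "adjacent r z" for z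
    using neighbour_ring[OF adj(1) that] unfolding la f5(2) .
  have not_all: "\<not> (tri r d \<in> D \<and> tri r e \<in> D)"
  proof
    assume "tri r d \<in> D \<and> tri r e \<in> D"
    then have "inner D r" unfolding inner_def using nb D by blast
    then show False using r by simp
  qed
  have ring6: "distinct [r, a, b, c, d, e, f]"
    using ring_distinct[OF adj(1)] unfolding la f5(2) .
  have no_e: "tri r e \<in> D" if "tri r d \<in> D"
  proof (rule ccontr)
    assume e: "tri r e \<notin> D"
    have others: "tri r z \<in> D" if "adjacent r z" "z \<noteq> e" for z
      using nb[OF that(1)] that(2) D \<open>tri r d \<in> D\<close> by blast
    \<comment> \<open>Shifting the gap of \<open>r\<close> to \<open>tri r f\<close> would expose
      the inner cell \<open>b\<close>, so the triangle beyond the edge \<open>fa\<close> must be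
      present.\<close>
    have af: "tri a f \<in> D"
      using no_exchange[OF adj3(1) e others adj2(5)] ring6 b(1) unfolding la by auto
    show False
    proof (cases "inner D a")
      case True
      then show False using tip(2)[OF True adj2(5) la(5)] te e by simp
    next
      case False
      \<comment> \<open>Now \<open>a\<close> also has five of its six triangles. Its gap could be
        shifted next to \<open>b\<close>, which forces the triangle that was assumed to be
        missing.\<close>
      define g where "g = la b a"
      have ab: "adjacent b a" using adj(5) by (rule adj_sym)
      have ag: "adjacent g a" "adjacent a g" "la a g = b"
        using la_adjacent[OF ab] by (auto simp: g_def)
      have t: "tri g a \<in> D" "tri a g \<in> D" "tri a b \<in> D"
        using tip[OF b(1) ag(2,3)] innerD[OF b(1) adj(5)] by (auto simp: tri_def)
      define h where "h = la g a"
      have ah: "adjacent a h" "la a h = g" using la_adjacent[OF ag(1)] by (auto simp: h_def)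
      have th: "tri a h \<in> D" using t(1) by (simp add: h_def tri_rot)
      have Daf: "tri a r \<in> D" using D(4) by (metis la(8) tri_rot(1) tri_around[OF adj2(5)] la(5) tri_rot(2))
      have l6: "la f a = r" using la by simp
      have x: "tri a (la h a) \<notin> D" "\<And>z. adjacent a z \<Longrightarrow> z \<noteq> la h a \<Longrightarrow> tri a z \<in> D"
        using all_but_one[OF ah(1) False, unfolded ah(2) ag(3) la, OF th t(2,3) Daf af] by blast+
      have xa: "adjacent a (la h a)" using la_adjacent(3)[OF adj_sym[OF ah(1)]] .
      have "r \<noteq> la h a" using x(1) Daf by auto
      then have "tri (la a r) r \<in> D"
        using no_exchange[OF xa x adj(2)] b(1) unfolding la by blast
      then show False using te e la by simp
    qed
  qed
  have no_d: "tri r d \<in> D" if "tri r e \<in> D"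
  proof (rule ccontr)
    assume d: "tri r d \<notin> D"
    have others: "tri r z \<in> D" if "adjacent r z" "z \<noteq> d" for z
      using nb[OF that(1)] that(2) D \<open>tri r e \<in> D\<close> by blast
    have dc: "tri d c \<in> D"
      using no_exchange[OF adj2(1) d others adj(3)] ring6 b(1) unfolding la by auto
    show False
    proof (cases "inner D c")
      case True
      then show False using tip(2)[OF True adj2(2) la(9)] d by simp
    next
      case False
      define g where "g = la c b"
      have cg: "adjacent c g" "adjacent g c" "la g c = b"
        using la_adjacent[OF adj(7)] by (auto simp: g_def la_back(1))
      have t: "tri c g \<in> D" "tri c b \<in> D" "tri c r \<in> D"
        using tip[OF b(1) cg(2,3)] innerD[OF b(1) adj(7)] innerD[OF b(1) adj(4)] la by (auto simp: tri_def)
      define h where "h = la d c"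
      have ch: "adjacent c h" "la c h = d" using la_adjacent[OF adj2(4)] by (auto simp: h_def)
      have th: "tri c h \<in> D" using dc by (simp add: h_def tri_rot)
      have tcd: "tri c d \<in> D" using D(3) tri_rot(1)[of c r] la by simp
      have x: "tri c (la h c) \<notin> D" "\<And>z. adjacent c z \<Longrightarrow> z \<noteq> la h c \<Longrightarrow> tri c z \<in> D"
        using all_but_one[OF ch(1) False, unfolded ch(2) la, OF th tcd t(3) t(2) t(1)[unfolded g_def]]
        by blast+
      have xc: "adjacent c (la h c)" using la_adjacent(3)[OF adj_sym[OF ch(1)]] .
      have "d \<noteq> la h c" using x(1) tcd by auto
      then have "tri (la c d) d \<in> D"
        using no_exchange[OF xc x adj2(3)] b(1) unfolding la by blast
      then show False using d la by simp
    qed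
  qed
  show "tri r (la r (la r b)) \<notin> D" using no_e not_all la by auto
  show te': "tri (la (la b r) r) r \<notin> D" using no_d not_all la te by auto
  show "\<not> inner D (la r b)"
  proof
    assume "inner D (la r b)"
    then have "tri r d \<in> D" using tip(2)[OF _ adj2(2) la(9)] la by simp
    then show False using no_e not_all by blast
  qed
  show "\<not> inner D (la b r)"
  proof
    assume "inner D (la b r)"
    then have "tri f r \<in> D" using tip(2)[OF _ adj2(5) la(5)] la by simp
    then show False using te no_d not_all by auto
  qed
qed

text \<open>An inner cell with extreme first coordinate has a neighbour that is not inner, and
  \<open>near_inner\<close> passes this on around its whole ring. Its six triangles and their six
  tips are then closed under dual steps, hence all of \<open>D\<close>, and their corners are the 13
  cells of a Star of David.\<close>

lemma inner_imp_star:
  assumes "inner D b0"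
  shows "\<exists>c. B = star_of_david c"
proof -
  have fin: "finite (\<Union>D)"
  proof -
    have "finite t" if "t \<in> D" for t
      using that good by (auto simp: good_def lat_def tri_def)
    moreover have "finite D" using good by (simp add: good_def)
    ultimately show ?thesis by blast
  qed
  have sub: "{v. inner D v} \<subseteq> \<Union>D"
  proof
    fix v assume "v \<in> {v. inner D v}"
    then have "tri v (v + (1, 0)) \<in> D" by (simp add: inner_def adjacent_def)
    then show "v \<in> \<Union>D" by (auto simp: tri_def)
  qed
  then have fin': "finite {v. inner D v}" using fin finite_subset by blast
  define M where "M = Max (fst ` {v. inner D v})"
  have "M \<in> fst ` {v. inner D v}" unfolding M_def using fin' assms by (intro Max_in) auto
  then obtain b where "inner D b" "fst b = M" by auto
  moreover have "fst v \<le> M" if "inner D v" for v unfolding M_def using fin' that by (intro Max_ge) auto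
  ultimately have b: "inner D b" "\<And>v. inner D v \<Longrightarrow> fst v \<le> fst b" by auto
  define r0 where "r0 = b + (1, 0)"
  have r0: "adjacent b r0" "\<not> inner D r0" using b(2)[of r0] by (auto simp: r0_def adjacent_def)
  have ring: "\<not> inner D (ring b r0 i)" for i
  proof (induction i)
    case (Suc i)
    have "adjacent (ring b r0 i) b" using ring_adjacent[OF r0(1)] adj_sym by blast
    then show ?case using near_inner(4)[OF Suc b(1)] by (simp add: ring_Suc)
  qed (simp add: r0)
  have nbr: "\<not> inner D y" if "adjacent b y" for y
    using neighbour_ringE[OF r0(1) that] ring by metis
  define S where "S = {tri b y | y. adjacent b y} \<union> {tri (la b y) y | y. adjacent b y}"
  have SD: "S \<subseteq> D"
  proof
    fix t assume "t \<in> S"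
    then obtain y where y: "adjacent b y" "t = tri b y \<or> t = tri (la b y) y" by (auto simp: S_def)
    then show "t \<in> D" using tip[OF b(1) la_adjacent(3)[OF y(1)]] b(1) by (auto simp: inner_def)
  qed
  \<comment> \<open>The only ways out of the twelve triangles are the two outer edges of each tip,
    and beyond these \<open>near_inner\<close> has excluded every triangle.\<close>
  have step: "t' \<in> S" if tS: "t \<in> S" and tt: "(t', t) \<in> dual (inn D)" for t t'
  proof -
    obtain y where y: "adjacent b y" "t = tri b y \<or> t = tri (la b y) y" using tS by (auto simp: S_def)
    define y' where "y' = la b y"
    have ay: "adjacent b y'" "adjacent y y'" "adjacent y' y" "adjacent y b" "adjacent y' b"
      using la_adjacent[OF y(1)] y(1) adj_sym by (auto simp: y'_def)
    show ?thesis
      using y(2)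
    proof
      assume "t = tri b y"
      then consider "t' = tri y b" | "t' = tri (la b y) y" | "t' = tri b (la b y)"
        using dual_nbrs(2)[of t' b y D] tt y(1) by auto
      then show ?thesis
      proof cases
        case 1
        then have "t' = tri b (la y b)" using tri_around[OF y(1)] by simp
        then show ?thesis using la_adjacent(3)[OF ay(4)] unfolding S_def by blast
      next
        case 2 then show ?thesis using y(1) unfolding S_def by blast
      next
        case 3 then show ?thesis using ay(1) unfolding S_def y'_def by blast
      qed
    next
      assume t: "t = tri (la b y) y"
      have t'D: "t' \<in> D" using dual_nbrs(1)[of t' y' y D] tt t ay(3) by (simp add: y'_def)
      consider "t' = tri y y'" | "t' = tri (la y' y) y" | "t' = tri y' (la y' y)"
        using dual_nbrs(2)[of t' y' y D] tt t ay(3) by (auto simp: y'_def)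
      then show ?thesis
      proof cases
        case 1
        then have "t' = tri b y" by (simp add: y'_def tri_rot)
        then show ?thesis using y(1) unfolding S_def by blast
      next
        case 2
        then show ?thesis using near_inner(2)[OF nbr[OF y(1)] b(1) ay(4)] t'D by (simp add: y'_def)
      next
        case 3
        have "la y' b = y" by (simp add: y'_def la_back(1))
        then show ?thesis using near_inner(1)[OF nbr[OF ay(1)] b(1) ay(5)] t'D 3 by simp
      qed
    qed
  qed
  have "tri b r0 \<in> S" using r0(1) by (auto simp: S_def)
  have "t \<in> S" if "t \<in> D" for t
  proof -
    have "(t, tri b r0) \<in> (dual (inn D))\<^sup>*"
      using linkedD[of D t "tri b r0"] good that SD \<open>tri b r0 \<in> S\<close> by (auto simp: good_def)
    then show ?thesis using \<open>tri b r0 \<in> S\<close> step by (induction rule: converse_rtrancl_induct) auto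
  qed
  then have "D = S" using SD by blast
  then have B: "B = \<Union>S" using good by (simp add: good_def)
  have "\<Union>S = star_of_david b"
  proof (intro equalityI subsetI)
    fix v assume "v \<in> \<Union>S"
    then obtain y where y: "adjacent b y" "v \<in> tri b y \<or> v \<in> tri (la b y) y" by (auto simp: S_def)
    define y' where "y' = la b y"
    have ay: "adjacent b y'" "adjacent y y'" "adjacent y' y" using la_adjacent[OF y(1)] by (auto simp: y'_def)
    have "v \<in> {b, y, y', la y' y}" using y(2) by (auto simp: tri_def y'_def)
    moreover have "la y' y \<in> star_of_david b"
      using y(1) ay la_adjacent[OF ay(3)] unfolding star_of_david_def by blast
    ultimately show "v \<in> star_of_david b" using y(1) ay by (auto simp: star_of_david_def)
  next
    fix v assume "v \<in> star_of_david b"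
    then consider "v = b" | "adjacent b v"
      | u w where "adjacent b u" "adjacent b w" "adjacent u w" "adjacent v u" "adjacent v w"
      unfolding star_of_david_def by blast
    then show "v \<in> \<Union>S"
    proof cases
      case 1 then show ?thesis using r0(1) unfolding S_def by (auto simp: tri_def)
    next
      case 2
      then have "tri b v \<in> S" by (auto simp: S_def)
      moreover have "v \<in> tri b v" by (simp add: tri_def)
      ultimately show ?thesis by blast
    next
      case 3
      have main: "v \<in> \<Union>S" if u: "adjacent b u" and w: "w = la b u" and v: "adjacent v u" "adjacent v w" for u w
      proof -
        have uw: "adjacent u w" using la_adjacent[OF u] w by simp
        have "v = la u w \<or> v = la w u" using clique_la[OF uw] v adj_sym by blast
        moreover have "la u w = b" using w by simp
        ultimately have "v \<in> tri b u \<or> v \<in> tri w u" by (auto simp: tri_def)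
        moreover have "tri b u \<in> S" "tri w u \<in> S" using u w by (auto simp: S_def)
        ultimately show ?thesis by blast
      qed
      have "w = la b u \<or> w = la u b" using clique_la 3 by blast
      then show ?thesis
      proof
        assume "w = la b u" then show ?thesis using main[of u w] 3 by blast
      next
        assume "w = la u b"
        then have "u = la b w" by (simp add: la_back(1))
        then show ?thesis using main[of w u] 3 by blast
      qed
    qed
  qed
  then show ?thesis using B by blast
qed

end


section \<open>Geometry of the hexagonal cells\<close>

text \<open>The centroid of a lattice triangle is the corner shared by its three hexagons.\<close>

abbreviation hv :: "cell \<Rightarrow> cell \<Rightarrow> cell \<Rightarrow> complex" where
  "hv p q s \<equiv> (cell_center p + cell_center q + cell_center s) / 3"

lemma cell_center_pair: "cell_center (a, b) = Complex (of_int a + of_int b / 2) (of_int b * (sqrt 3 / 2))"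
  by (simp add: cell_center_def complex_eq_iff cos_60 sin_60)

lemma hexagon_corners:
  "cell_center c + of_real (1 / sqrt 3) * cis (pi / 6 + of_nat k * (pi / 3)) =
   cell_center c + (cell_center ((rot60 ^^ k) (1, 0)) + cell_center ((rot60 ^^ Suc k) (1, 0))) / 3"
proof -
  have rot: "cell_center ((rot60 ^^ k) (1, 0)) = cis (of_nat k * (pi / 3))" for k
    by (induction k) (auto simp: cell_center_rot60 cis_mult algebra_simps add_divide_distrib cell_center_def[of "(1, 0)"])
  have a: "cis (pi / 6 + of_nat k * (pi / 3)) = cis (of_nat k * (pi / 3)) * cis (pi / 6)"
    by (simp add: cis_mult add.commute)
  have c: "of_real (1 / sqrt 3) * cis (pi / 6) = (1 + cis (pi / 3)) / 3"
    by (simp add: complex_eq_iff cos_30 sin_30 cos_60 sin_60 real_div_sqrt divide_simps)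
  have "of_real (1 / sqrt 3) * cis (pi / 6 + of_nat k * (pi / 3)) =
      cis (of_nat k * (pi / 3)) * (of_real (1 / sqrt 3) * cis (pi / 6))"
    by (simp only: a mult.left_commute)
  also have "\<dots> = cis (of_nat k * (pi / 3)) * ((1 + cis (pi / 3)) / 3)"
    by (simp only: c)
  also have "\<dots> = (cis (of_nat k * (pi / 3)) + cis (of_nat (Suc k) * (pi / 3))) / 3"
    by (simp add: cis_mult algebra_simps add_divide_distrib)
  finally show ?thesis using rot[of k] rot[of "Suc k"] by simp
qed

lemma rot60_funpow_dirs:
  assumes "adjacent x z"
  shows "\<exists>k < 6. z - x = (rot60 ^^ k) (1, 0)"
proof -
  have "(rot60 ^^ 0) (1, 0) = (1, 0)" "(rot60 ^^ 1) (1, 0) = (0, 1)" "(rot60 ^^ 2) (1, 0) = (-1, 1)"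
    "(rot60 ^^ 3) (1, 0) = (-1, 0)" "(rot60 ^^ 4) (1, 0) = (0, -1)" "(rot60 ^^ 5) (1, 0) = (1, -1)"
    by (simp_all add: numeral_eq_Suc rot60_def)
  then have "z - x \<in> {(rot60 ^^ 0) (1, 0), (rot60 ^^ 1) (1, 0), (rot60 ^^ 2) (1, 0),
      (rot60 ^^ 3) (1, 0), (rot60 ^^ 4) (1, 0), (rot60 ^^ 5) (1, 0)}"
    using assms unfolding adjacent_def by simp
  moreover have "(0::nat) < 6" "(1::nat) < 6" "(2::nat) < 6" "(3::nat) < 6" "(4::nat) < 6" "(5::nat) < 6"
    by simp_all
  ultimately show ?thesis by blast
qed

lemma adjacent_rot: "adjacent x (x + (rot60 ^^ k) (1, 0))"
proof -
  have "adjacent (0, 0) ((rot60 ^^ k) (1, 0))"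
  proof (induction k)
    case (Suc k)
    then show ?case using la_adjacent(1)[OF Suc] by (simp add: la_def zero_prod_def[symmetric])
  qed (simp add: adjacent_coords)
  then show ?thesis by (simp add: adjacent_def zero_prod_def[symmetric])
qed

lemma hexagon_eq:
  "hexagon x = convex hull {hv x z (la x z) | z. adjacent x z}"
proof -
  have "{cell_center x + of_real (1 / sqrt 3) * cis (pi / 6 + of_nat k * (pi / 3)) | k. k < (6::nat)}
    = {hv x z (la x z) | z. adjacent x z}" (is "?L = ?R")
  proof (intro set_eqI iffI)
    fix w assume "w \<in> ?L"
    then obtain k where k: "k < (6::nat)"
      and "w = cell_center x + of_real (1 / sqrt 3) * cis (pi / 6 + of_nat k * (pi / 3))"
      by blast
    then have w: "w = cell_center x + (cell_center ((rot60 ^^ k) (1, 0)) + cell_center ((rot60 ^^ Suc k) (1, 0))) / 3"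
      by (simp only: hexagon_corners)
    define z where "z = x + (rot60 ^^ k) (1, 0)"
    have "la x z = x + (rot60 ^^ Suc k) (1, 0)" by (simp add: la_def z_def)
    then have "w = hv x z (la x z)"
      by (simp add: w z_def cell_center_def algebra_simps add_divide_distrib)
    then show "w \<in> ?R" using adjacent_rot[of x k] by (auto simp: z_def)
  next
    fix w assume "w \<in> ?R"
    then obtain z where z: "adjacent x z" "w = hv x z (la x z)" by blast
    then obtain k where k: "k < 6" "z - x = (rot60 ^^ k) (1, 0)" using rot60_funpow_dirs by blast
    then have zk: "z = x + (rot60 ^^ k) (1, 0)" by (metis diff_add_cancel add.commute)
    then have "la x z = x + (rot60 ^^ Suc k) (1, 0)" by (simp add: la_def)
    then have "w = cell_center x + (cell_center ((rot60 ^^ k) (1, 0)) + cell_center ((rot60 ^^ Suc k) (1, 0))) / 3"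
      by (simp add: z(2) zk cell_center_def algebra_simps add_divide_distrib del: funpow.simps)
    then show "w \<in> ?L" using k(1) unfolding hexagon_corners by blast
  qed
  then show ?thesis by (simp add: hexagon_def)
qed

lemma convex_hexagon: "convex (hexagon c)"
  by (simp add: hexagon_def)

lemma compact_hexagon: "compact (hexagon c)"
proof -
  have "finite {cell_center c + of_real (1 / sqrt 3) * cis (pi / 6 + of_nat k * (pi / 3)) | k. k < (6::nat)}"
    by (rule finite_image_set) simp
  then show ?thesis unfolding hexagon_def
    by (intro compact_convex_hull finite_imp_compact)
qed

lemma corner_in_hexagon:
  "adjacent x z \<Longrightarrow> hv x z (la x z) \<in> hexagon x"
  unfolding hexagon_eq by (intro hull_inc) blast

lemma tri_corner_in_hexagons:
  assumes "adjacent x z"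
  shows "hv x z (la x z) \<in> hexagon x" "hv x z (la x z) \<in> hexagon z" "hv x z (la x z) \<in> hexagon (la x z)"
  using corner_in_hexagon[OF assms] corner_in_hexagon[OF la_adjacent(3)[OF assms]]
    corner_in_hexagon[OF la_adjacent(2)[OF assms]]
  by (simp_all add: add_ac)

lemma hexagon_radius:
  assumes "z \<in> hexagon c" shows "dist (cell_center c) z \<le> 1 / sqrt 3"
proof -
  have "{cell_center c + of_real (1 / sqrt 3) * cis (pi / 6 + of_nat k * (pi / 3)) | k. k < (6::nat)}
    \<subseteq> cball (cell_center c) (1 / sqrt 3)"
    by (auto simp: dist_norm norm_mult norm_divide)
  then have "hexagon c \<subseteq> cball (cell_center c) (1 / sqrt 3)"
    unfolding hexagon_def by (rule hull_minimal) simp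
  then show ?thesis using assms by auto
qed

lemma dist_centers:
  "(dist (cell_center (a, b)) (cell_center (c, d)))\<^sup>2 =
    of_int ((c - a) * (c - a) + (c - a) * (d - b) + (d - b) * (d - b))"
  unfolding dist_norm cmod_power2
  by (simp add: cell_center_pair power2_eq_square field_simps)

text \<open>The circumradius is \<open>1 / sqrt 3\<close>, so the squared distance of the centres is
  at most \<open>4 / 3\<close>. It is an integer, namely a value of the form
  \<open>x * x + x * y + y * y\<close>, and hence 0 or 1.\<close>

lemma hexagons_meet:
  assumes "z \<in> hexagon c" "z \<in> hexagon d"
  shows "c = d \<or> adjacent c d"
proof -
  obtain a b a' b' where cd: "c = (a, b)" "d = (a', b')" by fastforce
  define x y where "x = a' - a" "y = b' - b"
  have "dist (cell_center c) (cell_center d) \<le> dist (cell_center c) z + dist (cell_center d) z"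
    by (metis dist_commute dist_triangle)
  then have le: "dist (cell_center c) (cell_center d) \<le> 2 / sqrt 3"
    using hexagon_radius[OF assms(1)] hexagon_radius[OF assms(2)] by simp
  have "(dist (cell_center c) (cell_center d))\<^sup>2 \<le> (2 / sqrt 3)\<^sup>2"
    by (rule power_mono[OF le]) simp
  then have "real_of_int (x * x + x * y + y * y) \<le> 4 / 3"
    unfolding cd dist_centers x_y_def by (simp add: power_divide)
  then have le1: "x * x + x * y + y * y \<le> 1" by linarith
  show ?thesis
  proof (cases "x * x + x * y + y * y = 1")
    case True
    then have "(dist (cell_center c) (cell_center d))\<^sup>2 = 1"
      unfolding cd dist_centers x_y_def by simp
    then have "dist (cell_center c) (cell_center d) = 1"
      by (simp add: power2_eq_1_iff) (smt (verit) zero_le_dist)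
    then show ?thesis by (simp add: adjacent_iff_dist)
  next
    case False
    then have le0: "x * x + x * y + y * y \<le> 0" using le1 by linarith
    have gen: "X = 0" "Y = 0" if "X + Y + Z \<le> 0" "0 \<le> X" "0 \<le> Y" "0 \<le> Z" for X Y Z :: int
      using that by arith+
    have "x * x + y * y + (x + y) * (x + y) \<le> 0" using le0 by (simp add: algebra_simps)
    then have "x * x = 0" "y * y = 0"
      using gen[of "x * x" "y * y" "(x + y) * (x + y)"] zero_le_square[of x] zero_le_square[of y]
        zero_le_square[of "x + y"] by blast+
    then have "x = 0" "y = 0" by simp_all
    then show ?thesis by (simp add: cd x_y_def)
  qed
qed

lemma center_in_hexagon: "cell_center c \<in> hexagon c"
proof -
  define u where "u = hv c (c + (1, 0)) (la c (c + (1, 0)))"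
  define v where "v = hv c (c + (-1, 0)) (la c (c + (-1, 0)))"
  have "u \<in> hexagon c" "v \<in> hexagon c"
    unfolding u_def v_def by (rule corner_in_hexagon; simp add: adjacent_def)+
  then have "(1 / 2) *\<^sub>R u + (1 / 2) *\<^sub>R v \<in> hexagon c"
    by (intro convexD[OF convex_hexagon]) auto
  moreover have "(1 / 2) *\<^sub>R u + (1 / 2) *\<^sub>R v = cell_center c"
    by (cases c) (simp add: u_def v_def la_coords cell_center_pair complex_eq_iff field_simps)
  ultimately show ?thesis by simp
qed

lemma edge_midpoint_in_hexagon:
  assumes "adjacent x z"
  shows "(cell_center x + cell_center z) / 2 \<in> hexagon x"
proof -
  define u where "u = hv x z (la x z)"
  define v where "v = hv x (la z x) (la x (la z x))"
  have zz: "la x (la z x) = z" by simp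
  have "u \<in> hexagon x" "v \<in> hexagon x"
    using corner_in_hexagon[OF assms] corner_in_hexagon[of x "la z x"] la_adjacent[of z x] assms
    unfolding u_def v_def by (auto simp: adjacent_sym)
  then have "(1 / 2) *\<^sub>R u + (1 / 2) *\<^sub>R v \<in> hexagon x"
    by (intro convexD[OF convex_hexagon]) auto
  moreover have "(1 / 2) *\<^sub>R u + (1 / 2) *\<^sub>R v = (cell_center x + cell_center z) / 2"
    unfolding u_def v_def zz
    by (cases x; cases z) (simp add: la_coords cell_center_pair complex_eq_iff field_simps)
  ultimately show ?thesis by simp
qed

text \<open>The points of a lattice triangle with largest barycentric coordinate at \<open>x\<close>
  form the kite on \<open>x\<close>, two edge midpoints and the centroid. Its diagonal from
  \<open>x\<close> splits it into the two triangles of the case distinction.\<close>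

lemma kite_in_hexagon:
  assumes xz: "adjacent x z" and ab: "0 \<le> \<beta>" "0 \<le> \<gamma>" "2 * \<beta> + \<gamma> \<le> 1" "\<beta> + 2 * \<gamma> \<le> 1"
  shows "(1 - \<beta> - \<gamma>) *\<^sub>R cell_center x + \<beta> *\<^sub>R cell_center z + \<gamma> *\<^sub>R cell_center (la x z) \<in> hexagon x"
proof -
  define m where "m = (cell_center x + cell_center z) / 2"
  define m' where "m' = (cell_center x + cell_center (la x z)) / 2"
  define g where "g = hv x z (la x z)"
  have in_hex: "m \<in> hexagon x" "m' \<in> hexagon x" "g \<in> hexagon x" "cell_center x \<in> hexagon x"
    unfolding m_def m'_def g_def
    using edge_midpoint_in_hexagon[OF xz] edge_midpoint_in_hexagon[OF la_adjacent(1)[OF xz]]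
      corner_in_hexagon[OF xz] center_in_hexagon by auto
  have three: "a *\<^sub>R p + b *\<^sub>R q + c *\<^sub>R r \<in> hexagon x"
    if pqr: "p \<in> hexagon x" "q \<in> hexagon x" "r \<in> hexagon x" and abc: "a \<ge> 0" "b \<ge> 0" "c \<ge> 0" "a + b + c = 1"
    for a b c :: real and p q r
  proof -
    have "a *\<^sub>R p + b *\<^sub>R q + c *\<^sub>R r \<in> convex hull {p, q, r}"
      using abc unfolding convex_hull_3 by blast
    also have "convex hull {p, q, r} \<subseteq> hexagon x"
      using pqr convex_hexagon by (intro hull_minimal) auto
    finally show ?thesis .
  qed
  show ?thesis
  proof (cases "\<gamma> \<le> \<beta>")
    case True
    have "(1 - 2 * \<beta> - \<gamma>) *\<^sub>R cell_center x + (2 * (\<beta> - \<gamma>)) *\<^sub>R m + (3 * \<gamma>) *\<^sub>R g \<in> hexagon x"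
      using in_hex ab True by (intro three) auto
    moreover have "(1 - 2 * \<beta> - \<gamma>) *\<^sub>R cell_center x + (2 * (\<beta> - \<gamma>)) *\<^sub>R m + (3 * \<gamma>) *\<^sub>R g =
      (1 - \<beta> - \<gamma>) *\<^sub>R cell_center x + \<beta> *\<^sub>R cell_center z + \<gamma> *\<^sub>R cell_center (la x z)"
      by (simp add: m_def g_def complex_eq_iff field_simps)
    ultimately show ?thesis by simp
  next
    case False
    have "(1 - \<beta> - 2 * \<gamma>) *\<^sub>R cell_center x + (2 * (\<gamma> - \<beta>)) *\<^sub>R m' + (3 * \<beta>) *\<^sub>R g \<in> hexagon x"
      using in_hex ab False by (intro three) auto
    moreover have "(1 - \<beta> - 2 * \<gamma>) *\<^sub>R cell_center x + (2 * (\<gamma> - \<beta>)) *\<^sub>R m' + (3 * \<beta>) *\<^sub>R g =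
      (1 - \<beta> - \<gamma>) *\<^sub>R cell_center x + \<beta> *\<^sub>R cell_center z + \<gamma> *\<^sub>R cell_center (la x z)"
      by (simp add: m'_def g_def complex_eq_iff field_simps)
    ultimately show ?thesis by simp
  qed
qed

lemma triangle_covered:
  assumes "adjacent x z" "0 \<le> \<alpha>" "0 \<le> \<beta>" "0 \<le> \<gamma>" "\<alpha> + \<beta> + \<gamma> = 1"
  shows "\<exists>c. \<alpha> *\<^sub>R cell_center x + \<beta> *\<^sub>R cell_center z + \<gamma> *\<^sub>R cell_center (la x z) \<in> hexagon c"
    (is "\<exists>c. ?p \<in> _")
proof -
  consider "\<beta> \<le> \<alpha>" "\<gamma> \<le> \<alpha>" | "\<alpha> \<le> \<beta>" "\<gamma> \<le> \<beta>" | "\<alpha> \<le> \<gamma>" "\<beta> \<le> \<gamma>" by linarith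
  then show ?thesis
  proof cases
    case 1
    have e: "1 - \<beta> - \<gamma> = \<alpha>" using assms(5) by simp
    have "?p \<in> hexagon x" using kite_in_hexagon[OF assms(1), of \<beta> \<gamma>] assms 1 unfolding e by auto
    then show ?thesis by blast
  next
    case 2
    have e: "1 - \<gamma> - \<alpha> = \<beta>" using assms(5) by simp
    have "?p \<in> hexagon z"
      using kite_in_hexagon[OF la_adjacent(3)[OF assms(1)], of \<gamma> \<alpha>] assms 2
      unfolding e by (auto simp: add_ac)
    then show ?thesis by blast
  next
    case 3
    have e: "1 - \<alpha> - \<beta> = \<gamma>" using assms(5) by simp
    have "?p \<in> hexagon (la x z)"
      using kite_in_hexagon[OF la_adjacent(2)[OF assms(1)], of \<alpha> \<beta>] assms 3
      unfolding e by (auto simp: add_ac)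
    then show ?thesis by blast
  qed
qed

text \<open>The integer parts of the axial coordinates single out a unit rhombus, which a diagonal
  cuts into two lattice triangles. The fractional parts yield barycentric coordinates in one of
  them.\<close>

lemma hexagons_cover: "\<exists>c. z \<in> hexagon c"
proof -
  define t where "t = Im z * 2 / sqrt 3"
  define s where "s = Re z - t / 2"
  have im: "Im z = t * (sqrt 3 / 2)" by (simp add: t_def)
  have re: "Re z = s + t / 2" by (simp add: s_def)
  define a b where "a = \<lfloor>s\<rfloor>" "b = \<lfloor>t\<rfloor>"
  define \<beta> \<gamma> where "\<beta> = s - a" "\<gamma> = t - b"
  have bg: "0 \<le> \<beta>" "\<beta> \<le> 1" "0 \<le> \<gamma>" "\<gamma> \<le> 1"
    unfolding \<beta>_\<gamma>_def a_b_def by linarith+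
  show ?thesis
  proof (cases "\<beta> + \<gamma> \<le> 1")
    case True
    have "z = (1 - \<beta> - \<gamma>) *\<^sub>R cell_center (a, b) + \<beta> *\<^sub>R cell_center (a + 1, b)
        + \<gamma> *\<^sub>R cell_center (la (a, b) (a + 1, b))"
      by (simp add: la_coords cell_center_pair complex_eq_iff im re \<beta>_\<gamma>_def field_simps)
    moreover have "adjacent (a, b) (a + 1, b)" by (simp add: adjacent_coords)
    ultimately show ?thesis
      using triangle_covered[of "(a, b)" "(a + 1, b)" "1 - \<beta> - \<gamma>" \<beta> \<gamma>] bg True by auto
  next
    case False
    have "z = (\<beta> + \<gamma> - 1) *\<^sub>R cell_center (a + 1, b + 1) + (1 - \<beta>) *\<^sub>R cell_center (a, b + 1)
        + (1 - \<gamma>) *\<^sub>R cell_center (la (a + 1, b + 1) (a, b + 1))"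
      by (simp add: la_coords cell_center_pair complex_eq_iff im re \<beta>_\<gamma>_def field_simps)
    moreover have "adjacent (a + 1, b + 1) (a, b + 1)" by (simp add: adjacent_coords)
    ultimately show ?thesis
      using triangle_covered[of "(a + 1, b + 1)" "(a, b + 1)" "\<beta> + \<gamma> - 1" "1 - \<beta>" "1 - \<gamma>"] bg False
      by auto
  qed
qed

lemma finite_close_hexagons: "finite {c. hexagon c \<inter> cball 0 r \<noteq> {}}"
proof -
  have "{c. hexagon c \<inter> cball 0 r \<noteq> {}} \<subseteq> {-\<lceil>3 * \<bar>r\<bar> + 3\<rceil>..\<lceil>3 * \<bar>r\<bar> + 3\<rceil>} \<times> {-\<lceil>3 * \<bar>r\<bar> + 3\<rceil>..\<lceil>3 * \<bar>r\<bar> + 3\<rceil>}"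
  proof
    fix c assume "c \<in> {c. hexagon c \<inter> cball 0 r \<noteq> {}}"
    then obtain z where z: "z \<in> hexagon c" "norm z \<le> r" by auto
    obtain a b where c: "c = (a, b)" by fastforce
    have "1 / sqrt 3 \<le> (1::real)" by simp
    then have "norm (cell_center c) \<le> r + 1"
      using hexagon_radius[OF z(1), unfolded dist_norm] z(2) norm_triangle_sub[of "cell_center c" z]
      by linarith
    then have n: "\<bar>Re (cell_center c)\<bar> \<le> r + 1" "\<bar>Im (cell_center c)\<bar> \<le> r + 1"
      using abs_Re_le_cmod[of "cell_center c"] abs_Im_le_cmod[of "cell_center c"] by linarith+
    have s: "sqrt 3 \<ge> (1::real)" by simp
    have "\<bar>real_of_int b\<bar> * 1 \<le> \<bar>real_of_int b\<bar> * sqrt 3" using s by (intro mult_left_mono) auto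
    then have b: "\<bar>real_of_int b\<bar> \<le> 2 * (r + 1)"
      using n(2) by (simp add: c cell_center_pair abs_mult)
    have a: "\<bar>real_of_int a\<bar> \<le> 3 * (r + 1)"
      using n(1) b by (simp add: c cell_center_pair)
    have "\<bar>real_of_int a\<bar> \<le> 3 * \<bar>r\<bar> + 3" by (rule order_trans[OF a]) simp
    moreover have "\<bar>real_of_int b\<bar> \<le> 3 * \<bar>r\<bar> + 3"
      by (rule order_trans[OF b]) (use abs_ge_self[of r] abs_ge_zero[of r] in argo)
    moreover have "3 * \<bar>r\<bar> + 3 \<le> of_int \<lceil>3 * \<bar>r\<bar> + 3\<rceil>" by (rule le_of_int_ceiling)
    ultimately have "\<bar>real_of_int a\<bar> \<le> of_int \<lceil>3 * \<bar>r\<bar> + 3\<rceil>" "\<bar>real_of_int b\<bar> \<le> of_int \<lceil>3 * \<bar>r\<bar> + 3\<rceil>"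
      by (blast intro: order_trans)+
    then have "\<bar>a\<bar> \<le> \<lceil>3 * \<bar>r\<bar> + 3\<rceil>" "\<bar>b\<bar> \<le> \<lceil>3 * \<bar>r\<bar> + 3\<rceil>"
      unfolding of_int_abs[symmetric] of_int_le_iff by blast+
    then show "c \<in> {-\<lceil>3 * \<bar>r\<bar> + 3\<rceil>..\<lceil>3 * \<bar>r\<bar> + 3\<rceil>} \<times> {-\<lceil>3 * \<bar>r\<bar> + 3\<rceil>..\<lceil>3 * \<bar>r\<bar> + 3\<rceil>}"
      by (simp add: c abs_le_iff minus_le_iff)
  qed
  then show ?thesis by (rule finite_subset) simp
qed

text \<open>\<open>K\<close> may be infinite, as it is for the cells outside a board. Local
  finiteness helps: near a given point only finitely many hexagons matter.\<close>

lemma closed_hexagons: "closed (\<Union>c\<in>K. hexagon c)"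
proof -
  have "z \<in> (\<Union>c\<in>K. hexagon c)" if z: "z \<in> closure (\<Union>c\<in>K. hexagon c)" for z
  proof -
    define F where "F = {c \<in> K. hexagon c \<inter> cball 0 (norm z + 1) \<noteq> {}}"
    have "finite F" using finite_close_hexagons[of "norm z + 1"] by (rule rev_finite_subset) (auto simp: F_def)
    then have closed: "closed (\<Union>c\<in>F. hexagon c)" by (intro closed_UN) (auto intro: compact_imp_closed compact_hexagon)
    have "\<exists>y\<in>\<Union>c\<in>F. hexagon c. dist y z < e" if e: "e > 0" for e
    proof -
      have "min e 1 > 0" using e by simp
      then obtain y where y: "y \<in> (\<Union>c\<in>K. hexagon c)" "dist y z < min e 1"
        using z unfolding closure_approachable by blast
      have "norm y \<le> norm z + 1" using y(2) norm_triangle_sub[of y z] by (simp add: dist_norm)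
      then have "y \<in> cball 0 (norm z + 1)" by simp
      moreover obtain c where c: "c \<in> K" "y \<in> hexagon c" using y(1) by blast
      ultimately have "c \<in> F" unfolding F_def by blast
      then show ?thesis using c(2) y(2) by auto
    qed
    then have "z \<in> closure (\<Union>c\<in>F. hexagon c)" by (simp only: closure_approachable) blast
    then have "z \<in> (\<Union>c\<in>F. hexagon c)" using closed by simp
    then show ?thesis by (auto simp: F_def)
  qed
  then show ?thesis by (metis closure_subset closure_subset_eq subsetI)
qed

text \<open>If adjacency split the outer cells, the hexagons of the two parts would form disjoint
  closed sets covering the complement of the board. Both contain centres of outer cells, which lie
  in no hexagon of \<open>B\<close>, so the complement would be disconnected.\<close>

lemma hole_free_complement_connected:
  assumes "hole_free B" "k \<notin> B" "k' \<notin> B"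
  shows "(k, k') \<in> {(c, d). c \<notin> B \<and> d \<notin> B \<and> adjacent c d}\<^sup>*" (is "_ \<in> ?R\<^sup>*")
proof (rule ccontr)
  assume no: "(k, k') \<notin> ?R\<^sup>*"
  define K where "K = {c. c \<notin> B \<and> (k, c) \<in> ?R\<^sup>*}"
  define K' where "K' = {c. c \<notin> B \<and> (k, c) \<notin> ?R\<^sup>*}"
  define U where "U = - (\<Union>c\<in>B. hexagon c)"
  have cover: "U \<subseteq> (\<Union>c\<in>K. hexagon c) \<union> (\<Union>c\<in>K'. hexagon c)"
    using hexagons_cover by (fastforce simp: U_def K_def K'_def)
  have disj: "(\<Union>c\<in>K. hexagon c) \<inter> (\<Union>c\<in>K'. hexagon c) = {}"
  proof (rule ccontr)
    assume "\<not> ?thesis"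
    then obtain z c d where "c \<in> K" "d \<in> K'" "z \<in> hexagon c" "z \<in> hexagon d" by blast
    moreover from this have "c = d \<or> adjacent c d" using hexagons_meet by blast
    ultimately show False by (auto simp: K_def K'_def dest: rtrancl_into_rtrancl[of k c ?R d])
  qed
  have in_U: "cell_center c \<in> U" if "c \<notin> B" for c
  proof -
    have "cell_center c \<notin> hexagon d" if "d \<in> B" for d
    proof
      assume a: "cell_center c \<in> hexagon d"
      have "c \<noteq> d" using that \<open>c \<notin> B\<close> by blast
      then have "adjacent d c" using hexagons_meet[OF a center_in_hexagon] by auto
      then have "dist (cell_center d) (cell_center c) = 1" by (simp add: adjacent_iff_dist)
      moreover have "1 / sqrt 3 < (1::real)" by simp
      ultimately show False using hexagon_radius[OF a] by linarith
    qed
    then show ?thesis by (auto simp: U_def)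
  qed
  have kK: "k \<in> K" "k' \<in> K'" using assms(2,3) no by (auto simp: K_def K'_def)
  have "cell_center k \<in> (\<Union>c\<in>K. hexagon c) \<inter> U" "cell_center k' \<in> (\<Union>c\<in>K'. hexagon c) \<inter> U"
    using in_U assms(2,3) kK center_in_hexagon by blast+
  then have ne: "(\<Union>c\<in>K. hexagon c) \<inter> U \<noteq> {}" "(\<Union>c\<in>K'. hexagon c) \<inter> U \<noteq> {}" by blast+
  have "connected U" using assms(1) by (simp add: hole_free_def U_def)
  moreover have "(\<Union>c\<in>K. hexagon c) \<inter> (\<Union>c\<in>K'. hexagon c) \<inter> U = {}" using disj by simp
  ultimately show False using connected_closedD[OF _ _ cover closed_hexagons closed_hexagons] ne by blast
qed

text \<open>Janiszewski: the union of two compact sets with connected complements has a connected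
  complement if the sets meet in a connected set.\<close>

lemma hole_free_attach:
  assumes "hole_free S" "finite S" "A \<subseteq> S" "connected (\<Union>d\<in>A. hexagon c \<inter> hexagon d)"
    and "\<And>d. d \<in> S \<Longrightarrow> adjacent c d \<Longrightarrow> d \<in> A" "c \<notin> S"
  shows "hole_free (insert c S)"
proof -
  let ?S = "\<Union>c\<in>S. hexagon c"
  have *: "hexagon c \<inter> ?S = (\<Union>d\<in>A. hexagon c \<inter> hexagon d)"
  proof (intro equalityI subsetI)
    fix z assume z: "z \<in> hexagon c \<inter> ?S"
    then obtain d where d: "d \<in> S" "z \<in> hexagon d" by blast
    then have "adjacent c d" using z hexagons_meet assms(6) by blast
    then show "z \<in> (\<Union>d\<in>A. hexagon c \<inter> hexagon d)" using assms(5) d z by blast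
  qed (use assms(3) in blast)
  have "connected (- hexagon c)"
    using compact_hexagon convex_hexagon
    by (intro connected_complement_bounded_convex compact_imp_bounded) auto
  moreover have "compact ?S" using assms(2) compact_hexagon by blast
  ultimately have "connected (- (hexagon c \<union> ?S))"
    using assms(1,4) unfolding hole_free_def
    by (intro Janiszewski_connected) (auto simp: * compact_hexagon compact_imp_closed)
  then show ?thesis by (simp add: hole_free_def)
qed

text \<open>The new hexagon meets the old ones in two convex pieces which share the corner common to
  \<open>c\<close>, \<open>p\<close> and \<open>q\<close>, so the intersection is connected.\<close>

lemma hole_free_insert_edge:
  assumes "hole_free S" "finite S" "p \<in> S" "q \<in> S" "adjacent p q" "c = la p q"
    and "\<And>d. d \<in> S \<Longrightarrow> adjacent c d \<Longrightarrow> d \<in> {p, q}" "c \<notin> S"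
  shows "hole_free (insert c S)"
proof (rule hole_free_attach[OF assms(1,2) _ _ assms(7,8)])
  have "connected ((hexagon c \<inter> hexagon p) \<union> (hexagon c \<inter> hexagon q))"
    using tri_corner_in_hexagons[OF assms(5)] assms(6)
    by (intro connected_Un convex_connected convex_Int convex_hexagon) auto
  then show "connected (\<Union>d\<in>{p, q}. hexagon c \<inter> hexagon d)" by simp
qed (use assms(3,4) in auto)

lemma hole_free_insert_leaf:
  assumes "hole_free S" "finite S" "p \<in> S" "\<And>d. d \<in> S \<Longrightarrow> adjacent c d \<Longrightarrow> d \<in> {p}" "c \<notin> S"
  shows "hole_free (insert c S)"
proof (rule hole_free_attach[OF assms(1,2) _ _ assms(4,5)])
  show "connected (\<Union>d\<in>{p}. hexagon c \<inter> hexagon d)"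
    by (simp add: convex_connected convex_Int convex_hexagon)
qed (use assms(3) in auto)

lemma hole_free_singleton: "hole_free {c}"
  unfolding hole_free_def using compact_hexagon convex_hexagon
  by simp (intro connected_complement_bounded_convex compact_imp_bounded; simp)

section \<open>From boards to discs: all triangles of a hole-free 2-connected board\<close>

locale region =
  fixes B :: "cell set"
  assumes finite_B: "finite B" and two: "two_connected B"
    and outside: "\<And>k k'. k \<notin> B \<Longrightarrow> k' \<notin> B \<Longrightarrow>
      (k, k') \<in> {(c, d). c \<notin> B \<and> d \<notin> B \<and> adjacent c d}\<^sup>*"
begin

text \<open>A path of outer cells is followed by turning about each of its cells, which crosses only
  edges that end in an outer cell.\<close>

lemma tri_outside:
  assumes s: "s \<in> lat" "k \<in> s" "k \<notin> B" and t: "t \<in> lat" "k' \<in> t" "k' \<notin> B"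
  shows "(s, t) \<in> (dual (\<lambda>p q. p \<notin> B \<or> q \<notin> B))\<^sup>*" (is "_ \<in> (dual ?A)\<^sup>*")
proof -
  obtain z where z: "adjacent k z" "s = tri k z" using lat_at[OF s(1,2)] .
  have "\<forall>z'. adjacent k' z' \<longrightarrow> (s, tri k' z') \<in> (dual ?A)\<^sup>*"
    using outside[OF s(3) t(3)]
  proof (induction rule: rtrancl_induct)
    case base
    then show ?case using star_path[OF z(1), of _ ?A] s(3) z(2) by simp
  next
    case (step c d)
    have cd: "adjacent c d" "c \<notin> B" "d \<notin> B" using step.hyps(2) by auto
    show ?case
    proof (intro allI impI)
      fix z' assume "adjacent d z'"
      moreover have "tri c d = tri d (la c d)" by (simp add: tri_rot)
      ultimately have "(tri c d, tri d z') \<in> (dual ?A)\<^sup>*"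
        using star_path[OF la_adjacent(3)[OF cd(1)], of z' ?A] cd(3) by simp
      then show "(s, tri d z') \<in> (dual ?A)\<^sup>*" using step.IH cd(1) by (meson rtrancl_trans)
    qed
  qed
  then show ?thesis using lat_at[OF t(1,2)] by metis
qed

lemma connected_without:
  "u \<in> B \<Longrightarrow> c \<in> B - {u} \<Longrightarrow> d \<in> B - {u} \<Longrightarrow> (c, d) \<in> (board_graph (B - {u}))\<^sup>*"
  using two by (auto simp: two_connected_def board_connected_def)

text \<open>The neighbours of \<open>u\<close> in the board form one arc of its ring. Otherwise a
  closed dual walk could cross \<open>ux\<close> and the rest of the first arc of spokes and return
  through the outside. It would separate \<open>u\<close> from \<open>x\<close>, whereas the board
  edge from \<open>u\<close> to \<open>y\<close> in a second arc is not crossed and \<open>y\<close>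
  is joined to \<open>x\<close> in \<open>B - {u}\<close>, where nothing is crossed either.\<close>

lemma arc:
  assumes u: "u \<in> B" and x: "x \<in> B" "adjacent u x" "la x u \<notin> B"
    and j: "ring u x j \<notin> B" "j \<le> i" and i: "i < 6"
  shows "ring u x i \<notin> B"
proof
  assume y: "ring u x i \<in> B"
  define j0 where "j0 = (LEAST j. ring u x j \<notin> B)"
  have j0: "ring u x j0 \<notin> B" unfolding j0_def by (rule LeastI) (rule j)
  have below: "ring u x m \<in> B" if "m < j0" for m using that not_less_Least unfolding j0_def by blast
  have "j0 \<le> j" unfolding j0_def using j(1) by (rule Least_le)
  then have "j0 < i" using j j0 y by (metis le_neq_implies_less order_trans)
  have "0 < j0" using j0 x(1) by (cases j0) auto
  \<comment> \<open>Open edges: those with an outer end, and the spokes from \<open>u\<close> to the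
    first arc except \<open>ux\<close> itself, which is crossed only by the closing step.\<close>
  define A where "A p q \<longleftrightarrow> (p \<notin> B \<or> q \<notin> B) \<or> (\<exists>m. 0 < m \<and> m < j0 \<and> {p, q} = {u, ring u x m})" for p q
  have A_sym: "A p q = A q p" for p q unfolding A_def by (simp add: insert_commute disj_commute)
  have ring0: "x \<noteq> ring u x m" if "0 < m" "m < 6" for m using ring_inj[OF x(2) that(2), of 0] that by auto
  have "\<not> A u x" using u x ring0 \<open>j0 < i\<close> i by (auto simp: A_def doubleton_eq_iff)
  have "(tri u (ring u x 0), tri u (ring u x (j0 - 1))) \<in> (dual A)\<^sup>*"
  proof (rule ring_path[OF x(2)])
    show "A (ring u x m) u" if "0 < m" "m \<le> j0 - 1" for m
    proof -
      have "m < j0" using that by linarith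
      then show ?thesis using that(1) by (auto simp: A_def)
    qed
  qed simp
  moreover have "(tri u (ring u x (j0 - 1)), tri x u) \<in> (dual A)\<^sup>*"
  proof -
    have "(tri u (ring u x (j0 - 1)), tri x u) \<in> (dual (\<lambda>p q. p \<notin> B \<or> q \<notin> B))\<^sup>*"
    proof (rule tri_outside)
      show "ring u x j0 \<in> tri u (ring u x (j0 - 1))"
        using \<open>0 < j0\<close> ring_Suc[of u x "j0 - 1"] by (simp add: tri_def)
      show "la x u \<in> tri x u" by (simp add: tri_def)
    qed (use j0 x ring_adjacent[OF x(2)] in \<open>auto intro: tri_lat adj_sym\<close>)
    then show ?thesis using dual_mono[of "\<lambda>p q. p \<notin> B \<or> q \<notin> B" A] by (auto simp: A_def)
  qed
  ultimately have "(tri u x, tri x u) \<in> (dual A)\<^sup>*" by simp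
  then obtain f :: "cell \<Rightarrow> bool" where f: "f u \<noteq> f x"
    "\<And>a b. adjacent a b \<Longrightarrow> \<not> A a b \<Longrightarrow> {a, b} \<noteq> {u, x} \<Longrightarrow> f a = f b"
    using dual_cut[OF A_sym x(2) \<open>\<not> A u x\<close>] by blast
  define y where "y = ring u x i"
  have ay: "adjacent u y" unfolding y_def using x(2) by (rule ring_adjacent)
  have yB: "y \<in> B" "y \<noteq> u" using \<open>ring u x i \<in> B\<close> adjacent_neq[OF ay] by (auto simp: y_def)
  have yr: "y \<noteq> ring u x m" if "m < j0" for m
    using ring_inj[OF x(2) i, of m] that \<open>j0 < i\<close> i by (simp add: y_def)
  then have "\<not> A u y" using u yB by (auto simp: A_def doubleton_eq_iff)
  moreover have "y \<noteq> x" using yr[of 0] \<open>0 < j0\<close> by simp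
  ultimately have "f u = f y" using f(2)[OF ay] by (auto simp: doubleton_eq_iff)
  moreover have "f x = f y"
  proof -
    have "(x, y) \<in> (board_graph (B - {u}))\<^sup>*"
      using connected_without[OF u] x yB adjacent_neq[OF x(2)] by blast
    then show ?thesis
    proof (induction rule: rtrancl_induct)
      case (step a b)
      then have "a \<in> B" "b \<in> B" "a \<noteq> u" "b \<noteq> u" "adjacent a b" by (auto simp: board_graph_def)
      then have "f a = f b" by (intro f(2)) (auto simp: A_def doubleton_eq_iff)
      then show ?case using step.IH by simp
    qed simp
  qed
  ultimately show False using f(1) by simp
qed

lemma other_cell: "\<exists>v\<in>B. v \<notin> {a, b}"
proof (rule ccontr)
  assume "\<not> ?thesis"
  then have "B \<subseteq> {a, b}" by auto
  then have "card B \<le> card {a, b}" by (intro card_mono) auto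
  then show False using two card_insert_le_m1[of 2 "{b}" a] by (simp add: two_connected_def card_insert_if split: if_splits)
qed

text \<open>With both sides of \<open>ux\<close> outside the board, \<open>arc\<close> would leave
  \<open>x\<close> as the only neighbour of \<open>u\<close>, so deleting \<open>x\<close> would cut
  \<open>u\<close> off from the remaining cells.\<close>

lemma edge_in_tri:
  assumes "u \<in> B" "x \<in> B" "adjacent u x"
  shows "la u x \<in> B \<or> la x u \<in> B"
proof (rule ccontr)
  assume no: "\<not> ?thesis"
  then have "ring u x 1 \<notin> B" by (simp add: ring_Suc)
  then have out: "ring u x i \<notin> B" if "1 \<le> i" "i < 6" for i using arc[of u x 1 i] assms no that by blast
  obtain v where v: "v \<in> B" "v \<noteq> u" "v \<noteq> x" using other_cell[of u x] by auto
  have "(u, v) \<in> (board_graph (B - {x}))\<^sup>*"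
    using connected_without[OF assms(2)] assms v adjacent_neq[OF assms(3)] by blast
  then obtain c where "(u, c) \<in> board_graph (B - {x})" using v by (metis converse_rtranclE)
  then have c: "c \<in> B" "c \<noteq> x" "adjacent u c" by (auto simp: board_graph_def)
  obtain i where i: "i < 6" "c = ring u x i" using neighbour_ringE[OF assms(3) c(3)] .
  then show False using out[of i] c by (cases i) auto
qed

definition all_tris :: "cell set set" where
  "all_tris = {t \<in> lat. t \<subseteq> B}"

text \<open>Single fans come from \<open>arc\<close>. Paths of the board are turned into dual walks
  by rotating about their cells, using that each edge lies on a triangle. A triangle not in the set
  has an outer corner, and outer corners are connected.\<close>

lemma good_all_tris: "good B all_tris"
proof -
  let ?D = all_tris
  have start: "z = z'" if st: "start ?D v z" "start ?D v z'" for v z z'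
  proof (rule ccontr)
    assume "z \<noteq> z'"
    have v: "v \<in> B" "z \<in> B" "z' \<in> B" "adjacent v z" "adjacent v z'"
      using st by (auto simp: start_def all_tris_def tri_def)
    have out: "la z v \<notin> B" "la z' v \<notin> B"
      using st v tri_lat[OF adj_sym[OF v(4)]] tri_lat[OF adj_sym[OF v(5)]]
      by (auto simp: start_def all_tris_def tri_def)
    obtain i where i: "i < 6" "z' = ring v z i" using neighbour_ringE[OF v(4,5)] .
    then obtain k where k: "i = Suc k" using \<open>z \<noteq> z'\<close> by (cases i) auto
    have "ring v z k \<notin> B" using out(2) i k ring_prev(2)[of v z k] by simp
    then show False using arc[OF v(1,2,4) out(1), of k i] i k v by simp
  qed
  have fan: "(s, t) \<in> (dual (inn ?D))\<^sup>*" if st: "s \<in> ?D" "t \<in> ?D" "u \<in> s" "u \<in> t" for s t u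
  proof -
    obtain x where x: "adjacent u x" "s = tri u x" using lat_at[of s u] st by (auto simp: all_tris_def)
    obtain y where y: "adjacent u y" "t = tri u y" using lat_at[of t u] st by (auto simp: all_tris_def)
    have "(tri u x, tri u y) \<in> (dual (\<lambda>p q. inn ?D p q \<and> u \<in> {p, q}))\<^sup>*"
      using start st x y by (intro fan_linked) auto
    then show ?thesis using dual_mono[of "\<lambda>p q. inn ?D p q \<and> u \<in> {p, q}" "inn ?D"] x y by auto
  qed
  have edge: "\<exists>t\<in>?D. u \<in> t \<and> x \<in> t" if "u \<in> B" "x \<in> B" "adjacent u x" for u x
  proof -
    have "tri u x \<in> ?D \<or> tri x u \<in> ?D"
      using edge_in_tri[OF that] that tri_lat[OF that(3)] tri_lat[OF adj_sym[OF that(3)]]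
      by (auto simp: all_tris_def tri_def)
    moreover have "{u, x} \<subseteq> tri u x" "{u, x} \<subseteq> tri x u" by (simp_all add: tri_def)
    ultimately show ?thesis by blast
  qed
  have conn: "(c, d) \<in> (board_graph B)\<^sup>*" if "c \<in> B" "d \<in> B" for c d
    using two that by (auto simp: two_connected_def board_connected_def)
  have linked: "linked ?D"
    unfolding linked_def
  proof (intro ballI)
    fix s t assume st: "s \<in> ?D" "t \<in> ?D"
    obtain u v where uv: "u \<in> s" "v \<in> t" using st by (fastforce simp: all_tris_def lat_def tri_def)
    then have "u \<in> B" "v \<in> B" using st by (auto simp: all_tris_def)
    then have "(u, v) \<in> (board_graph B)\<^sup>*" using conn by blast
    then have "\<forall>t\<in>?D. v \<in> t \<longrightarrow> (s, t) \<in> (dual (inn ?D))\<^sup>*"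
    proof (induction rule: rtrancl_induct)
      case base then show ?case using fan st uv by blast
    next
      case (step a b)
      then have ab: "a \<in> B" "b \<in> B" "adjacent a b" by (auto simp: board_graph_def)
      obtain m where m: "m \<in> ?D" "a \<in> m" "b \<in> m" using edge[OF ab] by blast
      show ?case
      proof (intro ballI impI)
        fix t assume "t \<in> ?D" "b \<in> t"
        then have "(m, t) \<in> (dual (inn ?D))\<^sup>*" using fan m by blast
        then show "(s, t) \<in> (dual (inn ?D))\<^sup>*" using step.IH m by (meson rtrancl_trans)
      qed
    qed
    then show "(s, t) \<in> (dual (inn ?D))\<^sup>*" using st uv by blast
  qed
  have co: "linked (lat - ?D)"
    unfolding linked_def
  proof (intro ballI)
    fix s t assume st: "s \<in> lat - ?D" "t \<in> lat - ?D"
    obtain k k' where "k \<in> s" "k \<notin> B" "k' \<in> t" "k' \<notin> B" using st by (auto simp: all_tris_def)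
    then have "(s, t) \<in> (dual (\<lambda>p q. p \<notin> B \<or> q \<notin> B))\<^sup>*" using tri_outside st by blast
    moreover have "(dual (\<lambda>p q. p \<notin> B \<or> q \<notin> B))\<^sup>* \<subseteq> (dual (inn (lat - ?D)))\<^sup>*"
    proof (rule dual_mono)
      fix p q assume "adjacent p q" "p \<notin> B \<or> q \<notin> B"
      then show "inn (lat - ?D) p q"
        using tri_lat adj_sym by (auto simp: inn_def all_tris_def tri_def)
    qed
    ultimately show "(s, t) \<in> (dual (inn (lat - ?D)))\<^sup>*" by blast
  qed
  have "finite ?D" using finite_B by (rule_tac finite_subset[of _ "Pow B"]) (auto simp: all_tris_def)
  moreover have "\<Union>?D = B"
  proof
    show "B \<subseteq> \<Union>?D"
    proof
      fix u assume u: "u \<in> B"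
      obtain v where v: "v \<in> B" "v \<noteq> u" using other_cell[of u u] by auto
      then obtain c where "(u, c) \<in> board_graph B" using conn[OF u v(1)] by (metis converse_rtranclE)
      then show "u \<in> \<Union>?D" using edge[of u c] by (auto simp: board_graph_def)
    qed
  qed (auto simp: all_tris_def)
  ultimately show ?thesis
    using start linked co unfolding good_def by (auto simp: all_tris_def)
qed

lemma good_without_inner:
  assumes "\<And>c. B \<noteq> star_of_david c"
  obtains D where "good B D" "\<And>v. \<not> inner D v"
proof -
  obtain D where "good B D" "\<And>D'. good B D' \<Longrightarrow> card D \<le> card D'"
    using ex_has_least_nat[of "good B" all_tris card] good_all_tris by blast
  then interpret minimal_good B D by unfold_locales
  show ?thesis using that[OF good] inner_imp_star assms by blast
qed

end

subsection \<open>Triangulated polygons\<close>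

text \<open>A triangulated polygon to the left of the edge from \<open>x\<close> to
  \<open>z\<close>, where \<open>ps\<close> lists the other boundary cells from \<open>x\<close> to
  \<open>z\<close>. The recursion is the binary dual tree rooted at this edge. Embeddedness is not
  built in; it is added as distinctness of the list.\<close>

inductive poly :: "cell \<Rightarrow> cell \<Rightarrow> cell list \<Rightarrow> cell set set \<Rightarrow> bool" where
  edge: "poly x z [] {}"
| node: "poly x (la x z) ps D \<Longrightarrow> poly (la x z) z qs E \<Longrightarrow>
    poly x z (ps @ la x z # qs) (insert (tri x z) (D \<union> E))"

lemma poly_root: "poly x z ps D \<Longrightarrow> ps = [] \<and> D = {} \<or> tri x z \<in> D"
  by (cases rule: poly.cases) auto

lemma poly_neighbour:
  assumes "poly x z ps D" "adjacent x z" "t \<in> D" "(t, t') \<in> dual (inn D')" "t' \<notin> D"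
  shows "t' = tri z x \<or> (\<exists>us a b vs. x # ps @ [z] = us @ a # b # vs \<and> t' = tri a b)"
  using assms
proof (induction arbitrary: t rule: poly.induct)
  case (node x z ps D qs E)
  let ?w = "la x z"
  have tx: "tri ?w x = tri x z" "tri z ?w = tri x z" by (simp_all add: tri_rot)
  have first: "?case" if "x # ps @ [?w] = us @ a # b # vs" "t' = tri a b" for us a b vs
    using that by (intro disjI2 exI[of _ us] exI[of _ a] exI[of _ b] exI[of _ "vs @ qs @ [z]"]) simp
  have second: "?case" if "?w # qs @ [z] = us @ a # b # vs" "t' = tri a b" for us a b vs
    using that by (intro disjI2 exI[of _ "x # ps @ us"] exI[of _ a] exI[of _ b] exI[of _ vs]) simp
  consider "t = tri x z" | "t \<in> D" | "t \<in> E" using node.prems by blast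
  then show ?case
  proof cases
    case 1
    have "(t', tri x z) \<in> dual (inn D')"
    proof -
      obtain p q where "t = tri p q" "t' = tri q p" "adjacent p q" "inn D' p q"
        using node.prems(3) unfolding dual_def by blast
      then show ?thesis using 1 dualI[OF adj_sym, of p q "inn D'"] inn_sym by simp
    qed
    then consider "t' = tri z x" | "t' = tri ?w z" | "t' = tri x ?w"
      using dual_nbrs(2) node.prems(1) by blast
    then show ?thesis
    proof cases
      case 2
      then have "qs = []" using poly_root[OF node.hyps(2)] node.prems by auto
      then show ?thesis using second[of "[]" ?w z "[]"] 2 by simp
    next
      case 3
      then have "ps = []" using poly_root[OF node.hyps(1)] node.prems by auto
      then show ?thesis using first[of "[]" x ?w "[]"] 3 by simp
    qed simp
  next
    case 2
    have "t' \<notin> D" "t' \<noteq> tri ?w x" using node.prems(4) tx by auto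
    then show ?thesis
      using node.IH(1)[OF la_adjacent(1)[OF node.prems(1)] 2 node.prems(3)] first by blast
  next
    case 3
    have "t' \<notin> E" "t' \<noteq> tri z ?w" using node.prems(4) tx by auto
    then show ?thesis
      using node.IH(2)[OF la_adjacent(4)[OF node.prems(1)] 3 node.prems(3)] second by blast
  qed
qed simp

lemma split_at:
  assumes "xs @ c # ys = us @ a # b # vs"
  obtains vs' where "xs @ [c] = us @ a # b # vs'" "vs = vs' @ ys"
  | us' where "us = xs @ us'" "c # ys = us' @ a # b # vs"
proof -
  consider w where "xs = us @ w" "w @ c # ys = a # b # vs" | w where "us = xs @ w" "c # ys = w @ a # b # vs"
    using assms unfolding append_eq_append_conv2 by blast
  then show ?thesis
  proof cases
    case (1 w)
    consider "w = []" | "w = [a]" "c = b" "ys = vs" | w' where "w = a # b # w'" "vs = w' @ c # ys"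
    proof (cases w)
      case (Cons d w0)
      then show ?thesis using 1(2) that(2,3) by (cases w0) auto
    qed (use that in auto)
    then show ?thesis
    proof cases
      case c1: 1
      show ?thesis by (rule that(2)[of "[]"]) (use 1 c1 in auto)
    next
      case 2
      show ?thesis by (rule that(1)[of "[]"]) (use 1 2 in auto)
    next
      case (3 w')
      show ?thesis by (rule that(1)[of "w' @ [c]"]) (use 1 3 in auto)
    qed
  next
    case (2 w)
    then show ?thesis using that(2) by blast
  qed
qed

text \<open>The growth step of the maximal polygon: a triangle is glued to the outer side of a
  boundary edge, and its apex is spliced into the boundary between the two ends of that
  edge.\<close>

lemma poly_insert:
  assumes "poly x z ps D" "x # ps @ [z] = us @ a # b # vs"
  shows "\<exists>ps'. poly x z ps' (insert (tri a b) D) \<and> x # ps' @ [z] = us @ a # la a b # b # vs"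
  using assms
proof (induction arbitrary: us vs rule: poly.induct)
  case (edge x z)
  then have "us = []" "a = x" "b = z" "vs = []"
    by (auto simp: Cons_eq_append_conv)
  then show ?case using poly.node[OF poly.edge poly.edge, of x z] by auto
next
  case (node x z ps D qs E)
  let ?w = "la x z"
  have "(x # ps) @ ?w # qs @ [z] = us @ a # b # vs" using node.prems by simp
  then show ?case
  proof (cases rule: split_at)
    case (1 vs')
    then obtain ps' where "poly x ?w ps' (insert (tri a b) D)" "x # ps' @ [?w] = us @ a # la a b # b # vs'"
      using node.IH(1)[of us vs'] by auto
    then show ?thesis using poly.node[OF _ node.hyps(2)] 1
      by (intro exI[of _ "ps' @ ?w # qs"]) (fastforce simp: insert_commute)
  next
    case (2 us')
    then obtain qs' where "poly ?w z qs' (insert (tri a b) E)" "?w # qs' @ [z] = us' @ a # la a b # b # vs"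
      using node.IH(2)[of us' vs] by auto
    then show ?thesis using poly.node[OF node.hyps(1)] 2
      by (intro exI[of _ "ps @ ?w # qs'"]) (fastforce simp: insert_commute)
  qed
qed

lemma poly_leaf:
  assumes "poly x z ps D" "ps \<noteq> []" "x # ps @ [z] = us @ a # b # vs"
  shows "tri b a \<in> D"
  using assms
proof (induction arbitrary: us vs rule: poly.induct)
  case (node x z ps D qs E)
  let ?w = "la x z"
  have "(x # ps) @ ?w # qs @ [z] = us @ a # b # vs" using node.prems by simp
  then show ?case
  proof (cases rule: split_at)
    case (1 vs')
    show ?thesis
    proof (cases "ps = []")
      case True
      then have "a = x" "b = ?w" using 1 by (auto simp: Cons_eq_append_conv)
      then show ?thesis by (simp add: tri_rot)
    qed (use node.IH(1)[of us vs'] 1 in auto)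
  next
    case (2 us')
    show ?thesis
    proof (cases "qs = []")
      case True
      then have "a = ?w" "b = z" using 2 by (auto simp: Cons_eq_append_conv)
      then show ?thesis by (simp add: tri_rot)
    qed (use node.IH(2)[of us' vs] 2 in auto)
  qed
qed simp

lemma poly_adjacent:
  assumes "poly x z ps D" "adjacent x z" "x # ps @ [z] = us @ a # b # vs"
  shows "adjacent a b"
  using assms
proof (induction arbitrary: us vs rule: poly.induct)
  case (edge x z)
  then show ?case by (auto simp: Cons_eq_append_conv)
next
  case (node x z ps D qs E)
  have "(x # ps) @ la x z # qs @ [z] = us @ a # b # vs" using node.prems by simp
  then show ?case
    by (cases rule: split_at) (use node.IH la_adjacent[OF node.prems(1)] in auto)
qed

lemma poly_cells_sub: "poly x z ps D \<Longrightarrow> \<Union>D \<subseteq> set (x # ps @ [z])"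
  by (induction rule: poly.induct) (auto simp: tri_def)

lemma poly_cells_sup: "poly x z ps D \<Longrightarrow> set ps \<subseteq> \<Union>D"
  by (induction rule: poly.induct) (auto simp: tri_def)

lemma poly_cells:
  assumes "poly x z ps D" "D \<noteq> {}" shows "\<Union>D = set (x # ps @ [z])"
proof -
  have "tri x z \<in> D" using poly_root[OF assms(1)] assms(2) by blast
  moreover have "x \<in> tri x z" "z \<in> tri x z" by (simp_all add: tri_def)
  ultimately have "{x, z} \<subseteq> \<Union>D" by blast
  then show ?thesis using poly_cells_sub[OF assms(1)] poly_cells_sup[OF assms(1)] by auto
qed

lemma poly_linked:
  assumes "poly x z ps D" "adjacent x z" "t \<in> D"
  shows "(t, tri x z) \<in> (dual (inn D))\<^sup>*"
  using assms
proof (induction arbitrary: t rule: poly.induct)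
  case (node x z ps D qs E)
  let ?w = "la x z" and ?X = "insert (tri x z) (D \<union> E)"
  have aw: "adjacent x ?w" "adjacent ?w z" using la_adjacent[OF node.prems(1)] by auto
  consider "t = tri x z" | "t \<in> D" | "t \<in> E" using node.prems by blast
  then show ?case
  proof cases
    case 2
    have "(t, tri x ?w) \<in> (dual (inn ?X))\<^sup>*"
      using node.IH(1)[OF aw(1) 2] inn_mono[of D ?X] by blast
    moreover have "tri x ?w \<in> D" using poly_root[OF node.hyps(1)] 2 by auto
    then have "(tri x ?w, tri x z) \<in> dual (inn ?X)"
      using dualI[OF aw(1), of "inn ?X"] by (simp add: inn_def tri_rot)
    ultimately show ?thesis by simp
  next
    case 3
    have "(t, tri ?w z) \<in> (dual (inn ?X))\<^sup>*"
      using node.IH(2)[OF aw(2) 3] inn_mono[of E ?X] by blast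
    moreover have "tri ?w z \<in> E" using poly_root[OF node.hyps(2)] 3 by auto
    then have "(tri ?w z, tri x z) \<in> dual (inn ?X)"
      using dualI[OF aw(2), of "inn ?X"] by (simp add: inn_def tri_rot)
    ultimately show ?thesis by simp
  qed simp
qed simp

text \<open>Another dual route would give a function separating \<open>a\<close> from
  \<open>b\<close> that is constant on every triangle outside \<open>D\<close>. As neither
  \<open>a\<close> nor \<open>b\<close> is inner, both are corners of triangles outside
  \<open>D\<close>, and these are linked, so the function agrees on \<open>a\<close> and
  \<open>b\<close>.\<close>

lemma no_inner_bridge:
  assumes g: "good B D" and no_inner: "\<And>v. \<not> inner D v" and ab: "adjacent a b"
    and D: "tri a b \<in> D" "tri b a \<in> D"
  shows "(tri a b, tri b a) \<notin> (dual (\<lambda>p q. inn D p q \<and> {p, q} \<noteq> {a, b}))\<^sup>*" (is "_ \<notin> (dual ?A)\<^sup>*")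
proof
  assume path: "(tri a b, tri b a) \<in> (dual ?A)\<^sup>*"
  have A_sym: "?A p q = ?A q p" for p q using inn_sym[of D p q] by (auto simp: doubleton_eq_iff)
  obtain f :: "cell \<Rightarrow> bool" where f: "f a \<noteq> f b"
    "\<And>p q. adjacent p q \<Longrightarrow> \<not> ?A p q \<Longrightarrow> {p, q} \<noteq> {a, b} \<Longrightarrow> f p = f q"
    using dual_cut[of ?A a b, OF A_sym ab _ path] by blast
  have const: "f p = f q" if "t \<in> lat - D" "p \<in> t" "q \<in> t" for t p q
  proof (cases "p = q")
    case False
    have pq: "adjacent p q" "t = tri p q \<or> t = tri q p" using lat_edge[of t p q] that False by blast+
    then have "\<not> inn D p q" using that by (auto simp: inn_def)
    moreover have "{p, q} \<noteq> {a, b}" using pq that D by (auto simp: doubleton_eq_iff)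
    ultimately show ?thesis using f(2) pq by blast
  qed simp
  obtain y where y: "adjacent a y" "tri a y \<notin> D" using no_inner[of a] unfolding inner_def by blast
  obtain z where z: "adjacent b z" "tri b z \<notin> D" using no_inner[of b] unfolding inner_def by blast
  have "(tri a y, tri b z) \<in> (dual (inn (lat - D)))\<^sup>*"
    using g y z tri_lat by (intro linkedD) (auto simp: good_def)
  then have "\<forall>q\<in>tri b z. f a = f q"
  proof (induction rule: rtrancl_induct)
    case base
    then show ?case using const[of "tri a y" a] y tri_lat by (auto simp: tri_def)
  next
    case (step s t)
    obtain p q where pq: "s = tri p q" "t = tri q p" "t \<in> lat - D"
      using step.hyps(2) unfolding dual_def inn_def by blast
    then show ?case using step.IH const[OF pq(3), of p] by (auto simp: tri_def)
  qed
  then show False using f(1) by (auto simp: tri_def)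
qed

text \<open>Among the embedded polygons inside \<open>D\<close> on a fixed boundary edge, a longest
  one is taken; its length is bounded by the number of cells. Leaving it by a dual step either
  produces a longer one or contradicts the bridge property, so it exhausts \<open>D\<close>.\<close>

lemma good_poly:
  assumes g: "good B D" and no_inner: "\<And>v. \<not> inner D v" and "B \<noteq> {}"
  obtains x z ps E where "adjacent x z" "poly x z ps E" "distinct (x # ps @ [z])" "set (x # ps @ [z]) = B"
proof -
  have sub: "D \<subseteq> lat" and fin: "finite D" and un: "\<Union>D = B" and linked: "linked D"
    using g by (auto simp: good_def)
  have finB: "finite B" using fin sub un by (auto simp: lat_def tri_def)
  obtain t v where "t \<in> D" "v \<in> t" using assms(3) un by blast
  then obtain u where u: "adjacent v u" "tri v u \<in> D" using lat_at sub by (metis subsetD)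
  obtain y where y: "adjacent v y" "tri v y \<notin> D" using no_inner[of v] unfolding inner_def by blast
  obtain z where "start D v z" using fan_back[OF u y] by blast
  then have vz: "adjacent v z" "tri v z \<in> D" "tri z v \<notin> D" by (auto simp: start_def)
  define P where "P ps \<longleftrightarrow> ps \<noteq> [] \<and> distinct (v # ps @ [z]) \<and> (\<exists>E\<subseteq>D. poly v z ps E)" for ps
  have P_cells: "set (v # ps @ [z]) \<subseteq> B" if P: "P ps" for ps
  proof -
    obtain E where E: "E \<subseteq> D" "poly v z ps E" using P by (auto simp: P_def)
    then have "E \<noteq> {}" using poly_root[OF E(2)] P by (auto simp: P_def)
    then show ?thesis using poly_cells[OF E(2)] E un by blast
  qed
  have bound: "length ps \<le> card B" if "P ps" for ps
  proof -
    have "length ps = card (set ps)" using that by (simp add: P_def distinct_card)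
    also have "\<dots> \<le> card B" using P_cells[OF that] finB by (intro card_mono) auto
    finally show ?thesis .
  qed
  have P0: "P [la v z]"
    using poly.node[OF poly.edge poly.edge, of v z] vz la_neq[OF vz(1)] adjacent_neq[OF vz(1)]
    by (auto simp: P_def intro!: exI[of _ "{tri v z}"])
  have "\<forall>qs. P qs \<longrightarrow> length qs < Suc (card B)" using bound by (simp add: less_Suc_eq_le)
  from ex_has_greatest_nat[of P _ length, OF P0 this]
  obtain ps where ps: "P ps" "\<And>qs. P qs \<Longrightarrow> length qs \<le> length ps" by blast
  obtain E where E: "E \<subseteq> D" "poly v z ps E" "ps \<noteq> []" "distinct (v # ps @ [z])"
    using ps(1) by (auto simp: P_def)
  have root: "tri v z \<in> E" using poly_root[OF E(2)] E(3) by blast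
  have cells: "\<Union>E = set (v # ps @ [z])" using poly_cells[OF E(2)] root by blast
  have closed: "t' \<in> E" if tE: "t \<in> E" and tt: "(t, t') \<in> dual (inn D)" for t t'
  proof (rule ccontr)
    assume out: "t' \<notin> E"
    have t': "t' \<in> D" using tt unfolding dual_def inn_def by blast
    then have "t' \<noteq> tri z v" using vz by blast
    then obtain us a b vs where ab: "v # ps @ [z] = us @ a # b # vs" "t' = tri a b"
      using poly_neighbour[OF E(2) vz(1) tE tt out] by blast
    have adj: "adjacent a b" using poly_adjacent[OF E(2) vz(1) ab(1)] .
    define w where "w = la a b"
    obtain ps' where ps': "poly v z ps' (insert (tri a b) E)" "v # ps' @ [z] = us @ a # w # b # vs"
      using poly_insert[OF E(2) ab(1)] by (auto simp: w_def)
    show False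
    proof (cases "w \<in> set (v # ps @ [z])")
      case False
      then have "distinct (v # ps' @ [z])" using E(4) unfolding ps'(2) ab(1) by auto
      moreover have "length (v # ps' @ [z]) = length (v # ps @ [z]) + 1" unfolding ps'(2) ab(1) by simp
      then have len: "length ps' = length ps + 1" by simp
      ultimately have "P ps'" using ps'(1) t' E(1) ab(2) by (auto simp: P_def intro!: exI[of _ "insert (tri a b) E"])
      then show False using ps(2)[of ps'] len by simp
    next
      \<comment> \<open>The apex is already a corner of the polygon. The fan at the apex leads from
        the new triangle to the polygon without crossing \<open>ab\<close>, and inside the polygon
        one gets back to the other side of \<open>ab\<close>, which is therefore no bridge.\<close>
      case True
      then obtain t2 where t2: "t2 \<in> E" "w \<in> t2" using cells by blast
      then obtain y where y: "adjacent w y" "t2 = tri w y" using lat_at E(1) sub by (metis subsetD)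
      have wa: "adjacent w a" "tri w a = tri a b" using la_adjacent[OF adj] by (simp_all add: w_def tri_rot)
      let ?A = "\<lambda>p q. inn D p q \<and> {p, q} \<noteq> {a, b}"
      have wab: "w \<noteq> a" "w \<noteq> b" using la_neq[OF adj] by (auto simp: w_def)
      have "(tri w a, tri w y) \<in> (dual (\<lambda>p q. inn D p q \<and> w \<in> {p, q}))\<^sup>*"
        using good_startD[OF g] wa y t' ab(2) t2 E(1) by (intro fan_linked) auto
      moreover have "(dual (\<lambda>p q. inn D p q \<and> w \<in> {p, q}))\<^sup>* \<subseteq> (dual ?A)\<^sup>*"
        by (rule dual_mono) (use wab in auto)
      ultimately have "(tri a b, t2) \<in> (dual ?A)\<^sup>*" using wa y by auto
      moreover have "(t2, tri b a) \<in> (dual ?A)\<^sup>*"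
      proof -
        have "tri b a \<in> E" using poly_leaf[OF E(2,3) ab(1)] .
        then have "(t2, tri b a) \<in> (dual (inn E))\<^sup>*"
          using poly_linked[OF E(2) vz(1)] t2 sym_inn[of E] by (meson symD rtrancl_trans)
        moreover have "(dual (inn E))\<^sup>* \<subseteq> (dual ?A)\<^sup>*"
          by (rule dual_mono) (use E(1) out ab(2) in \<open>auto simp: inn_def doubleton_eq_iff\<close>)
        ultimately show ?thesis by blast
      qed
      moreover have "tri b a \<in> D" using poly_leaf[OF E(2,3) ab(1)] E(1) by blast
      ultimately show False
        using no_inner_bridge[OF g no_inner adj] t' ab(2) by (meson rtrancl_trans)
    qed
  qed
  have "t \<in> E" if "t \<in> D" for t
  proof -
    have "(tri v z, t) \<in> (dual (inn D))\<^sup>*" using linkedD[OF linked vz(2) that] .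
    then show ?thesis by (induction rule: rtrancl_induct) (use root closed in auto)
  qed
  then have "E = D" using E(1) by blast
  then show ?thesis using that[OF vz(1) E(2,4)] cells un by simp
qed

subsection \<open>Unoriented states\<close>

type_synonym 'g ustate = "('g \<times> cell set) set"

text \<open>Slide, turn and pivot all take a two-cell set \<open>{p, q}\<close> to
  \<open>{q, e}\<close>; dropping the ends makes them one kind of hop. That each hop is realised by
  some move is shown later.\<close>

definition uhop :: "cell set \<Rightarrow> 'g ustate \<Rightarrow> 'g ustate \<Rightarrow> bool" where
  "uhop V U U' \<longleftrightarrow> (\<exists>g p q e. (g, {p, q}) \<in> U \<and> p \<in> V \<and> q \<in> V \<and> e \<in> V \<and> adjacent p q \<and> adjacent q e \<and>
     (\<forall>x\<in>U. e \<notin> snd x) \<and> U' = insert (g, {q, e}) (U - {(g, {p, q})}))"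

lemma uhopI:
  assumes "(g, {p, q}) \<in> U" "{p, q, e} \<subseteq> V" "adjacent p q" "adjacent q e"
    "\<And>x. x \<in> U \<Longrightarrow> e \<notin> snd x" "U' = insert (g, {q, e}) (U - {(g, {p, q})})"
  shows "uhop V U U'"
  unfolding uhop_def using assms by blast

definition ureach :: "cell set \<Rightarrow> nat \<Rightarrow> 'g ustate \<Rightarrow> 'g ustate \<Rightarrow> bool" where
  "ureach V k U U' \<longleftrightarrow> (\<exists>j\<le>k. (uhop V ^^ j) U U')"

definition disj :: "'g ustate \<Rightarrow> bool" where
  "disj U \<longleftrightarrow> (\<forall>x\<in>U. snd x \<noteq> {}) \<and> (\<forall>x\<in>U. \<forall>y\<in>U. x \<noteq> y \<longrightarrow> snd x \<inter> snd y = {})"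

lemma ureach_refl [simp]: "ureach V k U U"
  unfolding ureach_def by (intro exI[of _ 0]) simp

lemma ureach_trans: "ureach V k U U' \<Longrightarrow> ureach V l U' U'' \<Longrightarrow> ureach V (k + l) U U''"
proof -
  assume "ureach V k U U'" "ureach V l U' U''"
  then obtain i j where "i \<le> k" "j \<le> l" "(uhop V ^^ i) U U'" "(uhop V ^^ j) U' U''"
    unfolding ureach_def by blast
  moreover from this have "(uhop V ^^ (i + j)) U U''" unfolding relpowp_add by blast
  ultimately show ?thesis unfolding ureach_def by (intro exI[of _ "i + j"]) simp
qed

lemma ureach_mono: "ureach V k U U' \<Longrightarrow> k \<le> l \<Longrightarrow> ureach V l U U'"
  unfolding ureach_def by (meson order_trans)

lemma ureach_hop: "uhop V U U' \<Longrightarrow> ureach V 1 U U'"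
  unfolding ureach_def by (intro exI[of _ 1]) (simp add: eq_OO)

lemma ureach_induct [consumes 1, case_names refl hop]:
  assumes "ureach V k U U'" "P U" "\<And>U1 U2. P U1 \<Longrightarrow> uhop V U1 U2 \<Longrightarrow> P U2"
  shows "P U'"
proof -
  obtain j where "(uhop V ^^ j) U U'" using assms(1) by (auto simp: ureach_def)
  then show ?thesis using assms(2,3) by (induction j arbitrary: U') auto
qed

lemma uhop_disj:
  assumes "uhop V U U'" "disj U" shows "disj U'"
proof -
  obtain g p q e where h: "(g, {p, q}) \<in> U" "\<forall>x\<in>U. e \<notin> snd x" "U' = insert (g, {q, e}) (U - {(g, {p, q})})"
    using assms(1) unfolding uhop_def by blast
  have "{q, e} \<inter> snd y = {}" "snd y \<inter> {q, e} = {}" if "y \<in> U - {(g, {p, q})}" for y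
    using that h(1,2) assms(2) unfolding disj_def by force+
  then show ?thesis using assms(2) unfolding h(3) disj_def by auto
qed

lemma uhop_sym:
  assumes "uhop V U U'" "disj U" shows "uhop V U' U"
proof -
  obtain g p q e where h: "(g, {p, q}) \<in> U" "p \<in> V" "q \<in> V" "e \<in> V" "adjacent p q" "adjacent q e"
    "\<forall>x\<in>U. e \<notin> snd x" "U' = insert (g, {q, e}) (U - {(g, {p, q})})"
    using assms(1) unfolding uhop_def by blast
  have e: "e \<noteq> p" "e \<noteq> q" using h by auto
  have "p \<notin> snd x" if "x \<in> U'" for x
    using that h(1) assms(2) e adjacent_neq[OF h(5)] unfolding h(8) disj_def by force
  moreover have "(g, {q, e}) \<notin> U" using h(7) by force
  then have "U = insert (g, {q, p}) (U' - {(g, {e, q})})"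
    using h(1) unfolding h(8) by (auto simp: insert_commute)
  moreover have "(g, {e, q}) \<in> U'" by (simp add: h(8) insert_commute)
  moreover have "adjacent e q" "adjacent q p" using h adj_sym by auto
  ultimately show ?thesis unfolding uhop_def using h(2-4) by blast
qed

lemma ureach_sym:
  assumes "ureach V k U U'" "disj U" shows "ureach V k U' U"
proof -
  have "(uhop V ^^ j) U U' \<Longrightarrow> (uhop V ^^ j) U' U" for j
    using assms(2)
  proof (induction j arbitrary: U)
    case (Suc j)
    then obtain U1 where U1: "uhop V U U1" "(uhop V ^^ j) U1 U'" by (meson relpowp_Suc_E2)
    then have "(uhop V ^^ j) U' U1" using Suc uhop_disj by blast
    then show ?case using uhop_sym[OF U1(1) Suc.prems(2)] by auto
  qed simp
  then show ?thesis using assms(1) by (auto simp: ureach_def)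
qed

text \<open>Hops do not see names. A sequence of hops found for gourds named by their triangles thus
  serves for every labelling, also when labels repeat.\<close>

definition relabel :: "('g \<Rightarrow> 'h) \<Rightarrow> 'g ustate \<Rightarrow> 'h ustate" where
  "relabel \<phi> U = map_prod \<phi> id ` U"

lemma uhop_relabel:
  assumes "uhop V U U'" "disj U" shows "uhop V (relabel \<phi> U) (relabel \<phi> U')"
proof -
  obtain g p q e where h: "(g, {p, q}) \<in> U" "p \<in> V" "q \<in> V" "e \<in> V" "adjacent p q" "adjacent q e"
    "\<forall>x\<in>U. e \<notin> snd x" "U' = insert (g, {q, e}) (U - {(g, {p, q})})"
    using assms(1) unfolding uhop_def by blast
  \<comment> \<open>Distinct elements of the state occupy disjoint nonempty sets, so renaming cannot
    identify them.\<close>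
  have inj: "inj_on (map_prod \<phi> id) U"
  proof (rule inj_onI)
    fix x y assume "x \<in> U" "y \<in> U" "map_prod \<phi> id x = map_prod \<phi> id y"
    moreover from this have "snd x = snd y" by (metis id_apply snd_map_prod)
    ultimately show "x = y" using assms(2) unfolding disj_def by (metis Int_absorb)
  qed
  have "relabel \<phi> U' = insert (\<phi> g, {q, e}) (map_prod \<phi> id ` (U - {(g, {p, q})}))"
    by (simp add: relabel_def h(8))
  also have "map_prod \<phi> id ` (U - {(g, {p, q})}) = relabel \<phi> U - {(\<phi> g, {p, q})}"
    using inj_on_image_set_diff[OF inj, of U "{(g, {p, q})}"] h(1) by (simp add: relabel_def)
  finally have "relabel \<phi> U' = insert (\<phi> g, {q, e}) (relabel \<phi> U - {(\<phi> g, {p, q})})" .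
  moreover have "(\<phi> g, {p, q}) \<in> relabel \<phi> U" using h(1) by (force simp: relabel_def)
  moreover have "\<forall>x\<in>relabel \<phi> U. e \<notin> snd x" using h(7) by (auto simp: relabel_def)
  ultimately show ?thesis unfolding uhop_def using h(2-6) by blast
qed

lemma ureach_relabel:
  assumes "ureach V k U U'" "disj U" shows "ureach V k (relabel \<phi> U) (relabel \<phi> U')"
proof -
  have "(uhop V ^^ j) U U' \<Longrightarrow> (uhop V ^^ j) (relabel \<phi> U) (relabel \<phi> U') \<and> disj U'" for j
    using assms(2)
  proof (induction j arbitrary: U')
    case (Suc j)
    then obtain U1 where U1: "(uhop V ^^ j) U U1" "uhop V U1 U'" by (meson relpowp_Suc_E)
    have a: "(uhop V ^^ j) (relabel \<phi> U) (relabel \<phi> U1)" and d: "disj U1"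
      using Suc.IH[OF U1(1) Suc.prems(2)] by auto
    show ?case using relpowp_Suc_I[OF a uhop_relabel[OF U1(2) d]] uhop_disj[OF U1(2) d] by blast
  qed simp
  then show ?thesis using assms(1) by (auto simp: ureach_def)
qed

text \<open>A state whose gourds are named by the triangles in \<open>\<T>\<close>: the one named \<open>t\<close> lies on \<open>P t\<close>.\<close>

definition stt :: "cell set set \<Rightarrow> (cell set \<Rightarrow> 'g) \<Rightarrow> (cell set \<Rightarrow> cell set) \<Rightarrow> 'g ustate" where
  "stt \<T> \<phi> P = (\<lambda>t. (\<phi> t, P t)) ` \<T>"

definition fit :: "cell set \<Rightarrow> cell set set \<Rightarrow> cell \<Rightarrow> (cell set \<Rightarrow> cell set) \<Rightarrow> bool" where
  "fit V \<T> e P \<longleftrightarrow> finite \<T> \<and> e \<in> V \<and>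
     (\<forall>t\<in>\<T>. t \<in> lat \<and> t \<subseteq> V \<and> P t \<subseteq> t \<and> card (P t) = 2 \<and> e \<notin> P t) \<and>
     (\<forall>s\<in>\<T>. \<forall>t\<in>\<T>. s \<noteq> t \<longrightarrow> P s \<inter> P t = {})"

lemma fit_disjoint: "fit V \<T> e P \<Longrightarrow> s \<in> \<T> \<Longrightarrow> t \<in> \<T> \<Longrightarrow> s \<noteq> t \<Longrightarrow> P s \<inter> P t = {}"
  unfolding fit_def by blast

lemma fit_disj: "fit V \<T> e P \<Longrightarrow> disj (stt \<T> \<phi> P)"
proof -
  assume f: "fit V \<T> e P"
  then have "P t \<noteq> {}" if "t \<in> \<T>" for t using that by (auto simp: fit_def)
  moreover have "P s \<inter> P t = {}" if "s \<in> \<T>" "t \<in> \<T>" "(\<phi> s, P s) \<noteq> (\<phi> t, P t)" for s t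
    using fit_disjoint[OF f that(1,2)] that(3) by blast
  ultimately show ?thesis unfolding disj_def stt_def by simp
qed

text \<open>\<open>\<pi>\<close> is read backwards: after the operation the gourd on
  \<open>P' t\<close> is the one that started in triangle \<open>\<pi> t\<close>. With this
  convention performing \<open>\<pi>\<close> and then \<open>\<rho>\<close> gives
  \<open>\<pi> \<circ> \<rho>\<close>.\<close>

definition opn :: "cell set \<Rightarrow> cell set set \<Rightarrow> nat \<Rightarrow> (cell set \<Rightarrow> cell set) \<Rightarrow> (cell set \<Rightarrow> cell set) \<Rightarrow>
    (cell set \<Rightarrow> cell set) \<Rightarrow> bool" where
  "opn V \<T> c P P' \<pi> \<longleftrightarrow> ureach V c (stt \<T> id P) (stt \<T> \<pi> P')"

lemma relabel_stt: "relabel \<phi> (stt \<T> \<psi> P) = stt \<T> (\<phi> \<circ> \<psi>) P"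
  by (force simp: relabel_def stt_def)

lemma opn_relabel:
  assumes "opn V \<T> c P P' \<pi>" "fit V \<T> e P"
  shows "ureach V c (stt \<T> \<phi> P) (stt \<T> (\<phi> \<circ> \<pi>) P')"
  using ureach_relabel[OF assms(1)[unfolded opn_def] fit_disj[OF assms(2)], of \<phi>]
  by (simp add: relabel_stt)

lemma opn_comp:
  assumes "opn V \<T> c P P1 \<pi>" "opn V \<T> d P1 P2 \<rho>" "fit V \<T> e P1"
  shows "opn V \<T> (c + d) P P2 (\<pi> \<circ> \<rho>)"
  using ureach_trans[OF assms(1)[unfolded opn_def] opn_relabel[OF assms(2,3), of \<pi>]]
  by (simp add: opn_def)

lemma opn_inv:
  assumes "opn V \<T> c P P' \<pi>" "fit V \<T> e P" "bij \<pi>"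
  shows "opn V \<T> c P' P (inv \<pi>)"
proof -
  have "inv \<pi> \<circ> \<pi> = id" using assms(3) bij_is_inj inv_o_cancel by blast
  then have "ureach V c (stt \<T> (inv \<pi>) P) (stt \<T> id P')"
    using opn_relabel[OF assms(1,2), of "inv \<pi>"] by simp
  then show ?thesis unfolding opn_def by (rule ureach_sym) (rule fit_disj[OF assms(2)])
qed

lemma opn_mono: "opn V \<T> c P P' \<pi> \<Longrightarrow> c \<le> d \<Longrightarrow> opn V \<T> d P P' \<pi>"
  unfolding opn_def by (rule ureach_mono)

lemma opn_refl: "opn V \<T> c P P id"
  by (simp add: opn_def)

lemma lat_third:
  assumes "t \<in> lat" "v \<in> t" "w \<in> t" "v \<noteq> w"
  obtains u where "t = {v, w, u}" "adjacent v w" "adjacent v u" "adjacent w u" "u \<noteq> v" "u \<noteq> w"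
proof -
  have vw: "adjacent v w" "t = tri v w \<or> t = tri w v" using lat_edge assms by blast+
  then show ?thesis
    using that[of "la v w"] that[of "la w v"] la_adjacent[OF vw(1)] la_adjacent[OF adj_sym[OF vw(1)]]
      la_neq[OF vw(1)] la_neq[OF adj_sym[OF vw(1)]]
    by (auto simp: tri_def insert_commute)
qed

lemma fit_pos:
  assumes "fit V \<T> e P" "t \<in> \<T>" "e \<in> t" shows "P t = t - {e}"
proof -
  have t: "t \<in> lat" "P t \<subseteq> t - {e}" "card (P t) = 2" using assms by (auto simp: fit_def)
  then have "card t = 3" using card_tri by (auto simp: lat_def)
  moreover from this have fin: "finite t" by (intro card_ge_0_finite) simp
  ultimately have "card (t - {e}) = 2" using assms(3) by simp
  then show ?thesis using card_subset_eq[of "t - {e}" "P t"] fin t(2,3) by simp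
qed

lemma stt_upd:
  assumes "t \<in> \<T>"
  shows "stt \<T> id (P(t := S)) = insert (t, S) (stt \<T> id P - {(t, P t)})"
proof (rule set_eqI)
  fix x :: "cell set \<times> cell set"
  obtain s Q where x: "x = (s, Q)" by fastforce
  have mem: "(s, Q) \<in> stt \<T> id P' \<longleftrightarrow> s \<in> \<T> \<and> Q = P' s" for P'
    unfolding stt_def image_iff by auto
  show "x \<in> stt \<T> id (P(t := S)) \<longleftrightarrow> x \<in> insert (t, S) (stt \<T> id P - {(t, P t)})"
    unfolding x insert_iff Diff_iff mem using assms by (cases "s = t") auto
qed

text \<open>With the hole at a corner of \<open>t\<close>, the gourd of \<open>t\<close> must cover
  the other two corners. Choosing the new hole therefore determines its new position, which is one
  hop away.\<close>

lemma pivot: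
  assumes f: "fit V \<T> v P" and t: "t \<in> \<T>" "v \<in> t" "w \<in> t"
  shows "fit V \<T> w (P(t := t - {w})) \<and> opn V \<T> 1 P (P(t := t - {w})) id"
proof (cases "v = w")
  case True
  then have "P t = t - {w}" using fit_pos[OF f t(1,2)] by blast
  then have "P(t := t - {w}) = P" by (rule fun_upd_idem)
  then show ?thesis using f True opn_refl[of V \<T> 1 P] by metis
next
  case False
  have lat: "t \<in> lat" and tV: "t \<subseteq> V" using f t by (auto simp: fit_def)
  obtain u where u: "t = {v, w, u}" "adjacent v w" "adjacent v u" "adjacent w u" "u \<noteq> v" "u \<noteq> w"
    using lat_third[OF lat t(2,3) False] .
  have Pt: "P t = {w, u}" using fit_pos[OF f t(1,2)] u False by auto
  have tw: "t - {w} = {u, v}" using u False by auto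
  have others: "P s \<inter> {u, v} = {}" "w \<notin> P s" if s: "s \<in> \<T>" "s \<noteq> t" for s
  proof -
    have "v \<notin> P s" using f s(1) by (simp add: fit_def)
    then show "P s \<inter> {u, v} = {}" "w \<notin> P s" using fit_disjoint[OF f s(1) t(1) s(2)] Pt by auto
  qed
  have "fit V \<T> w (P(t := t - {w}))"
    unfolding fit_def
  proof (intro conjI ballI impI)
    show "finite \<T>" "w \<in> V" using f tV t by (auto simp: fit_def)
    fix s assume s: "s \<in> \<T>"
    then have fs: "s \<in> lat" "s \<subseteq> V" "P s \<subseteq> s" "card (P s) = 2" using f by (auto simp: fit_def)
    show "s \<in> lat" "s \<subseteq> V" using fs by auto
    show "(P(t := t - {w})) s \<subseteq> s" using fs by auto
    show "card ((P(t := t - {w})) s) = 2" using fs(4) tw u(5) by (cases "s = t") auto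
    show "w \<notin> (P(t := t - {w})) s" using others s by (cases "s = t") auto
    fix s' assume s': "s' \<in> \<T>" "s \<noteq> s'"
    show "(P(t := t - {w})) s \<inter> (P(t := t - {w})) s' = {}"
      using fit_disjoint[OF f s s'] others(1)[OF s] others(1)[OF s'(1)] s'(2)
      by (cases "s = t"; cases "s' = t") (simp_all add: tw Int_commute)
  qed
  moreover have "uhop V (stt \<T> id P) (stt \<T> id (P(t := t - {w})))"
  proof (rule uhopI[where g = t and p = w and q = u and e = v])
    show "(t, {w, u}) \<in> stt \<T> id P" using t Pt by (force simp: stt_def)
    show "{w, u, v} \<subseteq> V" using tV u by auto
    show "adjacent w u" "adjacent u v" using u adj_sym by auto
    show "v \<notin> snd x" if "x \<in> stt \<T> id P" for x using f that by (auto simp: stt_def fit_def)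
    show "stt \<T> id (P(t := t - {w})) = insert (t, {u, v}) (stt \<T> id P - {(t, {w, u})})"
      using stt_upd[OF t(1), of P "t - {w}"] unfolding tw Pt .
  qed
  ultimately show ?thesis using ureach_hop by (auto simp: opn_def)
qed

lemma travel_pair:
  assumes f: "fit V \<T> v P" and T: "T \<in> \<T>" "T' \<in> \<T>" "w \<in> T" "w \<in> T'" and v: "v \<in> T \<union> T'" and x: "x \<in> T \<union> T'"
  obtains P1 where "fit V \<T> x P1" "opn V \<T> 2 P P1 id" "opn V \<T> 2 P1 P id"
proof -
  obtain S where S: "S \<in> \<T>" "v \<in> S" "w \<in> S" using T v by blast
  obtain S' where S': "S' \<in> \<T>" "w \<in> S'" "x \<in> S'" using T x by blast
  define P0 where "P0 = P(S := S - {w})"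
  have P0: "fit V \<T> w P0" "opn V \<T> 1 P P0 id" using pivot[OF f S] by (auto simp: P0_def)
  define P1 where "P1 = P0(S' := S' - {x})"
  have P1: "fit V \<T> x P1" "opn V \<T> 1 P0 P1 id" using pivot[OF P0(1) S'] by (auto simp: P1_def)
  have op: "opn V \<T> 2 P P1 id" using opn_comp[OF P0(2) P1(2) P0(1)] by (simp add: numeral_2_eq_2)
  show ?thesis
    using that[OF P1(1) op] opn_inv[OF op f] by simp
qed

subsection \<open>Rotation along a path of triangles\<close>

text \<open>A chain of triangles glued at corners is written as a list of odd length: corner, tip,
  corner, tip, and so on up to the last corner.\<close>

fun tris :: "cell list \<Rightarrow> cell set list" where
  "tris (x # t # y # r) = {x, t, y} # tris (y # r)"
| "tris _ = []"

fun prl :: "cell list \<Rightarrow> cell set list" where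
  "prl (a # b # r) = {a, b} # prl r"
| "prl _ = []"

fun adjs :: "cell list \<Rightarrow> bool" where
  "adjs (a # b # r) \<longleftrightarrow> adjacent a b \<and> adjs (b # r)"
| "adjs _ \<longleftrightarrow> True"

lemma prl_append: "even (length xs) \<Longrightarrow> prl (xs @ ys) = prl xs @ prl ys"
  by (induction xs rule: prl.induct) auto

lemma prl_subset: "S \<in> set (prl cs) \<Longrightarrow> S \<subseteq> set cs \<and> S \<noteq> {}"
  by (induction cs rule: prl.induct) auto

lemma length_prl: "length (prl cs) = length cs div 2"
  by (induction cs rule: prl.induct) auto

lemma adjs_append: "adjs (xs @ a # b # ys) \<longleftrightarrow> adjs (xs @ [a]) \<and> adjacent a b \<and> adjs (b # ys)"
  by (induction xs rule: adjs.induct) auto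

text \<open>The hole is the last cell of the path. The gourd next to it hops first and vacates a
  cell for its predecessor, so every gourd advances by one cell.\<close>

lemma shift:
  assumes "adjs cs" "distinct cs" "length cs = 2 * length gs + 1" "set cs \<subseteq> V"
    and "\<And>h S. (h, S) \<in> R \<Longrightarrow> S \<inter> set cs = {} \<and> S \<noteq> {}"
  shows "ureach V (length gs) (R \<union> set (zip gs (prl cs))) (R \<union> set (zip gs (prl (tl cs))))"
  using assms
proof (induction gs arbitrary: cs R)
  case (Cons g gs)
  obtain a b c r where cs: "cs = a # b # c # r"
    using Cons.prems(3) by (cases cs rule: prl.cases; cases "tl (tl cs)") auto
  define Q where "Q = R \<union> {(g, {a, b})}"
  have IH: "ureach V (length gs) (Q \<union> set (zip gs (prl (c # r)))) (Q \<union> set (zip gs (prl (tl (c # r)))))"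
    using Cons.prems cs by (intro Cons.IH) (auto simp: Q_def)
  define Z where "Z = set (zip gs (prl r))"
  have Z: "S \<subseteq> set r \<and> S \<noteq> {}" if "(h, S) \<in> Z" for h S
    using that prl_subset by (auto simp: Z_def dest: set_zip_rightD)
  have notin: "(g, {a, b}) \<notin> R \<union> Z" using Cons.prems(2,5) Z[of g "{a, b}"] by (auto simp: cs)
  have "uhop V (Q \<union> Z) (R \<union> {(g, {b, c})} \<union> Z)"
  proof (rule uhopI[where g = g and p = a and q = b and e = c])
    show "(g, {a, b}) \<in> Q \<union> Z" by (simp add: Q_def)
    show "c \<notin> snd x" if "x \<in> Q \<union> Z" for x
      using that Cons.prems(2) Cons.prems(5)[of "fst x" "snd x"] Z[of "fst x" "snd x"]
      by (auto simp: cs Q_def)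
    show "R \<union> {(g, {b, c})} \<union> Z = insert (g, {b, c}) (Q \<union> Z - {(g, {a, b})})"
      using notin by (auto simp: Q_def)
  qed (use Cons.prems in \<open>auto simp: cs\<close>)
  moreover have "Q \<union> set (zip gs (prl (tl (c # r)))) = Q \<union> Z" by (simp add: Z_def)
  ultimately have "ureach V (length gs + 1) (Q \<union> set (zip gs (prl (c # r)))) (R \<union> {(g, {b, c})} \<union> Z)"
    using ureach_trans[OF IH ureach_hop] by metis
  moreover have "Q \<union> set (zip gs (prl (c # r))) = R \<union> set (zip (g # gs) (prl cs))"
    by (auto simp: Q_def cs)
  moreover have "R \<union> {(g, {b, c})} \<union> Z = R \<union> set (zip (g # gs) (prl (tl cs)))"
    by (auto simp: cs Z_def)
  ultimately show ?case by simp
qed simp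

lemma tris_subset: "t \<in> set (tris cs) \<Longrightarrow> t \<subseteq> set cs"
  by (induction cs rule: tris.induct) auto

lemma tris_distinct: "distinct cs \<Longrightarrow> distinct (tris cs)"
proof (induction cs rule: tris.induct)
  case (1 x t y r)
  then show ?case using tris_subset[of "{x, t, y}" "y # r"] by auto
qed auto

lemma tris_adjs:
  assumes "set (tris cs) \<subseteq> lat" "distinct cs" "odd (length cs)" shows "adjs cs"
  using assms
proof (induction cs rule: tris.induct)
  case (1 x t y r)
  have "{x, t, y} \<in> lat" "x \<noteq> t" "t \<noteq> y" using 1 by auto
  then have "adjacent x t" "adjacent t y" using lat_edge(1)[of "{x, t, y}"] by blast+
  then show ?case using 1 by auto
qed auto

text \<open>The first corner is free, so the first gourd covers the tip and the second corner. This
  blocks that corner for the next triangle, and the argument repeats along the chain.\<close>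

lemma fit_path:
  assumes "fit V \<T> e P" "set (tris cs) \<subseteq> \<T>" "distinct cs" "odd (length cs)"
    "\<And>t. t \<in> set (tris cs) \<Longrightarrow> hd cs \<notin> P t"
  shows "map P (tris cs) = prl (tl cs)"
  using assms(2-)
proof (induction cs rule: tris.induct)
  case (1 x t y r)
  let ?T = "{x, t, y}"
  have T: "?T \<in> \<T>" using 1 by simp
  have "P ?T \<subseteq> ?T" "card (P ?T) = 2" "x \<notin> P ?T" using assms(1) T 1(5)[of ?T] by (auto simp: fit_def)
  then have PT: "P ?T = {t, y}" using 1(3) card_subset_eq[of "{t, y}" "P ?T"] by auto
  have "y \<notin> P s" if s: "s \<in> set (tris (y # r))" for s
  proof -
    have "s \<subseteq> set (y # r)" using tris_subset s by blast
    then have "s \<noteq> ?T" using 1(3) by auto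
    moreover have "s \<in> \<T>" using s 1(2) by auto
    ultimately have "P s \<inter> P ?T = {}" using fit_disjoint[OF assms(1) _ T] by blast
    then show ?thesis using PT by auto
  qed
  then have "map P (tris (y # r)) = prl r" using 1 by simp
  then show ?case using PT by simp
qed (auto elim: tris.elims)

lemma tris_cells: "odd (length cs) \<Longrightarrow> length cs > 1 \<Longrightarrow> set cs = \<Union>(set (tris cs))"
proof (induction cs rule: tris.induct)
  case (1 x t y r)
  then show ?case by (cases r) auto
qed auto

text \<open>The \<open>2 * k + 1\<close> cells form a cycle with \<open>k\<close> gourds and one
  hole. Shifting all gourds twice by one cell takes \<open>2 * k\<close> hops and leaves the hole
  two cells past its place; one more hop of the last gourd restores it. Every gourd has then moved
  on by one triangle, the last one to the first triangle.\<close>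

lemma rotation:
  assumes f: "fit V \<T> (hd cs) P" and sub: "set (tris cs) \<subseteq> \<T>" and cs: "distinct cs" "odd (length cs)" "length cs > 1"
    and close: "adjacent (last cs) (hd cs)"
    and \<pi>: "map \<pi> (rotate1 (tris cs)) = tris cs" "\<And>t. t \<notin> set (tris cs) \<Longrightarrow> \<pi> t = t"
  shows "opn V \<T> (length cs) P P \<pi>"
proof -
  define ts where "ts = tris cs"
  obtain x t y r where c: "cs = x # t # y # r"
    using cs by (cases cs rule: tris.cases) auto
  define k where "k = length ts"
  have len: "length cs = 2 * k + 1"
    using cs(2) unfolding k_def ts_def by (induction cs rule: tris.induct) auto
  have ts: "ts = {x, t, y} # tris (y # r)" by (simp add: ts_def c)
  have map: "map P ts = prl (tl cs)"
    unfolding ts_def using fit_path[OF f sub cs(1,2)] f sub by (auto simp: fit_def)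
  have lat: "set ts \<subseteq> lat" "set cs \<subseteq> V"
    using f sub tris_cells[OF cs(2,3)] by (auto simp: fit_def ts_def)
  have adjs: "adjs cs" using tris_adjs lat cs by (simp add: ts_def)
  have evr: "even (length r)" using cs(2) by (simp add: c)
  define R where "R = (\<lambda>t. (t, P t)) ` (\<T> - set ts)"
  have R: "S \<inter> set cs = {} \<and> S \<noteq> {}" if hS: "(h, S) \<in> R" for h S
  proof -
    have h: "h \<in> \<T>" "h \<notin> set ts" "S = P h" using hS by (auto simp: R_def)
    have "P h \<inter> P s = {}" if "s \<in> set ts" for s
    proof (rule fit_disjoint[OF f h(1)])
      show "s \<in> \<T>" "h \<noteq> s" using that sub h(2) by (auto simp: ts_def)
    qed
    moreover have "set cs = insert x (\<Union>(set (map P ts)))"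
    proof -
      have "\<Union>(set (prl xs)) = set xs" if "even (length xs)" for xs
        using that by (induction xs rule: prl.induct) auto
      then show ?thesis using cs(2) by (simp add: map c)
    qed
    moreover have "x \<notin> P h" "P h \<noteq> {}" using f h by (auto simp: fit_def c)
    ultimately show ?thesis using h(3) by auto
  qed
  have split: "stt \<T> f P = (\<lambda>t. (f t, P t)) ` (\<T> - set ts) \<union> (\<lambda>t. (f t, P t)) ` set ts" for f :: "cell set \<Rightarrow> cell set"
  proof -
    have "\<T> - set ts \<union> set ts = \<T>" using sub unfolding ts_def by blast
    then show ?thesis unfolding stt_def image_Un[symmetric] by simp
  qed
  have start: "stt \<T> id P = R \<union> set (zip ts (prl (tl cs)))"
  proof -
    have "stt \<T> id P = R \<union> (\<lambda>t. (t, P t)) ` set ts" using split[of id] by (simp add: R_def)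
    also have "(\<lambda>t. (t, P t)) ` set ts = set (zip ts (map P ts))" by (induction ts) auto
    finally show ?thesis by (simp add: map id_def)
  qed
  let ?l = "last cs"
  have c1: "prl (t # y # r @ [x]) = prl (tl cs)"
    using prl_append[of "t # y # r" "[x]"] evr by (simp add: c)
  have "adjs (tl cs @ [x])"
  proof -
    obtain zs where zs: "tl cs = zs @ [?l]" by (metis append_butlast_last_id c last_ConsR list.discI list.sel(3))
    moreover have "adjs (tl cs)" using adjs by (simp add: c)
    ultimately show ?thesis using adjs_append[of zs ?l x "[]"] close by (simp add: c)
  qed
  then have s1: "ureach V k (R \<union> set (zip ts (prl (t # y # r @ [x])))) (R \<union> set (zip ts (prl (y # r @ [x]))))"
    using shift[of "t # y # r @ [x]" ts V R] cs len lat R by (auto simp: k_def c)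
  have a2: "adjs (y # r @ [x, t])"
    using \<open>adjs (tl cs @ [x])\<close> adjs adjs_append[of "y # r" x t "[]"] by (auto simp: c)
  have c2: "prl (y # r @ [x, t]) = prl (y # r @ [x])"
    using prl_append[of "y # r @ [x]" "[t]"] evr by simp
  have s2: "ureach V k (R \<union> set (zip ts (prl (y # r @ [x, t])))) (R \<union> set (zip ts (prl (r @ [x, t]))))"
    using shift[of "y # r @ [x, t]" ts V R] a2 cs len lat R by (auto simp: k_def c)
  have c3: "prl (r @ [x, t]) = prl r @ [{x, t}]" using prl_append[OF evr, of "[x, t]"] by simp
  obtain ts0 l where tsl: "ts = ts0 @ [l]" using ts by (metis append_butlast_last_id list.discI)
  have len0: "length ts0 = length (prl r)"
    using len by (simp add: length_prl tsl k_def c)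
  define Y where "Y = R \<union> set (zip ts0 (prl r))"
  have Y: "S \<inter> {x, t, y} = {} \<and> S \<noteq> {}" if "(h, S) \<in> Y" for h S
    using that R[of h S] prl_subset[of S r] cs(1) by (auto simp: Y_def c dest: set_zip_rightD)
  have "uhop V (insert (l, {x, t}) Y) (insert (l, {t, y}) Y)"
  proof (rule uhopI[where g = l and p = x and q = t and e = y])
    show "(l, {x, t}) \<in> insert (l, {x, t}) Y" by simp
    show "{x, t, y} \<subseteq> V" "adjacent x t" "adjacent t y" using lat adjs by (auto simp: c)
    show "y \<notin> snd s" if "s \<in> insert (l, {x, t}) Y" for s
      using that Y[of "fst s" "snd s"] cs(1) by (auto simp: c)
    have "(l, {x, t}) \<notin> Y" using Y[of l "{x, t}"] by auto
    then show "insert (l, {t, y}) Y = insert (l, {t, y}) (insert (l, {x, t}) Y - {(l, {x, t})})" by auto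
  qed
  then have s3: "ureach V 1 (R \<union> set (zip ts (prl (r @ [x, t])))) (insert (l, {t, y}) Y)"
    using ureach_hop len0 by (simp add: c3 tsl Y_def)
  have fin: "insert (l, {t, y}) Y = stt \<T> \<pi> P"
  proof -
    have mP: "map P (rotate1 ts) = prl r @ [{t, y}]" using map by (simp add: ts c)
    have "(\<lambda>t. (\<pi> t, P t)) ` set ts = set (map (\<lambda>t. (\<pi> t, P t)) (rotate1 ts))" by simp
    also have "map (\<lambda>t. (\<pi> t, P t)) (rotate1 ts) = zip (map \<pi> (rotate1 ts)) (map P (rotate1 ts))"
      by (simp add: zip_map_map zip_same_conv_map)
    also have "\<dots> = zip ts (prl r @ [{t, y}])" using \<pi>(1) mP by (simp add: ts_def)
    finally have "(\<lambda>t. (\<pi> t, P t)) ` set ts = insert (l, {t, y}) (set (zip ts0 (prl r)))"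
      using len0 by (simp add: tsl)
    moreover note split[of \<pi>]
    moreover have "(\<lambda>t. (\<pi> t, P t)) ` (\<T> - set ts) = R" unfolding R_def using \<pi>(2) by (auto simp: ts_def)
    ultimately show ?thesis by (auto simp: Y_def)
  qed
  have "ureach V (k + k + 1) (stt \<T> id P) (stt \<T> \<pi> P)"
    using ureach_trans[OF ureach_trans[OF s1 s2[unfolded c2]] s3] unfolding start c1 fin .
  then show ?thesis by (simp add: opn_def len mult_2)
qed

section \<open>Exchanging the gourds of two triangles\<close>

abbreviation swap :: "'a \<Rightarrow> 'a \<Rightarrow> 'a \<Rightarrow> 'a" where
  "swap \<equiv> Transposition.transpose"

text \<open>The quantification over larger families of triangles and over all hole cells in
  \<open>T \<union> T'\<close> keeps an exchange valid after its triangles have become part of a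
  bigger cactus.\<close>

definition sw :: "cell set set \<Rightarrow> cell set \<Rightarrow> cell set \<Rightarrow> nat \<Rightarrow> bool" where
  "sw \<S> T T' c \<longleftrightarrow> T \<in> \<S> \<and> T' \<in> \<S> \<and>
     (\<forall>V \<T> P v. \<S> \<subseteq> \<T> \<longrightarrow> v \<in> T \<union> T' \<longrightarrow> fit V \<T> v P \<longrightarrow> opn V \<T> c P P (swap T T'))"

lemma swD: "sw \<S> T T' c \<Longrightarrow> \<S> \<subseteq> \<T> \<Longrightarrow> v \<in> T \<union> T' \<Longrightarrow> fit V \<T> v P \<Longrightarrow> opn V \<T> c P P (swap T T')"
  unfolding sw_def by blast

lemma sw_commute: "sw \<S> T T' c \<Longrightarrow> sw \<S> T' T c"
  unfolding sw_def by (metis Un_commute transpose_commute)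

lemma sw_mono: "sw \<S> T T' c \<Longrightarrow> \<S> \<subseteq> \<S>' \<Longrightarrow> c \<le> d \<Longrightarrow> sw \<S>' T T' d"
  unfolding sw_def by (meson opn_mono order_trans subsetD)

lemma opn_travel:
  assumes f: "fit V \<T> v P" and T: "T \<in> \<T>" "T' \<in> \<T>" "w \<in> T" "w \<in> T'" and v: "v \<in> T \<union> T'" and x: "x \<in> T \<union> T'"
    and op: "\<And>P1. fit V \<T> x P1 \<Longrightarrow> opn V \<T> c P1 P1 \<pi>"
  shows "opn V \<T> (c + 4) P P \<pi>"
proof -
  obtain P1 where P1: "fit V \<T> x P1" "opn V \<T> 2 P P1 id" "opn V \<T> 2 P1 P id"
    using travel_pair[OF f T v x] .
  have "opn V \<T> (2 + c) P P1 (id \<circ> \<pi>)" by (rule opn_comp[OF P1(2) op[OF P1(1)] P1(1)])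
  then have "opn V \<T> (2 + c + 2) P P (id \<circ> \<pi> \<circ> id)" by (rule opn_comp[OF _ P1(3,1)])
  moreover have "2 + c + 2 = c + 4" by simp
  ultimately show ?thesis by (metis comp_id id_comp)
qed

text \<open>A rotation of two triangles is a transposition. It takes 5 hops, and bringing the hole
  to \<open>x\<close> and back takes 2 pivots each way.\<close>

lemma sw_fan:
  assumes d: "distinct [x, t, w, t', z]" and zx: "adjacent z x"
    and T: "{x, t, w} \<in> \<S>" "{w, t', z} \<in> \<S>"
  shows "sw \<S> {x, t, w} {w, t', z} 9"
  unfolding sw_def
proof (intro conjI allI impI)
  fix V \<T> P v
  assume a: "\<S> \<subseteq> \<T>" "v \<in> {x, t, w} \<union> {w, t', z}" "fit V \<T> v P"
  have "opn V \<T> (5 + 4) P P (swap {x, t, w} {w, t', z})"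
  proof (rule opn_travel[OF a(3) _ _ _ _ a(2)])
    show "{x, t, w} \<in> \<T>" "{w, t', z} \<in> \<T>" using T a(1) by auto
    show "w \<in> {x, t, w}" "w \<in> {w, t', z}" "x \<in> {x, t, w} \<union> {w, t', z}" by auto
    fix P1 assume f: "fit V \<T> x P1"
    have "opn V \<T> (length [x, t, w, t', z]) P1 P1 (swap {x, t, w} {w, t', z})"
      by (rule rotation) (use f d zx T a(1) in auto)
    moreover have "length [x, t, w, t', z] = 5" by simp
    ultimately show "opn V \<T> 5 P1 P1 (swap {x, t, w} {w, t', z})" by metis
  qed
  then show "opn V \<T> 9 P P (swap {x, t, w} {w, t', z})" by simp
qed (use T in auto)

lemma rotation_perm:
  assumes "distinct ts"
  obtains \<pi> where "bij \<pi>" "map \<pi> (rotate1 ts) = ts" "\<And>t. t \<notin> set ts \<Longrightarrow> \<pi> t = t"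
proof -
  define \<sigma> where "\<sigma> = cycle_of_list ts"
  have bij: "bij \<sigma>" using cycle_permutes[of ts] permutes_bij by (auto simp: \<sigma>_def)
  have "map \<sigma> ts = rotate1 ts"
    using cyclic_rotation[of ts 1] assms by (simp add: \<sigma>_def)
  then have "map (inv \<sigma>) (rotate1 ts) = map (inv \<sigma> \<circ> \<sigma>) ts" by (metis map_map)
  then have "map (inv \<sigma>) (rotate1 ts) = ts" using bij by (simp add: bij_is_inj)
  moreover have "inv \<sigma> t = t" if "t \<notin> set ts" for t
    using id_outside_supp[OF that] bij by (metis \<sigma>_def bij_inv_eq_iff)
  ultimately show ?thesis using that bij bij_imp_bij_inv by blast
qed

text \<open>The rotation \<open>\<pi>\<close> maps \<open>T1\<close>, \<open>T2\<close> to
  \<open>T0\<close>, \<open>T1\<close>, so it conjugates the exchange of the former pair into that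
  of the latter. Besides two rotations and \<open>c\<close>, the hole moves from \<open>x\<close> to
  \<open>y\<close> and back (2 hops), and from \<open>v\<close> to \<open>x\<close> and back (4
  hops).\<close>

lemma sw_conj:
  assumes cs: "tris cs = T0 # T1 # T2 # ts" "distinct cs" "odd (length cs)" and close: "adjacent (last cs) (hd cs)"
    and sub: "set (tris cs) \<subseteq> \<S>" and s: "sw \<S> T1 T2 c"
  shows "sw \<S> T0 T1 (c + 2 * length cs + 6)"
  unfolding sw_def
proof (intro conjI allI impI)
  obtain x t y t1 y1 r where c: "cs = x # t # y # t1 # y1 # r"
    using cs(1) by (cases cs rule: tris.cases; cases "tl (tl cs)" rule: tris.cases) auto
  have T: "T0 = {x, t, y}" "T1 = {y, t1, y1}" using cs(1) c by auto
  show "T0 \<in> \<S>" "T1 \<in> \<S>" using sub cs(1) by auto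
  fix V \<T> P v
  assume a: "\<S> \<subseteq> \<T>" "v \<in> T0 \<union> T1" "fit V \<T> v P"
  have TT: "T0 \<in> \<T>" "T1 \<in> \<T>" using sub cs(1) a(1) by auto
  have "distinct (tris cs)" using tris_distinct cs(2) .
  then obtain \<pi> where \<pi>: "bij \<pi>" "map \<pi> (rotate1 (tris cs)) = tris cs" "\<And>t. t \<notin> set (tris cs) \<Longrightarrow> \<pi> t = t"
    using rotation_perm by blast
  have \<pi>T: "\<pi> T1 = T0" "\<pi> T2 = T1" using \<pi>(2) cs(1) by auto
  have "opn V \<T> (c + 2 * length cs + 2 + 4) P P (swap T0 T1)"
  proof (rule opn_travel[OF a(3) TT _ _ a(2)])
    show "y \<in> T0" "y \<in> T1" "x \<in> T0 \<union> T1" using T by auto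
    fix P1 assume f: "fit V \<T> x P1"
    have rot: "opn V \<T> (length cs) P1 P1 \<pi>"
      by (rule rotation) (use f cs close sub a(1) \<pi> in \<open>auto simp: c\<close>)
    define P2 where "P2 = P1(T0 := T0 - {y})"
    have P2: "fit V \<T> y P2" "opn V \<T> 1 P1 P2 id"
      using pivot[OF f TT(1), of y] T by (auto simp: P2_def)
    have ret: "opn V \<T> 1 P2 P1 id" using opn_inv[OF P2(2) f] by simp
    have mid: "opn V \<T> c P2 P2 (swap T1 T2)" using swD[OF s a(1) _ P2(1)] T by auto
    have inv: "opn V \<T> (length cs) P1 P1 (inv \<pi>)" by (rule opn_inv[OF rot f \<pi>(1)])
    have "opn V \<T> (length cs + 1 + c + 1 + length cs) P1 P1 (\<pi> \<circ> id \<circ> swap T1 T2 \<circ> id \<circ> inv \<pi>)"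
      by (rule opn_comp[OF opn_comp[OF opn_comp[OF opn_comp[OF rot P2(2) f] mid P2(1)] ret P2(1)] inv f])
    moreover have "\<pi> \<circ> id \<circ> swap T1 T2 \<circ> id \<circ> inv \<pi> = swap T0 T1"
    proof
      fix u
      have "\<pi> (swap T1 T2 (inv \<pi> u)) = swap (\<pi> T1) (\<pi> T2) (\<pi> (inv \<pi> u))"
        using transpose_apply_commute[OF \<pi>(1), of T1 T2] \<pi>(1)
        by (metis (no_types) bij_inv_eq_iff transpose_apply_commute transpose_involutory)
      then show "(\<pi> \<circ> id \<circ> swap T1 T2 \<circ> id \<circ> inv \<pi>) u = swap T0 T1 u"
        using \<pi>T \<pi>(1) by (simp add: bij_is_surj surj_f_inv_f)
    qed
    moreover have "length cs + 1 + c + 1 + length cs = c + 2 * length cs + 2" by simp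
    ultimately show "opn V \<T> (c + 2 * length cs + 2) P1 P1 (swap T0 T1)" by metis
  qed
  moreover have "c + 2 * length cs + 2 + 4 = c + 2 * length cs + 6" by simp
  ultimately show "opn V \<T> (c + 2 * length cs + 6) P P (swap T0 T1)" by metis
qed

definition jt :: "cell set set \<Rightarrow> cell set \<Rightarrow> cell set \<Rightarrow> nat \<Rightarrow> bool" where
  "jt \<S> T T' c \<longleftrightarrow> T \<noteq> T' \<and> T \<inter> T' \<noteq> {} \<and> sw \<S> T T' c"

text \<open>Paths of joints with their total cost. The additional 1 of a step pays for the pivot
  that carries the hole to the corner shared with the next triangle.\<close>

inductive pth :: "cell set set \<Rightarrow> cell set \<Rightarrow> cell set \<Rightarrow> nat \<Rightarrow> bool" for \<S> where
  stay: "T \<in> \<S> \<Longrightarrow> pth \<S> T T 0"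
| step: "jt \<S> T T1 c \<Longrightarrow> pth \<S> T1 T' d \<Longrightarrow> pth \<S> T T' (c + 1 + d)"

lemma jt_commute: "jt \<S> T T' c \<Longrightarrow> jt \<S> T' T c"
  unfolding jt_def using sw_commute by blast

lemma pth_mono: "pth \<S> T T' c \<Longrightarrow> \<S> \<subseteq> \<S>' \<Longrightarrow> pth \<S>' T T' c"
proof (induction rule: pth.induct)
  case (step T T1 c T' d)
  then have "jt \<S>' T T1 c" using sw_mono unfolding jt_def by blast
  then show ?case using step by (intro pth.step) auto
qed (auto intro: pth.stay)

lemma pth_trans: "pth \<S> T T' c \<Longrightarrow> pth \<S> T' T'' d \<Longrightarrow> pth \<S> T T'' (c + d)"
proof (induction rule: pth.induct)
  case (step T T1 c T' d')
  then show ?case using pth.step[OF step.hyps(1), of T'' "d' + d"] by (simp add: add.assoc)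
qed simp

definition TW :: "cell set set \<Rightarrow> nat \<Rightarrow> bool" where
  "TW \<S> W \<longleftrightarrow> (\<forall>T\<in>\<S>. \<forall>T'\<in>\<S>. \<exists>c\<le>W. pth \<S> T T' c)"

lemma TW_single: "TW {T} 0"
  by (auto simp: TW_def intro: pth.stay)

lemma TW_union:
  assumes "TW \<S>1 W1" "TW \<S>2 W2" "A \<in> \<S>1" "B \<in> \<S>2" "jt (\<S>1 \<union> \<S>2) A B c"
  shows "TW (\<S>1 \<union> \<S>2) (W1 + W2 + c + 1)"
proof -
  let ?S = "\<S>1 \<union> \<S>2"
  have one: "\<exists>d\<le>W1. pth ?S T T' d" if "T \<in> \<S>1" "T' \<in> \<S>1" for T T'
    using assms(1) that pth_mono[of \<S>1 T T' _ ?S] unfolding TW_def by blast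
  have two: "\<exists>d\<le>W2. pth ?S T T' d" if "T \<in> \<S>2" "T' \<in> \<S>2" for T T'
    using assms(2) that pth_mono[of \<S>2 T T' _ ?S] unfolding TW_def by blast
  have cross: "\<exists>d\<le>W1 + W2 + c + 1. pth ?S T T' d" "\<exists>d\<le>W1 + W2 + c + 1. pth ?S T' T d"
    if T: "T \<in> \<S>1" "T' \<in> \<S>2" for T T'
  proof -
    obtain d1 d2 where d: "d1 \<le> W1" "pth ?S T A d1" "d2 \<le> W2" "pth ?S B T' d2"
      using one[OF T(1) assms(3)] two[OF assms(4) T(2)] by blast
    have "pth ?S T T' (d1 + (c + 1 + d2))" using pth_trans[OF d(2) pth.step[OF assms(5) d(4)]] .
    then show "\<exists>d\<le>W1 + W2 + c + 1. pth ?S T T' d" using d by (intro exI[of _ "d1 + (c + 1 + d2)"]) simp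
    obtain e1 e2 where e: "e1 \<le> W1" "pth ?S A T e1" "e2 \<le> W2" "pth ?S T' B e2"
      using one[OF assms(3) T(1)] two[OF T(2) assms(4)] by blast
    have "pth ?S T' T (e2 + (c + 1 + e1))"
      using pth_trans[OF e(4) pth.step[OF jt_commute[OF assms(5)] e(2)]] .
    then show "\<exists>d\<le>W1 + W2 + c + 1. pth ?S T' T d" using e by (intro exI[of _ "e2 + (c + 1 + e1)"]) simp
  qed
  show ?thesis
    unfolding TW_def
  proof (intro ballI)
    fix T T' assume "T \<in> ?S" "T' \<in> ?S"
    then consider "T \<in> \<S>1" "T' \<in> \<S>1" | "T \<in> \<S>2" "T' \<in> \<S>2" | "T \<in> \<S>1" "T' \<in> \<S>2" | "T \<in> \<S>2" "T' \<in> \<S>1"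
      by blast
    then show "\<exists>d\<le>W1 + W2 + c + 1. pth ?S T T' d"
    proof cases
      case 1 then show ?thesis using one by (meson le_add1 order_trans add.assoc le_add_same_cancel1 trans_le_add1)
    next
      case 2 then show ?thesis using two by (meson le_add2 order_trans trans_le_add1)
    qed (use cross in blast)+
  qed
qed

text \<open>The exchange of \<open>T\<close> and \<open>T'\<close> is the conjugate of that of
  \<open>T1\<close> and \<open>T'\<close> by that of \<open>T\<close> and \<open>T1\<close>. Each
  joint of the path is thus used at most twice in all, and the cost
  \<open>c + 1 + 2 * d + 1 + c\<close> is twice that of the extended path.\<close>

lemma pth_swap:
  assumes "pth \<S> T T' d" "\<S> \<subseteq> \<T>" "fit V \<T> v P" "v \<in> T"
  shows "opn V \<T> (2 * d) P P (swap T T')"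
  using assms
proof (induction arbitrary: P v rule: pth.induct)
  case (stay T)
  then show ?case using opn_refl by (simp add: id_def[symmetric])
next
  case (step T T1 c T' d)
  have "T1 \<noteq> T" and s: "sw \<S> T T1 c" using step.hyps(1) by (auto simp: jt_def)
  obtain w where w: "w \<in> T" "w \<in> T1" using step.hyps(1) by (auto simp: jt_def)
  have TT: "T \<in> \<T>" "T1 \<in> \<T>" using s step.prems(1) by (auto simp: sw_def)
  have one: "opn V \<T> c P P (swap T T1)" using swD[OF s] step.prems by blast
  show ?case
  proof (cases "T' = T \<or> T' = T1")
    case True
    then show ?thesis
    proof
      assume "T' = T"
      then show ?thesis using opn_refl by (simp add: id_def[symmetric])
    next
      assume "T' = T1"
      then show ?thesis using opn_mono[OF one] by simp
    qed
  next
    case False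
    define P1 where "P1 = P(T := T - {w})"
    have P1: "fit V \<T> w P1" "opn V \<T> 1 P P1 id"
      using pivot[OF step.prems(2) TT(1) step.prems(3) w(1)] by (auto simp: P1_def)
    have ret: "opn V \<T> 1 P1 P id" using opn_inv[OF P1(2) step.prems(2)] by simp
    have mid: "opn V \<T> (2 * d) P1 P1 (swap T1 T')" using step.IH step.prems(1) P1(1) w(2) by blast
    have "opn V \<T> (c + 1 + 2 * d + 1 + c) P P (swap T T1 \<circ> id \<circ> swap T1 T' \<circ> id \<circ> swap T T1)"
      by (rule opn_comp[OF opn_comp[OF opn_comp[OF opn_comp[OF one P1(2) step.prems(2)] mid P1(1)] ret P1(1)] one step.prems(2)])
    moreover have "swap T T1 \<circ> id \<circ> swap T1 T' \<circ> id \<circ> swap T T1 = swap T T'"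
      using transpose_comp_triple[of T T' T1] False \<open>T1 \<noteq> T\<close> by (auto simp: transpose_commute)
    moreover have "c + 1 + 2 * d + 1 + c = 2 * (c + 1 + d)" by simp
    ultimately show ?thesis by simp
  qed
qed

section \<open>Closed chains of triangles and the turns at their ends\<close>

lemma ring_add6: "ring r s (i + 6) = ring r s i"
proof -
  have "ring r s (Suc (Suc (Suc (Suc (Suc (Suc i)))))) = ring r s i"
    using la_6[of r "ring r s i"] by (simp only: ring_Suc)
  moreover have "i + 6 = Suc (Suc (Suc (Suc (Suc (Suc i)))))" by simp
  ultimately show ?thesis by metis
qed

lemma ring_mod: "ring r s i = ring r s (i mod 6)"
proof (induction i rule: less_induct)
  case (less i)
  show ?case
  proof (cases "i < 6")
    case False
    then have "ring r s i = ring r s (i - 6)" using ring_add6[of r s "i - 6"] by simp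
    also have "\<dots> = ring r s ((i - 6) mod 6)" by (rule less.IH) (use False in simp)
    also have "(i - 6) mod 6 = i mod 6" using False by (simp add: le_mod_geq)
    finally show ?thesis .
  qed simp
qed

lemma ring_ring: "ring r (ring r s i) j = ring r s (i + j)"
  by (induction j) (simp_all add: ring_Suc)

text \<open>A chain of triangles that closes up through the edge from \<open>z\<close> back to
  \<open>x\<close>. A node skips \<open>tri x z\<close> and runs around it along the two subchains.
  \<open>Suc a\<close> counts the triangles at \<open>x\<close> on this side of the edge, skipped
  ones included, and \<open>Suc b\<close> those at \<open>z\<close>.\<close>

inductive chain :: "cell \<Rightarrow> cell \<Rightarrow> cell list \<Rightarrow> nat \<Rightarrow> nat \<Rightarrow> bool" where
  base: "adjacent x z \<Longrightarrow> chain x z [x, la x z, z] 0 0"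
| node: "adjacent x z \<Longrightarrow> chain x (la x z) cs a1 b1 \<Longrightarrow> chain (la x z) z ds a2 b2 \<Longrightarrow>
    distinct (cs @ tl ds) \<Longrightarrow> chain x z (cs @ tl ds) (Suc a1) (Suc b2)"

lemma chain_shape:
  assumes "chain x z cs a b"
  shows "\<exists>u. cs = x # u @ [z]" "odd (length cs)" "distinct cs" "adjacent x z" "length cs > 1"
proof -
  have "(\<exists>u. cs = x # u @ [z]) \<and> odd (length cs) \<and> distinct cs \<and> adjacent x z"
    using assms
  proof (induction rule: chain.induct)
    case (base x z)
    have "[x, la x z, z] = x # [la x z] @ [z]" by simp
    then show ?case using base la_neq[of x z] adjacent_neq[of x z] by auto
  next
    case (node x z cs a1 b1 ds a2 b2)
    obtain u v where u: "cs = x # u @ [la x z]" "ds = la x z # v @ [z]" using node by blast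
    have "cs @ tl ds = x # (u @ la x z # v) @ [z]" by (simp add: u)
    moreover have "odd (length (cs @ tl ds))" using node u by auto
    ultimately show ?case using node.hyps by blast
  qed
  then show "\<exists>u. cs = x # u @ [z]" "odd (length cs)" "distinct cs" "adjacent x z" "length cs > 1"
    by auto
qed

lemma chain_close: assumes "chain x z cs a b" shows "adjacent (last cs) (hd cs)"
proof -
  obtain u where "cs = x # u @ [z]" using chain_shape(1)[OF assms] by blast
  then show ?thesis using chain_shape(4)[OF assms] adjacent_sym[of x z] by simp
qed

lemma tris_join: "odd (length cs) \<Longrightarrow> tris (cs @ ds) = tris cs @ tris (last cs # ds)"
  by (induction cs rule: tris.induct) auto

lemma tris_glue: "chain x w cs a b \<Longrightarrow> chain w z ds a' b' \<Longrightarrow> tris (cs @ tl ds) = tris cs @ tris ds"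
proof -
  assume c: "chain x w cs a b" "chain w z ds a' b'"
  obtain u where u: "cs = x # u @ [w]" using chain_shape(1)[OF c(1)] by blast
  obtain v where v: "ds = w # v @ [z]" using chain_shape(1)[OF c(2)] by blast
  have "last cs # tl ds = ds" using u v by simp
  then show ?thesis using tris_join[OF chain_shape(2)[OF c(1)], of "tl ds"] by simp
qed

lemma tris_snoc: "odd (length cs) \<Longrightarrow> tris (cs @ [t, z]) = tris cs @ [{last cs, t, z}]"
  using tris_join[of cs "[t, z]"] by simp

lemma tris_rev: "odd (length cs) \<Longrightarrow> tris (rev cs) = rev (tris cs)"
proof (induction cs rule: tris.induct)
  case (1 x t y r)
  then have "tris (rev (y # r) @ [t, x]) = rev (tris (y # r)) @ [{last (rev (y # r)), t, x}]"
    by (subst tris_snoc) auto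
  then show ?case by (simp add: insert_commute)
qed (auto elim: tris.elims)

lemma length_tris: "odd (length cs) \<Longrightarrow> length cs = 2 * length (tris cs) + 1"
  by (induction cs rule: tris.induct) auto

text \<open>The counter \<open>a\<close> is an angle: the first triangle of the chain lies
  \<open>a\<close> turns beyond the base edge.\<close>

lemma chain_head: "chain x z cs a b \<Longrightarrow> \<exists>r. cs = x # ring x z (Suc a) # ring x z a # r"
proof (induction rule: chain.induct)
  case (base x z)
  then show ?case by (simp add: ring_Suc)
next
  case (node x z cs a1 b1 ds a2 b2)
  have "la x z = ring x z 1" by (simp add: ring_Suc)
  then have "ring x (la x z) i = ring x z (Suc i)" for i using ring_ring[of x z 1 i] by simp
  then show ?case using node by auto
qed

lemma ring_turn: "ring w x i = ring w (la w x) (5 + i)"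
  using ring_ring[of w x 1 "5 + i"] ring_add6[of w x i] by (simp add: ring_Suc add.commute)

text \<open>\<open>ring z x (5 * i)\<close> is the neighbour of \<open>z\<close> that is \<open>i\<close> clockwise turns away from \<open>x\<close>.\<close>

lemma chain_last: "chain x z cs a b \<Longrightarrow> \<exists>r. cs = r @ [ring z x (5 * b), ring z x (5 * Suc b), z]"
proof (induction rule: chain.induct)
  case (base x z)
  have "ring z x 5 = la x z"
    using ring_turn[of z "la x z" 0] by simp
  then show ?case by simp
next
  case (node x z cs a1 b1 ds a2 b2)
  have "ring z (la x z) i = ring z x (5 + i)" for i
    using ring_turn[of z "la x z" i] by simp
  then have turn: "ring z (la x z) (5 * i) = ring z x (5 * Suc i)" for i by simp
  obtain r where r: "ds = r @ [ring z x (5 * Suc b2), ring z x (5 * Suc (Suc b2)), z]"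
    using node.IH(2) unfolding turn by blast
  show ?case
  proof (cases r)
    case Nil
    obtain u where "cs = x # u @ [la x z]" using chain_shape(1)[OF node.hyps(2)] by auto
    moreover obtain v where "ds = la x z # v" using chain_shape(1)[OF node.hyps(3)] by auto
    ultimately have "cs @ tl ds = (x # u) @ [ring z x (5 * Suc b2), ring z x (5 * Suc (Suc b2)), z]"
      using r Nil by auto
    then show ?thesis by blast
  next
    case (Cons y r')
    then have "cs @ tl ds = (cs @ r') @ [ring z x (5 * Suc b2), ring z x (5 * Suc (Suc b2)), z]"
      using r by simp
    then show ?thesis by blast
  qed
qed

lemma chain_fan: "chain x z cs a b \<Longrightarrow> 1 \<le> i \<Longrightarrow> i \<le> Suc a \<Longrightarrow> ring x z i \<in> set cs - {x, z}"
proof (induction arbitrary: i rule: chain.induct)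
  case (base x z)
  then have i: "i = Suc 0" by simp
  show ?case using base la_neq[of x z] by (simp add: i ring_Suc)
next
  case (node x z cs a1 b1 ds a2 b2)
  have dj: "z \<notin> set cs"
    using node.hyps(4) chain_shape(1)[OF node.hyps(3)] by auto
  show ?case
  proof (cases "i = 1")
    case True
    then show ?thesis using chain_shape(1)[OF node.hyps(2)] la_neq[OF node.hyps(1)] by (auto simp: ring_Suc)
  next
    case False
    then have "ring x (la x z) (i - 1) \<in> set cs - {x, la x z}" using node.prems by (intro node.IH(1)) auto
    moreover have "ring x (la x z) (i - 1) = ring x z i"
      using ring_ring[of x z 1 "i - 1"] node.prems by (simp add: ring_Suc)
    ultimately show ?thesis using dj by auto
  qed
qed

lemma chain_fan_last: "chain x z cs a b \<Longrightarrow> 1 \<le> i \<Longrightarrow> i \<le> Suc b \<Longrightarrow> ring z x (5 * i) \<in> set cs - {x, z}"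
proof (induction arbitrary: i rule: chain.induct)
  case (base x z)
  then have i: "i = 1" by simp
  show ?case using base la_neq[of x z] ring_turn[of z "la x z" 0] by (simp add: i)
next
  case (node x z cs a1 b1 ds a2 b2)
  have dj: "x \<notin> set (tl ds)" using node.hyps(4) chain_shape(1)[OF node.hyps(2)] by auto
  obtain u where u: "ds = la x z # u" using chain_shape(1)[OF node.hyps(3)] by auto
  have turn: "ring z (la x z) j = ring z x (5 + j)" for j
    using ring_turn[of z "la x z" j] by simp
  show ?case
  proof (cases "i = 1")
    case True
    then show ?thesis using chain_shape(1)[OF node.hyps(2)] la_neq[OF node.hyps(1)] turn[of 0] by auto
  next
    case False
    then have "ring z (la x z) (5 * (i - 1)) \<in> set ds - {la x z, z}" using node.prems by (intro node.IH(2)) auto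
    moreover have "ring z (la x z) (5 * (i - 1)) = ring z x (5 * i)"
      using turn[of "5 * (i - 1)"] node.prems by (cases i) auto
    ultimately show ?thesis using dj u by auto
  qed
qed

text \<open>All spokes of the fan at \<open>x\<close> are cells of the chain other than
  \<open>x\<close> and \<open>z\<close>. A sixth turn would return to \<open>z\<close>, so at most
  five triangles fit; likewise at \<open>z\<close>.\<close>

lemma chain_le: assumes "chain x z cs a b" shows "a \<le> 4" "b \<le> 4"
proof -
  show "a \<le> 4"
  proof (rule ccontr)
    assume "\<not> a \<le> 4"
    then have "ring x z 6 \<in> set cs - {x, z}" by (intro chain_fan[OF assms]) auto
    then show False using ring_add6[of x z 0] by simp
  qed
  show "b \<le> 4"
  proof (rule ccontr)
    assume "\<not> b \<le> 4"
    then have "ring z x (5 * 6) \<in> set cs - {x, z}" by (intro chain_fan_last[OF assms]) auto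
    then show False using ring_mod[of z x 30] by simp
  qed
qed

text \<open>At the joint cell there are \<open>b1 + 1\<close> triangles on one side, the skipped
  triangle, and \<open>a2 + 1\<close> on the other side. Six of them would make a spoke of one side
  coincide with one of the other, against distinctness.\<close>

lemma chain_node_le:
  assumes "chain x (la x z) cs a1 b1" "chain (la x z) z ds a2 b2" "distinct (cs @ tl ds)"
  shows "a2 + b1 \<le> 2"
proof (rule ccontr)
  let ?w = "la x z"
  assume c: "\<not> a2 + b1 \<le> 2"
  \<comment> \<open>Counted counterclockwise from \<open>z\<close>, the cell \<open>x\<close> has
    position 5 in the ring. Hence the spoke \<open>k\<close> of the second chain is the spoke
    \<open>5 - k\<close>, counted clockwise from \<open>x\<close>, of the first.\<close>
  define k where "k = min 4 (Suc a2)"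
  have k: "1 \<le> k" "k \<le> Suc a2" "1 \<le> 5 - k" "5 - k \<le> Suc b1" "k \<le> 4" using c by (auto simp: k_def)
  have one: "ring ?w z k \<in> set ds - {?w, z}" using chain_fan[OF assms(2) k(1,2)] .
  have two: "ring ?w x (5 * (5 - k)) \<in> set cs - {x, ?w}" using chain_fan_last[OF assms(1) k(3,4)] .
  have "ring ?w x (5 * (5 - k)) = ring ?w z (5 + 5 * (5 - k))"
    using ring_turn[of ?w x] by simp
  also have "\<dots> = ring ?w z ((5 + 5 * (5 - k)) mod 6)" by (rule ring_mod)
  also have "(5 + 5 * (5 - k)) mod 6 = k"
  proof -
    have "k = 1 \<or> k = 2 \<or> k = 3 \<or> k = 4" using k(1,5) by linarith
    then show ?thesis by auto
  qed
  finally have "ring ?w z k \<in> set cs" using two by simp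
  moreover obtain u where "ds = ?w # u" using chain_shape(1)[OF assms(2)] by auto
  ultimately show False using one assms(3) by auto
qed

text \<open>Both counters grow at every node, so a zero counter at either end leaves only a single
  triangle.\<close>

lemma chain_zero: "chain x z cs 0 b \<Longrightarrow> cs = [x, la x z, z] \<and> b = 0"
  "chain x z cs a 0 \<Longrightarrow> cs = [x, la x z, z] \<and> a = 0"
  by (auto elim: chain.cases)

lemma ring_consecutive: "adjacent r s \<Longrightarrow> adjacent (ring r s i) (ring r s (Suc i))"
  using la_adjacent(3)[OF ring_adjacent[of r s i]] by (simp add: ring_Suc)

text \<open>If the two tips next to the joint cell touch, the five cells of the two triangles form a fan.\<close>

lemma joint_fan:
  assumes c: "chain x (la x z) cs a1 b1" "chain (la x z) z ds a2 b2" "distinct (cs @ tl ds)"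
    and xz: "adjacent x z" and ab: "a2 + b1 = 2 \<or> a2 + b1 = 0"
  obtains As A B Bs where "tris cs = As @ [A]" "tris ds = B # Bs" "la x z \<in> A" "la x z \<in> B"
    "\<And>\<S>. A \<in> \<S> \<Longrightarrow> B \<in> \<S> \<Longrightarrow> sw \<S> A B 9"
proof -
  let ?w = "la x z"
  obtain u where u: "cs = u @ [ring ?w x (5 * b1), ring ?w x (5 * Suc b1), ?w]" using chain_last[OF c(1)] by auto
  obtain r where r: "ds = ?w # ring ?w z (Suc a2) # ring ?w z a2 # r" using chain_head[OF c(2)] by auto
  define p t t' p' where "p = ring ?w x (5 * b1)" and "t = ring ?w x (5 * Suc b1)"
    and "t' = ring ?w z (Suc a2)" and "p' = ring ?w z a2"
  have cs: "cs = (u @ [p]) @ [t, ?w]" and ds: "ds = ?w # t' # p' # r" by (simp_all add: u r p_def t_def t'_def p'_def)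
  have A: "tris cs = tris (u @ [p]) @ [{p, t, ?w}]"
    unfolding cs by (subst tris_snoc) (use chain_shape(2)[OF c(1)] u in auto)
  have B: "tris ds = {?w, t', p'} # tris (p' # r)" by (simp add: ds)
  have dist: "distinct [p, t, ?w, t', p']" using c(3) by (auto simp: cs ds)
  have t: "t = ring ?w z ((5 + 5 * Suc b1) mod 6)"
    using ring_turn[of ?w x "5 * Suc b1"] ring_mod[of ?w z "5 + 5 * Suc b1"] by (simp add: t_def)
  have wz: "adjacent ?w z" using la_adjacent[OF xz] by simp
  have w: "adjacent t' t" if "a2 + b1 = 2"
  proof -
    have "(5 + 5 * Suc b1) mod 6 = Suc (Suc a2)"
    proof -
      have "b1 = 0 \<and> a2 = 2 \<or> b1 = 1 \<and> a2 = 1 \<or> b1 = 2 \<and> a2 = 0" using that by linarith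
      then show ?thesis by auto
    qed
    then show ?thesis using ring_consecutive[OF wz, of "Suc a2"] by (simp add: t t'_def)
  qed
  have z: "adjacent p' p" if "a2 + b1 = 0"
    using that xz adjacent_sym by (auto simp: p_def p'_def)
  have "sw \<S> {p, t, ?w} {?w, t', p'} 9" if S: "{p, t, ?w} \<in> \<S>" "{?w, t', p'} \<in> \<S>" for \<S>
  proof (cases "a2 + b1 = 2")
    case True
    have "sw \<S> {t, p, ?w} {?w, p', t'} 9"
      by (rule sw_fan) (use dist w[OF True] S in \<open>auto simp: insert_commute\<close>)
    then show ?thesis by (simp add: insert_commute)
  next
    case False
    then show ?thesis using sw_fan[of p t ?w t' p' \<S>] dist z ab S by auto
  qed
  then show ?thesis using that[OF A B] by auto
qed

text \<open>\<open>a = 1\<close> means that the first triangle stands alone before the joint. If the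
  joint is no fan, the remaining chain has first counter 1 again; its first two triangles are
  exchanged recursively, and rotating the whole closed chain conjugates this into the desired
  exchange. Each level lowers \<open>b\<close> by one, so a bounded number of rotations
  suffices.\<close>

lemma first_swap:
  "chain x z cs a b \<Longrightarrow> a = 1 \<Longrightarrow> set (tris cs) \<subseteq> \<S> \<Longrightarrow>
    \<exists>T0 T1 r. tris cs = T0 # T1 # r \<and> sw \<S> T0 T1 (9 + (2 * length cs + 6) * b)"
proof (induction rule: chain.induct)
  case (node x z cs a1 b1 ds a2 b2)
  let ?w = "la x z"
  have cs: "cs = [x, la x ?w, ?w]" "b1 = 0" using chain_zero(1) node.hyps(2) node.prems(1) by auto
  then have tcs: "tris cs = [{x, la x ?w, ?w}]" by simp
  have glue: "tris (cs @ tl ds) = tris cs @ tris ds" using tris_glue[OF node.hyps(2,3)] .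
  have le: "a2 + b1 \<le> 2" using chain_node_le node.hyps by blast
  show ?case
  proof (cases "a2 = 1")
    case False
    then have "a2 + b1 = 2 \<or> a2 + b1 = 0" using le cs(2) by auto
    then obtain As A B Bs where AB: "tris cs = As @ [A]" "tris ds = B # Bs"
        "\<And>\<S>. A \<in> \<S> \<Longrightarrow> B \<in> \<S> \<Longrightarrow> sw \<S> A B 9"
      using joint_fan[OF node.hyps(2,3,4,1)] by metis
    have "tris (cs @ tl ds) = A # B # Bs" using glue AB tcs by simp
    moreover have "sw \<S> A B 9" by (rule AB(3)) (use node.prems(2) calculation in auto)
    moreover have "sw \<S> A B (9 + (2 * length (cs @ tl ds) + 6) * Suc b2)" by (rule sw_mono[OF \<open>sw \<S> A B 9\<close>]) simp_all
    ultimately show ?thesis by blast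
  next
    case True
    obtain T0 T1 r where T: "tris ds = T0 # T1 # r" "sw \<S> T0 T1 (9 + (2 * length ds + 6) * b2)"
      using node.IH(2) True node.prems(2) glue by auto
    have c: "chain x z (cs @ tl ds) (Suc a1) (Suc b2)" using chain.node node.hyps by blast
    have tr: "tris (cs @ tl ds) = {x, la x ?w, ?w} # T0 # T1 # r" using glue tcs T by simp
    have "sw \<S> {x, la x ?w, ?w} T0 ((9 + (2 * length ds + 6) * b2) + 2 * length (cs @ tl ds) + 6)"
      by (rule sw_conj[OF tr chain_shape(3,2)[OF c] chain_close[OF c] node.prems(2) T(2)])
    moreover have "(2 * length ds + 6) * b2 \<le> (2 * length (cs @ tl ds) + 6) * b2"
      by (intro mult_right_mono) (auto simp: cs)
    ultimately show ?thesis unfolding tr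
      using sw_mono[of \<S> "{x, la x ?w, ?w}" T0 _ \<S> "9 + (2 * length (cs @ tl ds) + 6) * Suc b2"]
      by (intro exI conjI) auto
  qed
qed simp

text \<open>Mirror image of \<open>first_swap\<close>, reading the chain from its other end.\<close>

lemma last_swap:
  "chain x z cs a b \<Longrightarrow> b = 1 \<Longrightarrow> set (tris cs) \<subseteq> \<S> \<Longrightarrow>
    \<exists>T0 T1 r. tris (rev cs) = T0 # T1 # r \<and> sw \<S> T0 T1 (9 + (2 * length cs + 6) * a)"
proof (induction rule: chain.induct)
  case (node x z cs a1 b1 ds a2 b2)
  let ?w = "la x z"
  have ds: "ds = [?w, la ?w z, z]" "a2 = 0" using chain_zero(2) node.hyps(3) node.prems(1) by auto
  then have tds: "tris ds = [{?w, la ?w z, z}]" by simp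
  have c: "chain x z (cs @ tl ds) (Suc a1) (Suc b2)" using chain.node node.hyps by blast
  have glue: "tris (cs @ tl ds) = tris cs @ tris ds" using tris_glue[OF node.hyps(2,3)] .
  have rev: "tris (rev (cs @ tl ds)) = {?w, la ?w z, z} # rev (tris cs)"
    using tris_rev[OF chain_shape(2)[OF c]] glue tds by simp
  have le: "a2 + b1 \<le> 2" using chain_node_le node.hyps by blast
  show ?case
  proof (cases "b1 = 1")
    case False
    then have "a2 + b1 = 2 \<or> a2 + b1 = 0" using le ds(2) by auto
    then obtain As A B Bs where AB: "tris cs = As @ [A]" "tris ds = B # Bs"
        "\<And>\<S>. A \<in> \<S> \<Longrightarrow> B \<in> \<S> \<Longrightarrow> sw \<S> A B 9"
      using joint_fan[OF node.hyps(2,3,4,1)] by metis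
    have B: "B = {?w, la ?w z, z}" using AB tds by simp
    have "A \<in> set (tris (cs @ tl ds))" "B \<in> set (tris (cs @ tl ds))" unfolding glue AB(1,2) by simp_all
    then have "A \<in> \<S>" "B \<in> \<S>" using node.prems(2) by blast+
    then have "sw \<S> B A 9" by (rule sw_commute[OF AB(3)])
    moreover have "tris (rev (cs @ tl ds)) = B # A # rev As" using rev unfolding AB(1) B by (simp del: rev_append)
    moreover have "sw \<S> B A (9 + (2 * length (cs @ tl ds) + 6) * Suc a1)" by (rule sw_mono[OF \<open>sw \<S> B A 9\<close>]) simp_all
    ultimately show ?thesis by blast
  next
    case True
    obtain T0 T1 r where T: "tris (rev cs) = T0 # T1 # r" "sw \<S> T0 T1 (9 + (2 * length cs + 6) * a1)"
      using node.IH(1) True node.prems(2) glue by auto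
    have tr: "tris (rev (cs @ tl ds)) = {?w, la ?w z, z} # T0 # T1 # r"
      unfolding rev T(1)[symmetric] tris_rev[OF chain_shape(2)[OF node.hyps(2)]] ..
    have "sw \<S> {?w, la ?w z, z} T0 ((9 + (2 * length cs + 6) * a1) + 2 * length (rev (cs @ tl ds)) + 6)"
    proof (rule sw_conj[OF tr _ _ _ _ T(2)])
      show "distinct (rev (cs @ tl ds))" using chain_shape(3)[OF c] unfolding distinct_rev .
      show "odd (length (rev (cs @ tl ds)))" using chain_shape(2)[OF c] unfolding length_rev .
      show "adjacent (last (rev (cs @ tl ds))) (hd (rev (cs @ tl ds)))"
        using chain_shape(5)[OF c] chain_close[OF c] adjacent_sym[of "hd (cs @ tl ds)" "last (cs @ tl ds)"]
        unfolding last_rev hd_rev by blast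
      show "set (tris (rev (cs @ tl ds))) \<subseteq> \<S>"
        using tris_rev[OF chain_shape(2)[OF c]] node.prems(2) by simp
    qed
    moreover have "(2 * length cs + 6) * a1 \<le> (2 * length (cs @ tl ds) + 6) * a1"
      by (intro mult_right_mono) auto
    ultimately show ?thesis unfolding tr
      using sw_mono[of \<S> "{?w, la ?w z, z}" T0 _ \<S> "9 + (2 * length (cs @ tl ds) + 6) * Suc a1"]
      by (intro exI conjI) auto
  qed
qed simp

text \<open>Three or five triangles about the joint cell give a fan and the constant cost 9. With
  four, that is \<open>a2 + b1 = 1\<close>, one of the subchains is a single triangle, and the
  exchange goes through rotations of the chain, at most four levels deep by
  \<open>chain_le\<close>.\<close>

lemma joint:
  assumes c: "chain x (la x z) cs a1 b1" "chain (la x z) z ds a2 b2" "distinct (cs @ tl ds)"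
    and xz: "adjacent x z" and sub: "set (tris (cs @ tl ds)) \<subseteq> \<S>"
  obtains A B c where "A \<in> set (tris cs)" "B \<in> set (tris ds)" "A \<inter> B \<noteq> {}" "sw \<S> A B c"
    "c = 9 \<or> a2 + b1 = 1 \<and> c \<le> 9 + (2 * length (cs @ tl ds) + 6) * 4"
proof -
  let ?w = "la x z"
  have glue: "tris (cs @ tl ds) = tris cs @ tris ds" using tris_glue[OF c(1,2)] .
  have node: "chain x z (cs @ tl ds) (Suc a1) (Suc b2)" using chain.node[OF xz c] .
  have le: "a2 + b1 \<le> 2" using chain_node_le[OF c] .
  consider "a2 + b1 = 2 \<or> a2 + b1 = 0" | "a2 = 1" "b1 = 0" | "a2 = 0" "b1 = 1" using le by linarith
  then show ?thesis
  proof cases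
    case 1
    then obtain As A B Bs where AB: "tris cs = As @ [A]" "tris ds = B # Bs" "?w \<in> A" "?w \<in> B"
        "\<And>\<S>. A \<in> \<S> \<Longrightarrow> B \<in> \<S> \<Longrightarrow> sw \<S> A B 9"
      using joint_fan[OF c xz] by metis
    then show ?thesis using that[of A B 9] sub glue by auto
  next
    case 2
    have cs: "cs = [x, la x ?w, ?w]" "a1 = 0" using chain_zero(2) c(1) 2 by auto
    have "\<exists>T0 T1 r. tris (cs @ tl ds) = T0 # T1 # r \<and> sw \<S> T0 T1 (9 + (2 * length (cs @ tl ds) + 6) * Suc b2)"
      using first_swap[OF node _ sub] cs by simp
    then obtain T0 T1 r where T: "tris (cs @ tl ds) = T0 # T1 # r" "sw \<S> T0 T1 (9 + (2 * length (cs @ tl ds) + 6) * Suc b2)"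
      by blast
    obtain v where v: "ds = ?w # v" using chain_shape(1)[OF c(2)] by auto
    obtain q where q: "ds = ?w # ring ?w z (Suc a2) # ring ?w z a2 # q" using chain_head[OF c(2)] by blast
    have TT: "T0 = {x, la x ?w, ?w}" "T1 \<in> set (tris ds)" "?w \<in> T1"
      using T(1) glue cs q by auto
    have "Suc b2 \<le> 4" using chain_le(2)[OF node] .
    then have "(2 * length (cs @ tl ds) + 6) * Suc b2 \<le> (2 * length (cs @ tl ds) + 6) * 4" by (intro mult_left_mono) auto
    then show ?thesis using that[OF _ TT(2) _ T(2)] TT 2 cs by auto
  next
    case 3
    have ds: "ds = [?w, la ?w z, z]" "b2 = 0" using chain_zero(1) c(2) 3 by auto
    have "\<exists>T0 T1 r. tris (rev (cs @ tl ds)) = T0 # T1 # r \<and> sw \<S> T0 T1 (9 + (2 * length (cs @ tl ds) + 6) * Suc a1)"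
      using last_swap[OF node _ sub] ds by simp
    then obtain T0 T1 r where T: "tris (rev (cs @ tl ds)) = T0 # T1 # r" "sw \<S> T0 T1 (9 + (2 * length (cs @ tl ds) + 6) * Suc a1)"
      by blast
    have rev: "tris (rev (cs @ tl ds)) = {?w, la ?w z, z} # rev (tris cs)"
      using tris_rev[OF chain_shape(2)[OF node]] glue ds by simp
    obtain q where q: "cs = (q @ [ring ?w x (5 * b1)]) @ [ring ?w x (5 * Suc b1), ?w]" using chain_last[OF c(1)] by auto
    have "tris cs = tris (q @ [ring ?w x (5 * b1)]) @ [{ring ?w x (5 * b1), ring ?w x (5 * Suc b1), ?w}]"
      by (subst q, subst tris_snoc) (use chain_shape(2)[OF c(1)] q in auto)
    then have TT: "T0 = {?w, la ?w z, z}" "T1 \<in> set (tris cs)" "?w \<in> T1" using T(1) rev by auto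
    have "Suc a1 \<le> 4" using chain_le(1)[OF node] .
    then have "(2 * length (cs @ tl ds) + 6) * Suc a1 \<le> (2 * length (cs @ tl ds) + 6) * 4" by (intro mult_left_mono) auto
    then show ?thesis using that[OF TT(2) _ _ sw_commute[OF T(2)]] TT 3 ds by auto
  qed
qed

section \<open>Amortised cost of the exchanges\<close>

text \<open>Credit invariant: each triangle of \<open>\<S>\<close> brings 540 units, of which
  \<open>W\<close> are spent. One chain triangle still holds its full 540, every other one at least
  \<open>540 - 60 * (1 + a + b)\<close>, which is not negative because \<open>a\<close> and
  \<open>b\<close> are at most 4.\<close>

definition balanced :: "cell set set \<Rightarrow> nat \<Rightarrow> cell list \<Rightarrow> nat \<Rightarrow> nat \<Rightarrow> bool" where
  "balanced \<S> W cs a b \<longleftrightarrow> finite \<S> \<and> set (tris cs) \<subseteq> \<S> \<and> TW \<S> W \<and>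
     W + 540 * length (tris cs) \<le> 540 * card \<S> + 60 * (1 + a + b) * (length (tris cs) - 1)"

text \<open>In the expensive case the factor \<open>1 + a + b\<close> of both old chains rises by at
  least one, which frees 60 units for each of the \<open>k1 + k2\<close> triangles, while the joint
  costs about 16 units per triangle. In the cheap case the cost 10 is covered by the one triangle
  that loses its full credit.\<close>

lemma balance_arith:
  assumes "W1 + 540 * Suc k1 \<le> 540 * n1 + 60 * (1 + a1 + b1) * k1"
    and "W2 + 540 * Suc k2 \<le> 540 * n2 + 60 * (1 + a2 + b2) * k2"
    and "a2 + b1 \<le> (2::nat)" "c = 9 \<or> a2 + b1 = 1 \<and> c \<le> 9 + (4 * (Suc k1 + Suc k2) + 8) * 4"
  shows "W1 + W2 + c + 1 + 540 * (Suc k1 + Suc k2) \<le> 540 * (n1 + n2) + 60 * (3 + a1 + b2) * (k1 + k2 + 1)"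
proof (cases "a2 + b1 = 1")
  case True
  have "(1 + a1 + b1) * k1 \<le> (2 + a1 + b2) * k1" "(1 + a2 + b2) * k2 \<le> (2 + a1 + b2) * k2"
    using True by (intro mult_right_mono; simp)+
  then show ?thesis using assms by (auto simp: algebra_simps)
next
  case False
  have "(1 + a1 + b1) * k1 \<le> (3 + a1 + b2) * k1" "(1 + a2 + b2) * k2 \<le> (3 + a1 + b2) * k2"
    using assms(3) by (intro mult_right_mono; simp)+
  then show ?thesis using assms False by (auto simp: algebra_simps)
qed

lemma balanced_node:
  assumes c: "chain x (la x z) cs a1 b1" "chain (la x z) z ds a2 b2" "distinct (cs @ tl ds)"
    and xz: "adjacent x z" and b: "balanced \<S>1 W1 cs a1 b1" "balanced \<S>2 W2 ds a2 b2" and dj: "\<S>1 \<inter> \<S>2 = {}"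
  shows "\<exists>W. balanced (\<S>1 \<union> \<S>2) W (cs @ tl ds) (Suc a1) (Suc b2)"
proof -
  have glue: "tris (cs @ tl ds) = tris cs @ tris ds" using tris_glue[OF c(1,2)] .
  have sub: "set (tris (cs @ tl ds)) \<subseteq> \<S>1 \<union> \<S>2" using b glue by (auto simp: balanced_def)
  obtain A B c where AB: "A \<in> set (tris cs)" "B \<in> set (tris ds)" "A \<inter> B \<noteq> {}" "sw (\<S>1 \<union> \<S>2) A B c"
    "c = 9 \<or> a2 + b1 = 1 \<and> c \<le> 9 + (2 * length (cs @ tl ds) + 6) * 4"
    using joint[OF c xz sub] by blast
  have "A \<in> \<S>1" "B \<in> \<S>2" using AB b by (auto simp: balanced_def)
  moreover from this have "jt (\<S>1 \<union> \<S>2) A B c" using AB(3,4) dj by (auto simp: jt_def)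
  ultimately have TW: "TW (\<S>1 \<union> \<S>2) (W1 + W2 + c + 1)"
    using TW_union b unfolding balanced_def by blast
  obtain k1 where k1: "length (tris cs) = Suc k1" using AB(1) by (cases "tris cs") auto
  obtain k2 where k2: "length (tris ds) = Suc k2" using AB(2) by (cases "tris ds") auto
  have k: "length (cs @ tl ds) = 2 * (Suc k1 + Suc k2) + 1"
    using length_tris[OF chain_shape(2)[OF chain.node[OF xz c]]] glue k1 k2 by simp
  have card: "card (\<S>1 \<union> \<S>2) = card \<S>1 + card \<S>2"
    using b dj by (intro card_Un_disjoint) (auto simp: balanced_def)
  have "W1 + W2 + c + 1 + 540 * (Suc k1 + Suc k2) \<le> 540 * (card \<S>1 + card \<S>2) + 60 * (3 + a1 + b2) * (k1 + k2 + 1)"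
  proof (rule balance_arith)
    show "c = 9 \<or> a2 + b1 = 1 \<and> c \<le> 9 + (4 * (Suc k1 + Suc k2) + 8) * 4" using AB(5) k by auto
  qed (use b k1 k2 chain_node_le[OF c] in \<open>auto simp: balanced_def\<close>)
  moreover have "1 + Suc a1 + Suc b2 = 3 + a1 + b2" "length (tris (cs @ tl ds)) = Suc k1 + Suc k2"
    "Suc k1 + Suc k2 - 1 = k1 + k2 + 1"
    using glue k1 k2 by auto
  ultimately have "W1 + W2 + c + 1 + 540 * length (tris (cs @ tl ds)) \<le>
      540 * card (\<S>1 \<union> \<S>2) + 60 * (1 + Suc a1 + Suc b2) * (length (tris (cs @ tl ds)) - 1)"
    using card by metis
  then show ?thesis using b sub TW unfolding balanced_def by blast
qed

section \<open>Cactuses of triangles and the parity recursion over the polygon\<close>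

text \<open>In a list entry \<open>u\<close> is the cell of attachment and \<open>a\<close>,
  \<open>b\<close> are new. The order of the list is an order of construction, so the last triangle
  is always a leaf and can be peeled off.\<close>

inductive cact :: "cell \<Rightarrow> cell set \<Rightarrow> (cell \<times> cell \<times> cell) list \<Rightarrow> bool" for r where
  root: "cact r {r} []"
| grow: "cact r V L \<Longrightarrow> u \<in> V \<Longrightarrow> a \<notin> V \<Longrightarrow> b \<notin> V \<Longrightarrow> a \<noteq> b \<Longrightarrow> {u, a, b} \<in> lat \<Longrightarrow>
    cact r (insert a (insert b V)) (L @ [(u, a, b)])"

definition trs :: "(cell \<times> cell \<times> cell) list \<Rightarrow> cell set set" where
  "trs L = (\<lambda>(u, a, b). {u, a, b}) ` set L"

lemma trs_append [simp]: "trs (L @ L') = trs L \<union> trs L'" by (auto simp: trs_def)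
lemma trs_Nil [simp]: "trs [] = {}" by (simp add: trs_def)
lemma trs_Cons [simp]: "trs ((u, a, b) # L) = insert {u, a, b} (trs L)" by (simp add: trs_def)
lemma finite_trs [simp]: "finite (trs L)" by (simp add: trs_def)

lemma cact_facts:
  assumes "cact r V L"
  shows "r \<in> V" "finite V" "trs L \<subseteq> lat" "\<Union>(trs L) \<subseteq> V" "card V = 2 * length L + 1" "card (trs L) = length L"
proof -
  have "r \<in> V \<and> finite V \<and> trs L \<subseteq> lat \<and> \<Union>(trs L) \<subseteq> V \<and> card V = 2 * length L + 1 \<and> card (trs L) = length L"
    using assms
  proof (induction rule: cact.induct)
    case (grow V L u a b)
    have "{u, a, b} \<notin> trs L" using grow by blast
    then show ?case using grow by auto
  qed auto
  then show "r \<in> V" "finite V" "trs L \<subseteq> lat" "\<Union>(trs L) \<subseteq> V" "card V = 2 * length L + 1" "card (trs L) = length L"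
    by blast+
qed

lemma cact_glue:
  assumes "cact w V' L'" "cact r V L" "w \<in> V" "V \<inter> V' = {w}"
  shows "cact r (V \<union> V') (L @ L')"
  using assms
proof (induction rule: cact.induct)
  case root
  then show ?case by (simp add: insert_absorb)
next
  case (grow V' L' u a b)
  have w: "w \<in> V'" using cact_facts(1) grow.hyps(1) .
  have i: "y \<in> V \<Longrightarrow> y \<in> insert a (insert b V') \<longleftrightarrow> y = w" for y using grow.prems(2,3) by blast
  have n: "a \<notin> V" "b \<notin> V" using i[of a] i[of b] grow.hyps(3,4) w by auto
  have "V \<inter> V' = {w}" using grow.prems(2,3) w by auto
  note n = n this
  have "cact r (insert a (insert b (V \<union> V'))) ((L @ L') @ [(u, a, b)])"
    by (rule cact.grow) (use grow n in auto)
  then show ?case by simp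
qed

lemma card_lat: "t \<in> lat \<Longrightarrow> card t = 3"
  unfolding lat_def using card_tri by blast

lemma lat_not_single: "t \<in> lat \<Longrightarrow> \<not> t \<subseteq> {v}"
  using card_lat[of t] card_mono[of "{v}" t] by auto

lemma lat_pair: "t \<in> lat \<Longrightarrow> s \<in> lat \<Longrightarrow> t \<subseteq> A \<Longrightarrow> s \<subseteq> B \<Longrightarrow> A \<inter> B = {v} \<Longrightarrow> t \<noteq> s"
  using lat_not_single by blast

text \<open>The outcome for odd \<open>ps\<close>: one cactus covers everything including both ends,
  and a chain from \<open>x\<close> to \<open>z\<close> with its credit is handed on to the other
  side of the edge. The same triangles are available rooted at either end, as gluing may happen at
  either.\<close>

definition closed_side :: "cell \<Rightarrow> cell \<Rightarrow> cell list \<Rightarrow> bool" where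
  "closed_side x z ps \<longleftrightarrow> (\<exists>cs a b Lx Lz W. chain x z cs a b \<and> set cs \<subseteq> set (x # ps @ [z]) \<and>
     cact x (set (x # ps @ [z])) Lx \<and> cact z (set (x # ps @ [z])) Lz \<and> trs Lz = trs Lx \<and> balanced (trs Lx) W cs a b)"

text \<open>The outcome for even \<open>ps\<close>: two disjoint cactuses, one at each end. They get
  connected only by triangles beyond the edge, so the statement accepts an arbitrary chain with
  credit from there and settles the account for the union.\<close>

definition open_side :: "cell \<Rightarrow> cell \<Rightarrow> cell list \<Rightarrow> bool" where
  "open_side x z ps \<longleftrightarrow> (\<forall>cs a b \<S> W. chain z x cs a b \<longrightarrow> set cs \<inter> set ps = {} \<longrightarrow> \<Union>\<S> \<inter> set ps = {} \<longrightarrow>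
     balanced \<S> W cs a b \<longrightarrow>
     (\<exists>Vx Vz Lx Lz W'. cact x Vx Lx \<and> cact z Vz Lz \<and> Vx \<union> Vz = set (x # ps @ [z]) \<and> Vx \<inter> Vz = {} \<and>
       TW (\<S> \<union> trs Lx \<union> trs Lz) W' \<and> W' + 540 \<le> 540 * card (\<S> \<union> trs Lx \<union> trs Lz)))"

lemma balanced_bound: "x \<le> 540 * k \<Longrightarrow> W + 540 * Suc k \<le> 540 * c + x \<Longrightarrow> W + 540 \<le> 540 * (c::nat)"
  by simp

text \<open>Here the chain stops growing. Its remaining credit pays off the term with the factor
  \<open>1 + a + b \<le> 9\<close>, and the 540 units of one triangle stay unspent.\<close>

lemma open_side_edge: assumes "adjacent x z" shows "open_side x z []"
  unfolding open_side_def
proof (intro allI impI)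
  fix cs a b \<S> W
  assume c: "chain z x cs a b" and b: "balanced \<S> W cs a b"
  obtain k where k: "length (tris cs) = Suc k"
    using length_tris[OF chain_shape(2)[OF c]] chain_shape(5)[OF c] by (cases "length (tris cs)") auto
  have "(1 + a + b) * k \<le> 9 * k" using chain_le[OF c] by (intro mult_right_mono) auto
  then have "60 * (1 + a + b) * k \<le> 540 * k" using mult_left_mono[of "(1 + a + b) * k" "9 * k" 60] by (simp only: mult.assoc[symmetric])
  moreover have "W + 540 * Suc k \<le> 540 * card \<S> + 60 * (1 + a + b) * k" using b k by (simp add: balanced_def)
  ultimately have "W + 540 \<le> 540 * card \<S>" by (rule balanced_bound)
  then show "\<exists>Vx Vz Lx Lz W'. cact x Vx Lx \<and> cact z Vz Lz \<and> Vx \<union> Vz = set (x # [] @ [z]) \<and> Vx \<inter> Vz = {} \<and>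
      TW (\<S> \<union> trs Lx \<union> trs Lz) W' \<and> W' + 540 \<le> 540 * card (\<S> \<union> trs Lx \<union> trs Lz)"
    using b adjacent_neq[OF assms] cact.root[of x] cact.root[of z]
    by (intro exI[of _ "{x}"] exI[of _ "{z}"] exI[of _ "[]"] exI[of _ W]) (auto simp: balanced_def)
qed

context
  fixes x z w p q A B
  assumes xz: "adjacent x z" and w: "w = la x z" and dist: "distinct (x # (p @ w # q) @ [z])"
    and A: "A = set (x # p @ [w])" and B: "B = set (w # q @ [z])"
begin

lemma AB: "A \<inter> B = {w}" "A \<union> B = set (x # (p @ w # q) @ [z])" "w \<in> A" "w \<in> B" "x \<in> A" "z \<in> B"
  "A \<inter> set q = {}" "B \<inter> set p = {}"
  using dist by (auto simp: A B)

text \<open>Both cactuses already contain \<open>w\<close>, so the triangle is skipped. The cactuses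
  are glued at \<open>w\<close>, and their chains meet there and close up around the skipped
  triangle.\<close>

lemma join_closed_closed:
  assumes "closed_side x w p" "closed_side w z q"
  shows "closed_side x z (p @ w # q)"
proof -
  obtain cs a1 b1 L1 M1 W1 where o: "chain x w cs a1 b1" "set cs \<subseteq> A" "cact x A L1" "cact w A M1"
    "trs M1 = trs L1" "balanced (trs L1) W1 cs a1 b1"
    using assms(1) unfolding closed_side_def A by blast
  obtain ds a2 b2 L2 M2 W2 where o': "chain w z ds a2 b2" "set ds \<subseteq> B" "cact w B L2" "cact z B M2"
    "trs M2 = trs L2" "balanced (trs L2) W2 ds a2 b2"
    using assms(2) unfolding closed_side_def B by blast
  have d: "distinct (cs @ tl ds)"
  proof -
    obtain u where "ds = w # u" using chain_shape(1)[OF o'(1)] by auto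
    then show ?thesis using chain_shape(3)[OF o(1)] chain_shape(3)[OF o'(1)] o(2) o'(2) AB(1) by auto
  qed
  have dj: "trs L1 \<inter> trs L2 = {}"
    using lat_pair[OF _ _ _ _ AB(1)] cact_facts(3,4)[OF o(3)] cact_facts(3,4)[OF o'(3)] by blast
  have c: "chain x z (cs @ tl ds) (Suc a1) (Suc b2)" using chain.node[OF xz] o(1) o'(1) d w by blast
  obtain W where W: "balanced (trs L1 \<union> trs L2) W (cs @ tl ds) (Suc a1) (Suc b2)"
    using balanced_node[OF _ _ d xz o(6) o'(6) dj] o(1) o'(1) w by blast
  have "set (cs @ tl ds) \<subseteq> A \<union> B" using o(2) o'(2) by (cases ds) auto
  moreover have "cact x (A \<union> B) (L1 @ L2)" using cact_glue[OF o'(3) o(3) AB(3,1)] .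
  moreover have "cact z (A \<union> B) (M2 @ M1)" using cact_glue[OF o(4) o'(4) AB(4)] AB(1) by (metis Int_commute Un_commute)
  moreover have "trs (M2 @ M1) = trs (L1 @ L2)" using o(5) o'(5) by auto
  moreover have "balanced (trs (L1 @ L2)) W (cs @ tl ds) (Suc a1) (Suc b2)" using W by simp
  ultimately show ?thesis unfolding closed_side_def AB(2)[symmetric] using c by blast
qed

text \<open>The triangle is used and serves, as a chain of its own, to connect the two halves on
  either side. It is counted in both accounts; of the 540 units saved on each side, one share makes
  up for this and the other is the credit of the new chain.\<close>

lemma join_open_open:
  assumes "open_side x w p" "open_side w z q"
  shows "closed_side x z (p @ w # q)"
proof -
  have adj: "adjacent w x" "adjacent z w" using la_adjacent[OF xz] w by auto
  have la: "la w x = z" "la z w = x" by (simp_all add: w)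
  define \<Delta> where "\<Delta> = {x, w, z}"
  have "\<Delta> = tri x z" by (auto simp: \<Delta>_def w tri_def)
  then have \<Delta>: "\<Delta> \<in> lat" using xz unfolding lat_def by blast
  have d: "\<Delta> = {w, z, x}" "\<Delta> = {z, x, w}" by (auto simp: \<Delta>_def)
  have c: "chain w x [w, z, x] 0 0" "chain z w [z, x, w] 0 0" "chain x z [x, w, z] 0 0"
    using chain.base[OF adj(1)] chain.base[OF adj(2)] chain.base[OF xz] la w by simp_all
  have b: "balanced {\<Delta>} 0 [w, z, x] 0 0" "balanced {\<Delta>} 0 [z, x, w] 0 0"
    using TW_single d by (simp_all add: balanced_def)
  have "set [w, z, x] \<inter> set p = {}" "\<Union>{\<Delta>} \<inter> set p = {}" using dist by (auto simp: \<Delta>_def)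
  then obtain Vx Vw Lx Lw W1 where o: "cact x Vx Lx" "cact w Vw Lw" "Vx \<union> Vw = A" "Vx \<inter> Vw = {}"
      "TW ({\<Delta>} \<union> trs Lx \<union> trs Lw) W1" "W1 + 540 \<le> 540 * card ({\<Delta>} \<union> trs Lx \<union> trs Lw)"
    using assms(1) c(1) b(1) unfolding open_side_def A by meson
  have "set [z, x, w] \<inter> set q = {}" "\<Union>{\<Delta>} \<inter> set q = {}" using dist by (auto simp: \<Delta>_def)
  then obtain Vw' Vz Lw' Lz W2 where o': "cact w Vw' Lw'" "cact z Vz Lz" "Vw' \<union> Vz = B" "Vw' \<inter> Vz = {}"
      "TW ({\<Delta>} \<union> trs Lw' \<union> trs Lz) W2" "W2 + 540 \<le> 540 * card ({\<Delta>} \<union> trs Lw' \<union> trs Lz)"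
    using assms(2) c(2) b(2) unfolding open_side_def B by meson
  note f = cact_facts[OF o(1)] cact_facts[OF o(2)] and f' = cact_facts[OF o'(1)] cact_facts[OF o'(2)]
  have in1: "x \<in> Vx" "w \<in> Vw" "w \<in> Vw'" "z \<in> Vz" using f(1,7) f'(1,7) by auto
  have ne: "x \<noteq> w" "w \<noteq> z" "x \<noteq> z" "x \<notin> B" "z \<notin> A" using dist by (auto simp: A B)
  let ?S1 = "{\<Delta>} \<union> trs Lx \<union> trs Lw" and ?S2 = "{\<Delta>} \<union> trs Lw' \<union> trs Lz"
  have i1: "?S1 \<inter> ?S2 = {\<Delta>}"
  proof -
    have "t \<noteq> s" if "t \<in> trs Lx \<union> trs Lw" "s \<in> trs Lw' \<union> trs Lz" for t s
    proof (rule lat_pair[OF _ _ _ _ AB(1)])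
      show "t \<in> lat" "s \<in> lat" using that f f' by auto
      show "t \<subseteq> A" using that(1) f(4,10) o(3) by blast
      show "s \<subseteq> B" using that(2) f'(4,10) o'(3) by blast
    qed
    then show ?thesis by blast
  qed
  have TW: "TW (?S1 \<union> ?S2) (W1 + W2)"
    unfolding TW_def
  proof (intro ballI)
    let ?S = "?S1 \<union> ?S2"
    have one: "\<exists>c\<le>W1. pth ?S T T' c" if "T \<in> ?S1" "T' \<in> ?S1" for T T'
      using o(5) that pth_mono[of ?S1 T T' _ ?S] unfolding TW_def by blast
    have two: "\<exists>c\<le>W2. pth ?S T T' c" if "T \<in> ?S2" "T' \<in> ?S2" for T T'
      using o'(5) that pth_mono[of ?S2 T T' _ ?S] unfolding TW_def by blast
    fix T T' assume T: "T \<in> ?S" "T' \<in> ?S"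
    have "\<exists>c c'. c + c' \<le> W1 + W2 \<and> pth ?S T \<Delta> c \<and> pth ?S \<Delta> T' c' \<or> (\<exists>c\<le>W1 + W2. pth ?S T T' c)"
    proof -
      consider "T \<in> ?S1" "T' \<in> ?S1" | "T \<in> ?S2" "T' \<in> ?S2" | "T \<in> ?S1" "T' \<in> ?S2" | "T \<in> ?S2" "T' \<in> ?S1"
        using T by blast
      then show ?thesis
      proof cases
        case 1 then show ?thesis using one[OF 1] trans_le_add1 by meson
      next
        case 2 then show ?thesis using two[OF 2] trans_le_add2 by meson
      next
        case 3
        obtain c where "c \<le> W1" "pth ?S T \<Delta> c" using one[OF 3(1), of \<Delta>] by blast
        moreover obtain c' where "c' \<le> W2" "pth ?S \<Delta> T' c'" using two[OF _ 3(2), of \<Delta>] by blast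
        ultimately show ?thesis using add_mono[of c W1 c' W2] by blast
      next
        case 4
        obtain c where "c \<le> W2" "pth ?S T \<Delta> c" using two[OF 4(1), of \<Delta>] by blast
        moreover obtain c' where "c' \<le> W1" "pth ?S \<Delta> T' c'" using one[OF _ 4(2), of \<Delta>] by blast
        moreover have "c + c' \<le> W1 + W2" using calculation by linarith
        ultimately show ?thesis by blast
      qed
    qed
    then show "\<exists>c\<le>W1 + W2. pth ?S T T' c" using pth_trans by meson
  qed
  have "finite ?S1" "finite ?S2" by auto
  then have card: "card (?S1 \<union> ?S2) + 1 = card ?S1 + card ?S2"
    using card_Un_Int[of ?S1 ?S2] unfolding i1 by simp
  have "balanced (?S1 \<union> ?S2) (W1 + W2) [x, w, z] 0 0"
    using TW o(6) o'(6) card by (auto simp: balanced_def \<Delta>_def)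
  define L where "L = Lx @ [(x, w, z)] @ Lw @ Lw' @ Lz"
  define M where "M = Lz @ [(z, w, x)] @ Lw' @ Lw @ Lx"
  have triL: "cact x {w, z, x} [(x, w, z)]" "cact z {w, x, z} [(z, w, x)]"
    using cact.grow[OF cact.root, of x x w z] cact.grow[OF cact.root, of z z w x] ne \<Delta> d
    by (auto simp: \<Delta>_def insert_commute)
  have L: "cact x (A \<union> B) L"
  proof -
    have "cact x (Vx \<union> {w, z, x}) (Lx @ [(x, w, z)])"
      by (rule cact_glue[OF triL(1) o(1)]) (use in1 o(3,4) ne in auto)
    then have "cact x (Vx \<union> {w, z, x} \<union> Vw) ((Lx @ [(x, w, z)]) @ Lw)"
      by (rule cact_glue[OF o(2)]) (use in1 o(3,4) ne in auto)
    then have "cact x (Vx \<union> {w, z, x} \<union> Vw \<union> Vw') (((Lx @ [(x, w, z)]) @ Lw) @ Lw')"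
      by (rule cact_glue[OF o'(1)]) (use in1 o(3,4) o'(3,4) ne AB(1) in auto)
    then have "cact x (Vx \<union> {w, z, x} \<union> Vw \<union> Vw' \<union> Vz) ((((Lx @ [(x, w, z)]) @ Lw) @ Lw') @ Lz)"
      by (rule cact_glue[OF o'(2)]) (use in1 o(3,4) o'(3,4) ne AB(1) in auto)
    moreover have "Vx \<union> {w, z, x} \<union> Vw \<union> Vw' \<union> Vz = A \<union> B" using o(3) o'(3) in1 by auto
    ultimately show ?thesis by (simp add: L_def)
  qed
  have M: "cact z (A \<union> B) M"
  proof -
    have "cact z (Vz \<union> {w, x, z}) (Lz @ [(z, w, x)])"
      by (rule cact_glue[OF triL(2) o'(2)]) (use in1 o'(3,4) ne in auto)
    then have "cact z (Vz \<union> {w, x, z} \<union> Vw') ((Lz @ [(z, w, x)]) @ Lw')"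
      by (rule cact_glue[OF o'(1)]) (use in1 o'(3,4) ne in auto)
    then have "cact z (Vz \<union> {w, x, z} \<union> Vw' \<union> Vw) (((Lz @ [(z, w, x)]) @ Lw') @ Lw)"
      by (rule cact_glue[OF o(2)]) (use in1 o(3,4) o'(3,4) ne AB(1) in auto)
    then have "cact z (Vz \<union> {w, x, z} \<union> Vw' \<union> Vw \<union> Vx) ((((Lz @ [(z, w, x)]) @ Lw') @ Lw) @ Lx)"
      by (rule cact_glue[OF o(1)]) (use in1 o(3,4) o'(3,4) ne AB(1) in auto)
    moreover have "Vz \<union> {w, x, z} \<union> Vw' \<union> Vw \<union> Vx = A \<union> B" using o(3) o'(3) in1 by auto
    ultimately show ?thesis by (simp add: M_def)
  qed
  have tr: "trs L = ?S1 \<union> ?S2" "trs M = trs L"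
    by (auto simp: L_def M_def \<Delta>_def insert_commute)
  have "set [x, w, z] \<subseteq> A \<union> B" using AB by auto
  then show ?thesis
    unfolding closed_side_def AB(2)[symmetric]
    using c(3) L M tr \<open>balanced (?S1 \<union> ?S2) (W1 + W2) [x, w, z] 0 0\<close> by metis
qed

text \<open>The closed side contains \<open>w\<close> and the triangle is skipped. The incoming
  chain from \<open>z\<close> to \<open>x\<close> is prolonged by the chain of the closed side to a
  chain from \<open>z\<close> to \<open>w\<close>, which is what the open side beyond
  \<open>wz\<close> asks for.\<close>

lemma join_closed_open:
  assumes "closed_side x w p" "open_side w z q"
  shows "open_side x z (p @ w # q)"
  unfolding open_side_def
proof (intro allI impI)
  fix cs a b \<S> W
  assume c: "chain z x cs a b" and cs: "set cs \<inter> set (p @ w # q) = {}" and S: "\<Union>\<S> \<inter> set (p @ w # q) = {}"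
    and bal: "balanced \<S> W cs a b"
  have adj: "adjacent z w" and la: "la z w = x" using la_adjacent[OF xz] w by auto
  obtain ds a1 b1 L1 M1 W1 where o: "chain x w ds a1 b1" "set ds \<subseteq> A" "cact x A L1" "cact w A M1"
    "trs M1 = trs L1" "balanced (trs L1) W1 ds a1 b1"
    using assms(1) unfolding closed_side_def A by blast
  note f = cact_facts[OF o(3)]
  obtain u where u: "ds = x # u" using chain_shape(1)[OF o(1)] by auto
  have d: "distinct (cs @ tl ds)"
    using chain_shape(3)[OF c] chain_shape(3)[OF o(1)] o(2) u cs by (auto simp: A)
  have dj: "\<S> \<inter> trs L1 = {}"
  proof -
    have False if t: "t \<in> \<S>" "t \<in> trs L1" for t
    proof -
      have "t \<subseteq> A" "t \<in> lat" using t(2) f by auto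
      moreover have "t \<inter> set (p @ w # q) = {}" using S t(1) by blast
      ultimately have "t \<subseteq> {x}" by (auto simp: A)
      then show False using lat_not_single \<open>t \<in> lat\<close> by blast
    qed
    then show ?thesis by blast
  qed
  have c1: "chain z (la z w) cs a b" "chain (la z w) w ds a1 b1" using c o(1) by (simp_all only: la)
  have c': "chain z w (cs @ tl ds) (Suc a) (Suc b1)" using chain.node[OF adj c1 d] .
  obtain W' where W': "balanced (\<S> \<union> trs L1) W' (cs @ tl ds) (Suc a) (Suc b1)"
    using balanced_node[OF c1 d adj bal o(6) dj] by blast
  have "set (cs @ tl ds) \<inter> set q = {}" using cs o(2) u AB(7) by auto
  moreover have "\<Union>(\<S> \<union> trs L1) \<inter> set q = {}" using S f(4) AB(7) by auto
  ultimately obtain Vw Vz Lw Lz W2 where o': "cact w Vw Lw" "cact z Vz Lz" "Vw \<union> Vz = B" "Vw \<inter> Vz = {}"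
      "TW (\<S> \<union> trs L1 \<union> trs Lw \<union> trs Lz) W2" "W2 + 540 \<le> 540 * card (\<S> \<union> trs L1 \<union> trs Lw \<union> trs Lz)"
    using assms(2) c' W' unfolding open_side_def B by meson
  have in1: "w \<in> Vw" "z \<in> Vz" using cact_facts(1)[OF o'(1)] cact_facts(1)[OF o'(2)] by auto
  have "cact x (A \<union> Vw) (L1 @ Lw)"
    by (rule cact_glue[OF o'(1) o(3) AB(3)]) (use AB(1) o'(3) in1 in auto)
  moreover have "A \<union> Vw \<union> Vz = A \<union> B" "(A \<union> Vw) \<inter> Vz = {}" using AB(1) o'(3,4) in1 by auto
  moreover have "\<S> \<union> trs (L1 @ Lw) \<union> trs Lz = \<S> \<union> trs L1 \<union> trs Lw \<union> trs Lz" by auto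
  ultimately show "\<exists>Vx Vz Lx Lz W'. cact x Vx Lx \<and> cact z Vz Lz \<and> Vx \<union> Vz = set (x # (p @ w # q) @ [z]) \<and>
      Vx \<inter> Vz = {} \<and> TW (\<S> \<union> trs Lx \<union> trs Lz) W' \<and> W' + 540 \<le> 540 * card (\<S> \<union> trs Lx \<union> trs Lz)"
    unfolding AB(2)[symmetric] using o'(2,5,6) by metis
qed

text \<open>Mirror image: the chain of the closed side precedes the incoming one, giving a chain
  from \<open>w\<close> to \<open>x\<close> for the open side.\<close>

lemma join_open_closed:
  assumes "open_side x w p" "closed_side w z q"
  shows "open_side x z (p @ w # q)"
  unfolding open_side_def
proof (intro allI impI)
  fix cs a b \<S> W
  assume c: "chain z x cs a b" and cs: "set cs \<inter> set (p @ w # q) = {}" and S: "\<Union>\<S> \<inter> set (p @ w # q) = {}"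
    and bal: "balanced \<S> W cs a b"
  have adj: "adjacent w x" and la: "la w x = z" using la_adjacent[OF xz] w by auto
  obtain ds a1 b1 L2 M2 W1 where o: "chain w z ds a1 b1" "set ds \<subseteq> B" "cact w B L2" "cact z B M2"
    "trs M2 = trs L2" "balanced (trs L2) W1 ds a1 b1"
    using assms(2) unfolding closed_side_def B by blast
  note f = cact_facts[OF o(4)]
  obtain u where u: "cs = z # u" using chain_shape(1)[OF c] by auto
  have d: "distinct (ds @ tl cs)"
    using chain_shape(3)[OF c] chain_shape(3)[OF o(1)] o(2) u cs by (auto simp: B)
  have dj: "trs L2 \<inter> \<S> = {}"
  proof -
    have False if t: "t \<in> \<S>" "t \<in> trs M2" for t
    proof -
      have "t \<subseteq> B" "t \<in> lat" using t(2) f by auto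
      moreover have "t \<inter> set (p @ w # q) = {}" using S t(1) by blast
      ultimately have "t \<subseteq> {z}" by (auto simp: B)
      then show False using lat_not_single \<open>t \<in> lat\<close> by blast
    qed
    then show ?thesis using o(5) by blast
  qed
  have c1: "chain w (la w x) ds a1 b1" "chain (la w x) x cs a b" using c o(1) by (simp_all only: la)
  have c': "chain w x (ds @ tl cs) (Suc a1) (Suc b)" using chain.node[OF adj c1 d] .
  obtain W' where W': "balanced (trs L2 \<union> \<S>) W' (ds @ tl cs) (Suc a1) (Suc b)"
    using balanced_node[OF c1 d adj o(6) bal dj] by blast
  have "set (ds @ tl cs) \<inter> set p = {}" using cs o(2) u AB(8) by auto
  moreover have "\<Union>(trs L2 \<union> \<S>) \<inter> set p = {}" using S f(4) AB(8) o(5) by auto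
  ultimately obtain Vx Vw Lx Lw W2 where o': "cact x Vx Lx" "cact w Vw Lw" "Vx \<union> Vw = A" "Vx \<inter> Vw = {}"
      "TW (trs L2 \<union> \<S> \<union> trs Lx \<union> trs Lw) W2" "W2 + 540 \<le> 540 * card (trs L2 \<union> \<S> \<union> trs Lx \<union> trs Lw)"
    using assms(1) c' W' unfolding open_side_def A by meson
  have in1: "x \<in> Vx" "w \<in> Vw" using cact_facts(1)[OF o'(1)] cact_facts(1)[OF o'(2)] by auto
  have "cact z (B \<union> Vw) (M2 @ Lw)"
    by (rule cact_glue[OF o'(2) o(4) AB(4)]) (use AB(1) o'(3) in1 in auto)
  moreover have "Vx \<union> (B \<union> Vw) = A \<union> B" "Vx \<inter> (B \<union> Vw) = {}" using AB(1) o'(3,4) in1 by auto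
  moreover have "\<S> \<union> trs Lx \<union> trs (M2 @ Lw) = trs L2 \<union> \<S> \<union> trs Lx \<union> trs Lw" using o(5) by auto
  ultimately show "\<exists>Vx Vz Lx Lz W'. cact x Vx Lx \<and> cact z Vz Lz \<and> Vx \<union> Vz = set (x # (p @ w # q) @ [z]) \<and>
      Vx \<inter> Vz = {} \<and> TW (\<S> \<union> trs Lx \<union> trs Lz) W' \<and> W' + 540 \<le> 540 * card (\<S> \<union> trs Lx \<union> trs Lz)"
    unfolding AB(2)[symmetric] using o'(1,5,6) by metis
qed

end

lemma poly_sides:
  "poly x z ps D \<Longrightarrow> adjacent x z \<Longrightarrow> distinct (x # ps @ [z]) \<Longrightarrow>
    (odd (length ps) \<longrightarrow> closed_side x z ps) \<and> (even (length ps) \<longrightarrow> open_side x z ps)"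
proof (induction rule: poly.induct)
  case (edge x z)
  then show ?case using open_side_edge by simp
next
  case (node x z ps D qs E)
  let ?w = "la x z"
  have adj: "adjacent x ?w" "adjacent ?w z" using la_adjacent[OF node.prems(1)] by auto
  have "distinct (x # ps @ [?w])" "distinct (?w # qs @ [z])" using node.prems(2) by auto
  then have I: "odd (length ps) \<longrightarrow> closed_side x ?w ps" "even (length ps) \<longrightarrow> open_side x ?w ps"
    "odd (length qs) \<longrightarrow> closed_side ?w z qs" "even (length qs) \<longrightarrow> open_side ?w z qs"
    using node.IH adj by blast+
  note J = join_closed_closed[OF node.prems(1) HOL.refl node.prems(2) HOL.refl HOL.refl]
    join_open_open[OF node.prems(1) HOL.refl node.prems(2) HOL.refl HOL.refl]
    join_closed_open[OF node.prems(1) HOL.refl node.prems(2) HOL.refl HOL.refl]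
    join_open_closed[OF node.prems(1) HOL.refl node.prems(2) HOL.refl HOL.refl]
  have "odd (length (ps @ ?w # qs)) \<longleftrightarrow> (odd (length ps) \<longleftrightarrow> odd (length qs))" by simp
  then show ?case using I J by blast
qed

text \<open>The odd number of cells makes the root side closed, and paying off its chain leaves
  \<open>W\<close> linear in the number of gourds.\<close>

lemma poly_cact:
  assumes "poly x z ps D" "adjacent x z" "distinct (x # ps @ [z])" "set (x # ps @ [z]) = B" "card B = 2 * n + 1"
  obtains L W where "cact x B L" "TW (trs L) W" "W \<le> 540 * n" "length L = n"
proof -
  have "card B = length ps + 2" using distinct_card[OF assms(3)] assms(4) by simp
  then have "odd (length ps)" using assms(5) by (metis even_add odd_even_add even_numeral even_mult_iff odd_one)
  then have "closed_side x z ps" using poly_sides assms by blast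
  then obtain cs a b L W where o: "chain x z cs a b" "cact x B L" "balanced (trs L) W cs a b"
    unfolding closed_side_def assms(4) by blast
  have n: "length L = n" using cact_facts(5)[OF o(2)] assms(5) by simp
  obtain k where k: "length (tris cs) = Suc k"
    using length_tris[OF chain_shape(2)[OF o(1)]] chain_shape(5)[OF o(1)] by (cases "length (tris cs)") auto
  have "(1 + a + b) * k \<le> 9 * k" using chain_le[OF o(1)] by (intro mult_right_mono) auto
  then have "60 * (1 + a + b) * k \<le> 540 * k" using mult_left_mono[of "(1 + a + b) * k" "9 * k" 60] by (simp only: mult.assoc[symmetric])
  moreover have "W + 540 * Suc k \<le> 540 * n + 60 * (1 + a + b) * k"
    using o(3) k cact_facts(6)[OF o(2)] n by (simp add: balanced_def)
  ultimately have "W + 540 \<le> 540 * n" by (rule balanced_bound)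
  then have "W \<le> 540 * n" by simp
  then show ?thesis using that o n by (auto simp: balanced_def)
qed

section \<open>Sorting parked gourds\<close>

text \<open>The hole passes from each triangle to the next through the attachment cell, with at most
  one pivot for each triangle.\<close>

lemma cact_travel:
  assumes "cact r V L" "v \<in> V" "trs L \<subseteq> \<T>" "fit W \<T> r P"
  obtains P1 where "fit W \<T> v P1" "opn W \<T> (length L) P P1 id"
proof -
  have "\<exists>P1. fit W \<T> v P1 \<and> opn W \<T> (length L) P P1 id"
    using assms(1-3)
  proof (induction arbitrary: v rule: cact.induct)
    case root
    then show ?case using assms(4) opn_refl by blast
  next
    case (grow V L u a b)
    show ?case
    proof (cases "v \<in> V")
      case True
      moreover have "trs L \<subseteq> \<T>" using grow.prems(2) by simp
      ultimately obtain P1 where P1: "fit W \<T> v P1" "opn W \<T> (length L) P P1 id"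
        using grow.IH by blast
      have "opn W \<T> (length (L @ [(u, a, b)])) P P1 id" by (rule opn_mono[OF P1(2)]) simp
      then show ?thesis using P1(1) by blast
    next
      case False
      have "trs L \<subseteq> \<T>" using grow.prems(2) by simp
      then obtain P1 where P1: "fit W \<T> u P1" "opn W \<T> (length L) P P1 id"
        using grow.IH grow.hyps(2) by blast
      define t where "t = {u, a, b}"
      have t: "t \<in> \<T>" "u \<in> t" "v \<in> t" using grow.prems False by (auto simp: t_def)
      have "opn W \<T> (length L + 1) P (P1(t := t - {v})) (id \<circ> id)"
        by (rule opn_comp[OF P1(2) _ P1(1)]) (use pivot[OF P1(1) t] in blast)
      moreover have "length L + 1 = length (L @ [(u, a, b)])" by simp
      ultimately have "opn W \<T> (length (L @ [(u, a, b)])) P (P1(t := t - {v})) id" by (metis comp_id)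
      then show ?thesis using pivot[OF P1(1) t] by blast
    qed
  qed
  then show ?thesis using that by blast
qed

text \<open>The parked state: the root stays free, and each triangle holds its gourd on the two
  cells that it added.\<close>

definition cu :: "'g list \<Rightarrow> (cell \<times> cell \<times> cell) list \<Rightarrow> 'g ustate" where
  "cu gs L = set (zip gs (map (\<lambda>(u, a, b). {a, b}) L))"

lemma cact_fit:
  assumes "cact r V L"
  obtains P where "fit V (trs L) r P" "\<And>u a b. (u, a, b) \<in> set L \<Longrightarrow> P {u, a, b} = {a, b}"
proof -
  have "\<exists>P. fit V (trs L) r P \<and> (\<forall>(u, a, b) \<in> set L. P {u, a, b} = {a, b})"
    using assms
  proof (induction rule: cact.induct)
    case root
    then show ?case by (auto simp: fit_def)
  next
    case (grow V L u a b)
    obtain P where P: "fit V (trs L) r P" "\<forall>(u, a, b) \<in> set L. P {u, a, b} = {a, b}" using grow.IH by blast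
    define t where "t = {u, a, b}"
    have tn: "s \<subseteq> V" "s \<noteq> t" if "s \<in> trs L" for s
      using cact_facts(4)[OF grow.hyps(1)] that grow.hyps(3) by (auto simp: t_def)
    have r: "r \<in> V" using cact_facts(1) grow.hyps(1) .
    have tr: "trs (L @ [(u, a, b)]) = insert t (trs L)" by (simp add: t_def)
    have ab: "{a, b} \<inter> P s = {}" "P s \<inter> {a, b} = {}" if "s \<in> trs L" for s
      using P(1) tn(1)[OF that] grow.hyps(3,4) that by (auto simp: fit_def)
    have "fit (insert a (insert b V)) (insert t (trs L)) r (P(t := {a, b}))"
      unfolding fit_def
    proof (intro conjI ballI impI)
      show "finite (insert t (trs L))" "r \<in> insert a (insert b V)" using r by auto
      fix s assume s: "s \<in> insert t (trs L)"
      show "s \<in> lat" using s cact_facts(3)[OF grow.hyps(1)] grow.hyps(6) t_def by auto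
      show "s \<subseteq> insert a (insert b V)" using s tn(1) grow.hyps(2) t_def by auto
      show "(P(t := {a, b})) s \<subseteq> s" using s P(1) by (auto simp: fit_def t_def)
      show "card ((P(t := {a, b})) s) = 2" using s P(1) grow.hyps(5) by (auto simp: fit_def)
      show "r \<notin> (P(t := {a, b})) s" using s P(1) r grow.hyps(3,4) by (auto simp: fit_def)
      fix s' assume s': "s' \<in> insert t (trs L)" "s \<noteq> s'"
      show "(P(t := {a, b})) s \<inter> (P(t := {a, b})) s' = {}"
        using s s' ab fit_disjoint[OF P(1), of s s'] by (cases "s = t"; cases "s' = t") simp_all
    qed
    moreover have "(P(t := {a, b})) {u', a', b'} = {a', b'}" if m: "(u', a', b') \<in> set (L @ [(u, a, b)])" for u' a' b'
    proof (cases "(u', a', b') \<in> set L")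
      case True
      then have "{u', a', b'} \<in> trs L" unfolding trs_def using imageI[OF True, of "\<lambda>(u, a, b). {u, a, b}"] by (simp only: prod.case)
      then have "{u', a', b'} \<noteq> t" by (rule tn(2))
      moreover have "P {u', a', b'} = {a', b'}" using bspec[OF P(2) True] by simp
      ultimately show ?thesis by (simp only: fun_upd_apply if_False)
    next
      case False
      then show ?thesis using m by (simp add: t_def)
    qed
    ultimately show ?case unfolding tr by (intro exI[of _ "P(t := {a, b})"]) blast
  qed
  then show ?thesis using that by blast
qed

lemma distinct_map_eq:
  assumes "distinct xs" "length ys = length xs" obtains f where "map f xs = ys"
proof
  show "map (\<lambda>x. the (map_of (zip xs ys) x)) xs = ys"
  proof (rule nth_equalityI)
    fix i assume i: "i < length (map (\<lambda>x. the (map_of (zip xs ys) x)) xs)"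
    have "(xs ! i, ys ! i) \<in> set (zip xs ys)" using i assms(2) by (auto simp: set_zip)
    then have "map_of (zip xs ys) (xs ! i) = Some (ys ! i)"
      by (intro map_of_is_SomeI) (use assms in simp_all)
    then show "map (\<lambda>x. the (map_of (zip xs ys) x)) xs ! i = ys ! i" using i by simp
  qed (use assms in simp)
qed

lemma cu_stt:
  assumes c: "cact r V L" and P: "\<And>u a b. (u, a, b) \<in> set L \<Longrightarrow> P {u, a, b} = {a, b}" and gs: "length gs = length L"
  obtains \<phi> where "cu gs L = stt (trs L) \<phi> P" "image_mset \<phi> (mset_set (trs L)) = mset gs"
proof -
  define ts where "ts = map (\<lambda>(u, a, b). {u, a, b}) L"
  have set: "set ts = trs L" by (simp add: ts_def trs_def)
  have "card (set ts) = length ts" using cact_facts(6)[OF c] set by (simp add: ts_def)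
  then have dist: "distinct ts" by (rule card_distinct)
  obtain \<phi> where \<phi>: "map \<phi> ts = gs" using distinct_map_eq[OF dist, of gs] gs by (auto simp: ts_def)
  have "map (\<lambda>(u, a, b). {a, b}) L = map P ts" using P by (auto simp: ts_def)
  then have "cu gs L = set (zip (map \<phi> ts) (map P ts))" by (simp add: cu_def \<phi>)
  also have "\<dots> = stt (trs L) \<phi> P" unfolding stt_def set[symmetric] by (induction ts) auto
  finally have "cu gs L = stt (trs L) \<phi> P" .
  moreover have "image_mset \<phi> (mset_set (trs L)) = mset gs"
    unfolding set[symmetric] mset_set_set[OF dist] \<phi>[symmetric] by simp
  ultimately show ?thesis using that by blast
qed

lemma swap_any:
  assumes c: "cact r V L" and TW: "TW (trs L) W" and f: "fit V (trs L) r P" and T: "T \<in> trs L" "T' \<in> trs L"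
  shows "opn V (trs L) (2 * length L + 2 * W) P P (swap T T')"
proof -
  have PT: "T \<subseteq> V" "P T \<subseteq> T" "card (P T) = 2" using f T(1) unfolding fit_def by blast+
  then have "P T \<noteq> {}" by (intro notI) simp
  then obtain v where v: "v \<in> T" "v \<in> V" using PT by blast
  obtain P1 where P1: "fit V (trs L) v P1" "opn V (trs L) (length L) P P1 id"
    using cact_travel[OF c v(2) subset_refl f] .
  have ret: "opn V (trs L) (length L) P1 P id" using opn_inv[OF P1(2) f] by simp
  obtain d where d: "d \<le> W" "pth (trs L) T T' d" using TW T unfolding TW_def by blast
  have "opn V (trs L) (2 * d) P1 P1 (swap T T')" using pth_swap[OF d(2) subset_refl P1(1) v(1)] .
  then have "opn V (trs L) (2 * W) P1 P1 (swap T T')" using opn_mono d(1) mult_le_mono2 by blast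
  then have "opn V (trs L) (length L + 2 * W + length L) P P (id \<circ> swap T T' \<circ> id)"
    by (rule opn_comp[OF opn_comp[OF P1(2) _ P1(1)] ret P1(1)])
  moreover have "length L + 2 * W + length L = 2 * length L + 2 * W" by simp
  ultimately show ?thesis by (metis comp_id id_comp)
qed

text \<open>One transposition for each moved position: it puts the right gourd into
  \<open>T\<close>, and the rest is a permutation of the smaller set.\<close>

lemma opn_permutes:
  assumes sw: "\<And>T T'. T \<in> \<S> \<Longrightarrow> T' \<in> \<S> \<Longrightarrow> opn V \<T> c P P (swap T T')" and f: "fit V \<T> e P"
    and fin: "finite \<S>" and p: "p permutes \<S>"
  shows "opn V \<T> (card \<S> * c) P P p"
  using fin sw p
proof (induction \<S> arbitrary: p rule: finite_induct)
  case empty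
  then have "p = id" by (simp only: permutes_empty)
  then show ?case using opn_refl by metis
next
  case (insert T \<S>)
  define q where "q = swap T (p T) \<circ> p"
  have q: "q permutes \<S>" unfolding q_def by (rule permutes_insert_lemma[OF insert.prems(2)])
  have "p T \<in> insert T \<S>" using permutes_in_image[OF insert.prems(2)] by simp
  then have "opn V \<T> c P P (swap T (p T))" using insert.prems(1) by blast
  moreover have "opn V \<T> (card \<S> * c) P P q" using insert.IH insert.prems(1) q by blast
  ultimately have "opn V \<T> (c + card \<S> * c) P P (swap T (p T) \<circ> q)" using opn_comp f by blast
  moreover have "swap T (p T) \<circ> q = p" by (simp add: q_def comp_assoc[symmetric])
  ultimately show ?case using insert.hyps by simp
qed

lemma sort:
  assumes c: "cact r V L" and TW: "TW (trs L) W" and gs: "length gs = length L" "mset gs = mset hs"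
  shows "ureach V (length L * (2 * length L + 2 * W)) (cu gs L) (cu hs L)"
proof -
  obtain P where P: "fit V (trs L) r P" "\<And>u a b. (u, a, b) \<in> set L \<Longrightarrow> P {u, a, b} = {a, b}"
    using cact_fit[OF c] by metis
  have hs: "length hs = length L" using gs by (metis mset_eq_length)
  obtain \<phi> where \<phi>: "cu gs L = stt (trs L) \<phi> P" "image_mset \<phi> (mset_set (trs L)) = mset gs"
    using cu_stt[OF c P(2) gs(1)] .
  obtain \<psi> where \<psi>: "cu hs L = stt (trs L) \<psi> P" "image_mset \<psi> (mset_set (trs L)) = mset hs"
    using cu_stt[OF c P(2) hs] .
  obtain p where p: "p permutes trs L" "\<forall>t\<in>trs L. \<psi> t = \<phi> (p t)"
    using image_mset_eq_implies_permutes[of "trs L" \<psi> \<phi>] \<phi>(2) \<psi>(2) gs(2) by auto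
  have "opn V (trs L) (card (trs L) * (2 * length L + 2 * W)) P P p"
    using opn_permutes[OF swap_any[OF c TW P(1)] P(1) _ p(1)] by simp
  then have "ureach V (length L * (2 * length L + 2 * W)) (stt (trs L) \<phi> P) (stt (trs L) (\<phi> \<circ> p) P)"
    using opn_relabel[OF _ P(1)] cact_facts(6)[OF c] by metis
  moreover have "stt (trs L) (\<phi> \<circ> p) P = stt (trs L) \<psi> P"
    unfolding stt_def by (rule image_cong) (use p(2) in auto)
  ultimately show ?thesis by (simp add: \<phi>(1) \<psi>(1))
qed

section \<open>Matchings and the parking of the gourds\<close>

definition pm :: "cell set \<Rightarrow> cell \<Rightarrow> cell set set \<Rightarrow> bool" where
  "pm V f K \<longleftrightarrow> finite K \<and> f \<in> V \<and> \<Union>K = V - {f} \<and> (\<forall>k\<in>K. \<exists>p q. k = {p, q} \<and> adjacent p q) \<and> disjoint K"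

lemma pm_insert:
  assumes "pm V f K" "a \<notin> V" "b \<notin> V" "adjacent a b"
  shows "pm (insert a (insert b V)) f (insert {a, b} K)"
proof -
  have "k \<inter> {a, b} = {}" if "k \<in> K" for k using assms that unfolding pm_def by blast
  then have "disjoint (insert {a, b} K)" using assms(1) unfolding pm_def disjoint_def by (auto simp: Int_commute)
  moreover have "\<Union>(insert {a, b} K) = insert a (insert b V) - {f}" using assms unfolding pm_def by auto
  ultimately show ?thesis using assms(1,4) unfolding pm_def by blast
qed

lemma pm_replace:
  assumes "pm V u K" "a \<notin> V" "b \<notin> V" "a \<noteq> b" "adjacent u a"
  shows "pm (insert a (insert b V)) b (insert {a, u} K)"
proof -
  have u: "u \<in> V" using assms by (simp add: pm_def)
  have "k \<inter> {a, u} = {}" if "k \<in> K" for k using assms that unfolding pm_def by blast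
  then have "disjoint (insert {a, u} K)" using assms(1) unfolding pm_def disjoint_def by (auto simp: Int_commute)
  moreover have "adjacent a u" using assms(5) adj_sym by blast
  moreover have "\<Union>(insert {a, u} K) = insert a (insert b V) - {b}"
    using assms u unfolding pm_def by auto
  ultimately show ?thesis using assms(1) unfolding pm_def by blast
qed

lemma lat_adj: "{u, a, b} \<in> lat \<Longrightarrow> a \<noteq> b \<Longrightarrow> u \<noteq> a \<Longrightarrow> u \<noteq> b \<Longrightarrow> adjacent u a \<and> adjacent u b \<and> adjacent a b"
  using lat_edge(1)[of "{u, a, b}"] by blast

text \<open>A cactus of triangles is factor-critical. If the free cell is old, the two new cells are
  matched with each other; if it is new, the other new cell is matched with \<open>u\<close>, and
  the older part leaves \<open>u\<close> free.\<close>

lemma cact_pm: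
  assumes "cact r V L" "f \<in> V" obtains K where "pm V f K" "card K \<le> length L"
proof -
  have "\<exists>K. pm V f K \<and> card K \<le> length L"
    using assms
  proof (induction arbitrary: f rule: cact.induct)
    case root
    then show ?case by (intro exI[of _ "{}"]) (simp add: pm_def)
  next
    case (grow V L u a b)
    have adj: "adjacent u a \<and> adjacent u b \<and> adjacent a b"
      by (rule lat_adj[OF grow.hyps(6,5)]) (use grow.hyps in auto)
    show ?case
    proof (cases "f \<in> V")
      case True
      then obtain K where K: "pm V f K" "card K \<le> length L" using grow.IH by blast
      then have "finite K" by (simp add: pm_def)
      then show ?thesis using pm_insert[OF K(1) grow.hyps(3,4)] adj K(2)
        by (intro exI[of _ "insert {a, b} K"]) (auto simp: card_insert_if)
    next
      case False
      obtain K where K: "pm V u K" "card K \<le> length L" using grow.IH grow.hyps(2) by blast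
      then have fin: "finite K" by (simp add: pm_def)
      from False grow.prems consider "f = b" | "f = a" by auto
      then show ?thesis
      proof cases
        case 1
        then show ?thesis using pm_replace[OF K(1) grow.hyps(3,4,5)] adj K(2) fin
          by (intro exI[of _ "insert {a, u} K"]) (auto simp: card_insert_if)
      next
        case 2
        then show ?thesis using pm_replace[OF K(1) grow.hyps(4,3)] grow.hyps(5) adj K(2) fin
          by (intro exI[of _ "insert {b, u} K"]) (auto simp: card_insert_if insert_commute)
      qed
    qed
  qed
  then show ?thesis using that by blast
qed

lemma doubleton_at: "S = {p, q} \<Longrightarrow> a \<in> S \<Longrightarrow> \<exists>y. S = {y, a}"
  by blast

lemma edge_at:
  assumes "S = {p, q}" "adjacent p q" "e \<in> S" shows "\<exists>v. S = {v, e} \<and> adjacent v e"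
proof (cases "e = q")
  case True
  then show ?thesis using assms by blast
next
  case False
  then have "S = {q, e}" "adjacent q e" using assms adj_sym[of p q] by (simp_all add: insert_commute)
  then show ?thesis by blast
qed

definition ust :: "cell set \<Rightarrow> cell \<Rightarrow> 'g ustate \<Rightarrow> bool" where
  "ust V e U \<longleftrightarrow> finite U \<and> e \<in> V \<and> (\<Union>x\<in>U. snd x) = V - {e} \<and> disj U \<and>
     (\<forall>x\<in>U. \<exists>p q. snd x = {p, q} \<and> adjacent p q)"

lemma ustD:
  assumes "ust V e U"
  shows "finite U" "e \<in> V" "(\<Union>x\<in>U. snd x) = V - {e}" "disj U"
    "\<And>x. x \<in> U \<Longrightarrow> \<exists>p q. snd x = {p, q} \<and> adjacent p q"
proof -
  show "finite U" "e \<in> V" "(\<Union>x\<in>U. snd x) = V - {e}" "disj U" using assms by (simp_all add: ust_def)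
  have "\<forall>x\<in>U. \<exists>p q. snd x = {p, q} \<and> adjacent p q"
    using assms unfolding ust_def by (elim conjE)
  then show "\<exists>p q. snd x = {p, q} \<and> adjacent p q" if "x \<in> U" for x using that by (rule bspec)
qed

lemma ust_hop:
  assumes U: "ust V e U" and g: "(g, {p, q}) \<in> U" and qe: "adjacent q e"
  defines "U' \<equiv> insert (g, {q, e}) (U - {(g, {p, q})})"
  shows "uhop V U U' \<and> ust V p U'"
proof
  have dj: "snd x \<inter> snd y = {}" if "x \<in> U" "y \<in> U" "x \<noteq> y" for x y
    using ustD(4)[OF U] that unfolding disj_def by blast
  obtain p' q' where "{p, q} = {p', q'}" "adjacent p' q'" using ustD(5)[OF U g] unfolding snd_conv by blast
  then have pq: "adjacent p q" using adj_sym[of p' q'] unfolding doubleton_eq_iff by blast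
  have cov: "(\<Union>x\<in>U. snd x) = V - {e}" using U by (simp add: ust_def)
  have sub: "{p, q} \<subseteq> V - {e}" using cov g by force
  have e: "e \<notin> snd x" if "x \<in> U" for x using cov that by blast
  have oth: "snd x \<inter> {p, q} = {}" if "x \<in> U" "x \<noteq> (g, {p, q})" for x
    using dj[OF that(1) g that(2)] by simp
  show hop: "uhop V U U'"
  proof (rule uhopI[where g = g and p = p and q = q and e = e])
    show "{p, q, e} \<subseteq> V" using sub U by (auto simp: ust_def)
    show "U' = insert (g, {q, e}) (U - {(g, {p, q})})" by (simp add: U'_def)
  qed (use g pq qe e in auto)
  have ne: "p \<noteq> q" using pq adjacent_neq by blast
  have "(\<Union>x\<in>U'. snd x) = V - {p}"
  proof -
    have "(\<Union>x\<in>U. snd x) = {p, q} \<union> (\<Union>x\<in>U - {(g, {p, q})}. snd x)" using g by force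
    moreover have "(\<Union>x\<in>U - {(g, {p, q})}. snd x) \<inter> {p, q} = {}" using oth by blast
    moreover have "e \<in> V" using U by (simp add: ust_def)
    ultimately show ?thesis using cov sub ne by (auto simp: U'_def)
  qed
  moreover have "disj U'" using uhop_disj[OF hop] U by (simp add: ust_def)
  moreover have "\<forall>x\<in>U'. \<exists>p q. snd x = {p, q} \<and> adjacent p q"
  proof
    fix x assume "x \<in> U'"
    then have "x = (g, {q, e}) \<or> x \<in> U" by (auto simp: U'_def)
    then show "\<exists>p q. snd x = {p, q} \<and> adjacent p q"
    proof
      assume "x = (g, {q, e})"
      then have "snd x = {q, e}" by simp
      then show ?thesis using qe by blast
    next
      assume "x \<in> U"
      then show ?thesis using ustD(5)[OF U] by blast
    qed
  qed
  ultimately show "ust V p U'" using U sub unfolding ust_def U'_def by auto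
qed

lemma diff_psubset: "A - {s} \<subseteq> B \<Longrightarrow> s \<notin> K \<Longrightarrow> k \<in> B \<Longrightarrow> k \<notin> A \<Longrightarrow> k \<in> K \<Longrightarrow> K - B \<subset> K - A"
  by blast

text \<open>The hole walks along the alternating path of the current matching and \<open>K\<close>:
  the gourd on the \<open>K\<close>-partner of the hole hops onto that edge of \<open>K\<close>.
  Each hop occupies one more edge of \<open>K\<close> and vacates none, so gourds already on edges
  of \<open>K\<close> never move and \<open>card K\<close> hops suffice.\<close>

lemma empty_to:
  assumes "ust V e U" "pm V f K"
  shows "\<exists>U'. ureach V (card K) U U' \<and> ust V f U' \<and> (\<forall>x\<in>U. snd x \<in> K \<longrightarrow> x \<in> U')"
proof -
  have K: "finite K" "f \<in> V" "\<Union>K = V - {f}" "\<And>k. k \<in> K \<Longrightarrow> \<exists>p q. k = {p, q} \<and> adjacent p q" "disjoint K"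
    using assms(2) by (auto simp: pm_def)
  have "\<exists>U'. ureach V (card (K - snd ` U)) U U' \<and> ust V f U' \<and> (\<forall>x\<in>U. snd x \<in> K \<longrightarrow> x \<in> U')"
    using assms(1)
  proof (induction "card (K - snd ` U)" arbitrary: U e rule: less_induct)
    case less
    show ?case
    proof (cases "e = f")
      case True
      then show ?thesis using less.prems by (intro exI[of _ U]) auto
    next
      case False
      have cov: "(\<Union>x\<in>U. snd x) = V - {e}" and eV: "e \<in> V" using less.prems by (auto simp: ust_def)
      obtain k where k: "k \<in> K" "e \<in> k" using False eV K(3) by blast
      obtain p q where "k = {p, q}" "adjacent p q" using K(4) k(1) by blast
      then obtain v where v: "k = {v, e}" "adjacent v e" using edge_at k(2) by blast
      have "v \<in> V - {e}" using v adjacent_neq[of v e] k(1) K(3) by auto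
      then obtain x where x: "x \<in> U" "v \<in> snd x" using cov by blast
      obtain p' q' where "snd x = {p', q'}" using ustD(5)[OF less.prems x(1)] by blast
      then obtain y where y: "snd x = {y, v}" using doubleton_at x(2) by metis
      define g where "g = fst x"
      have gx: "(g, {y, v}) = x" using y by (simp add: g_def prod_eq_iff)
      define U1 where "U1 = insert (g, {v, e}) (U - {(g, {y, v})})"
      have h: "uhop V U U1" "ust V y U1"
        using ust_hop[OF less.prems, of g y v] v(2) x(1) gx by (auto simp: U1_def)
      have en: "e \<notin> snd z" if "z \<in> U" for z using cov that by blast
      have kU: "k \<notin> snd ` U" using en k(2) by blast
      \<comment> \<open>\<open>k\<close> is the only edge of \<open>K\<close> at \<open>v\<close>,
        so the position given up is not an edge of \<open>K\<close>.\<close>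
      have yv: "{y, v} \<notin> K"
      proof
        assume "{y, v} \<in> K"
        moreover have "{y, v} \<noteq> k" using en[OF x(1)] y k(2) by auto
        ultimately have "{y, v} \<inter> k = {}" by (intro disjointD[OF K(5) _ k(1)])
        then show False unfolding v(1) by simp
      qed
      have img: "snd ` U - {{y, v}} \<subseteq> snd ` U1"
      proof
        fix S assume "S \<in> snd ` U - {{y, v}}"
        then obtain z where z: "z \<in> U" "S = snd z" "S \<noteq> {y, v}" by blast
        then have "z \<noteq> (g, {y, v})" by (intro notI) simp
        then have "z \<in> U1" using z(1) unfolding U1_def by blast
        then show "S \<in> snd ` U1" using z(2) by blast
      qed
      have "(g, {v, e}) \<in> U1" unfolding U1_def by (rule insertI1)
      then have "snd (g, {v, e}) \<in> snd ` U1" by (rule imageI)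
      then have kU1: "k \<in> snd ` U1" unfolding v(1) snd_conv .
      have lt: "card (K - snd ` U1) < card (K - snd ` U)"
      proof (rule psubset_card_mono)
        show "finite (K - snd ` U)" using K(1) by simp
        show "K - snd ` U1 \<subset> K - snd ` U" by (rule diff_psubset[OF img yv kU1 kU k(1)])
      qed
      obtain U' where U': "ureach V (card (K - snd ` U1)) U1 U'" "ust V f U'" "\<forall>x\<in>U1. snd x \<in> K \<longrightarrow> x \<in> U'"
        using less.hyps[OF lt h(2)] by blast
      have "ureach V (1 + card (K - snd ` U1)) U U'" by (rule ureach_trans[OF ureach_hop[OF h(1)] U'(1)])
      then have "ureach V (card (K - snd ` U)) U U'" by (rule ureach_mono) (use lt in simp)
      moreover have "x \<in> U'" if xU: "x \<in> U" "snd x \<in> K" for x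
      proof -
        have "x \<noteq> (g, {y, v})" using xU(2) yv by (intro notI) simp
        then have "x \<in> U1" using xU(1) unfolding U1_def by blast
        then show ?thesis using U'(3) xU(2) by blast
      qed
      ultimately show ?thesis using U'(2) by blast
    qed
  qed
  moreover have "card (K - snd ` U) \<le> card K" using K(1) by (simp add: card_mono)
  ultimately show ?thesis using ureach_mono by blast
qed

text \<open>Allows a gourd parked outside \<open>V\<close> to be frozen while the recursion
  continues inside \<open>V\<close>.\<close>

lemma uhop_frame:
  assumes "uhop V U U'" "V \<subseteq> V'" "\<Union>(snd ` U) \<subseteq> V" "snd x \<inter> V = {}" "snd x \<noteq> {}"
  shows "uhop V' (insert x U) (insert x U') \<and> \<Union>(snd ` U') \<subseteq> V"
proof -
  obtain g p q e where h: "(g, {p, q}) \<in> U" "p \<in> V" "q \<in> V" "e \<in> V" "adjacent p q" "adjacent q e"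
     "\<forall>x\<in>U. e \<notin> snd x" "U' = insert (g, {q, e}) (U - {(g, {p, q})})"
    using assms(1) unfolding uhop_def by blast
  have xn: "x \<noteq> (g, {p, q})" using assms(4) h(2) by auto
  have "uhop V' (insert x U) (insert x U')"
    by (rule uhopI[where g = g and p = p and q = q and e = e]) (use h xn assms in auto)
  moreover have "\<Union>(snd ` U') \<subseteq> V" using h(2-4,8) assms(3) by auto
  ultimately show ?thesis by blast
qed

lemma ureach_frame:
  assumes "ureach V k U U'" "V \<subseteq> V'" "\<Union>(snd ` U) \<subseteq> V" "snd x \<inter> V = {}" "snd x \<noteq> {}"
  shows "ureach V' k (insert x U) (insert x U')"
proof -
  have "(uhop V ^^ j) U U' \<Longrightarrow> (uhop V' ^^ j) (insert x U) (insert x U') \<and> \<Union>(snd ` U') \<subseteq> V" for j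
  proof (induction j arbitrary: U')
    case (Suc j)
    obtain U1 where U1: "(uhop V ^^ j) U U1" "uhop V U1 U'" using Suc.prems by (meson relpowp_Suc_E)
    have a: "(uhop V' ^^ j) (insert x U) (insert x U1)" and s: "\<Union>(snd ` U1) \<subseteq> V" using Suc.IH[OF U1(1)] by auto
    have "uhop V' (insert x U1) (insert x U') \<and> \<Union>(snd ` U') \<subseteq> V"
      by (rule uhop_frame[OF U1(2) assms(2) s assms(4,5)])
    then show ?case using relpowp_Suc_I[OF a] by blast
  qed (use assms(3) in simp)
  then show ?thesis using assms(1) by (auto simp: ureach_def)
qed

lemma remaining_cover:
  assumes "{a, b} \<union> X = insert a (insert b V) - {u}" "X \<inter> {a, b} = {}" "a \<notin> V" "b \<notin> V"
  shows "X = V - {u}"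
proof -
  have "X = ({a, b} \<union> X) - {a, b}" using assms(2) by auto
  also have "\<dots> = insert a (insert b V) - {u} - {a, b}" by (simp only: assms(1))
  also have "\<dots> = V - {u}" using assms(3,4) by auto
  finally show ?thesis .
qed

lemma ust_remove:
  assumes U: "ust (insert a (insert b V)) u U" and g: "(g, {a, b}) \<in> U" and n: "a \<notin> V" "b \<notin> V" "u \<in> V"
  shows "ust V u (U - {(g, {a, b})})"
proof -
  have oth: "snd x \<inter> {a, b} = {}" if "x \<in> U" "x \<noteq> (g, {a, b})" for x
  proof -
    have "snd x \<inter> snd (g, {a, b}) = {}" using ustD(4)[OF U] g that unfolding disj_def by blast
    then show ?thesis by simp
  qed
  note cov = ustD(3)[OF U]
  have "U = insert (g, {a, b}) (U - {(g, {a, b})})" using insert_Diff[OF g] by (rule sym)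
  then have "(\<Union>x\<in>U. snd x) = (\<Union>x\<in>insert (g, {a, b}) (U - {(g, {a, b})}). snd x)" by (rule arg_cong)
  also have "\<dots> = {a, b} \<union> (\<Union>x\<in>U - {(g, {a, b})}. snd x)" by (simp only: UN_insert snd_conv)
  finally have split: "(\<Union>x\<in>U. snd x) = {a, b} \<union> (\<Union>x\<in>U - {(g, {a, b})}. snd x)" .
  have "(\<Union>x\<in>U - {(g, {a, b})}. snd x) \<inter> {a, b} = {}" using oth by blast
  then have "(\<Union>x\<in>U - {(g, {a, b})}. snd x) = V - {u}"
    by (rule remaining_cover[OF split[symmetric, unfolded cov] _ n(1,2)])
  then show ?thesis using U n(3) unfolding ust_def disj_def by simp
qed

text \<open>Leaf triangles are settled from the last to the first. Settling one costs at most
  \<open>2 * n + 4\<close> hops for \<open>n\<close> remaining triangles, which sums to at most four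
  times the square.\<close>

lemma gather:
  assumes "cact r V L" "ust V e U"
  shows "\<exists>gs. length gs = length L \<and> ureach V (4 * length L ^ 2) U (cu gs L)"
  using assms
proof (induction arbitrary: e U rule: cact.induct)
  case root
  note c = ustD(3)[OF root] and e = ustD(2)[OF root] and d = ustD(4)[OF root]
  have cov: "(\<Union>x\<in>U. snd x) = {}" using c e by simp
  have "U = {}"
  proof (rule ccontr)
    assume "U \<noteq> {}"
    then obtain x where "x \<in> U" by blast
    then have "snd x \<subseteq> {}" unfolding cov[symmetric] by (rule UN_upper)
    moreover have "snd x \<noteq> {}" using d \<open>x \<in> U\<close> unfolding disj_def by simp
    ultimately show False by simp
  qed
  then show ?case by (simp add: cu_def)
next
  case (grow V L u a b)
  let ?V = "insert a (insert b V)" and ?n = "length L"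
  have adj: "adjacent u a \<and> adjacent u b \<and> adjacent a b"
    by (rule lat_adj[OF grow.hyps(6,5)]) (use grow.hyps in auto)
  have ua: "adjacent a u" using adj adj_sym by blast
  obtain K where K: "pm V u K" "card K \<le> ?n" using cact_pm[OF grow.hyps(1,2)] .
  have fin: "finite K" using K by (simp add: pm_def)
  have K1: "pm ?V u (insert {a, b} K)" using pm_insert[OF K(1) grow.hyps(3,4)] adj by blast
  have K2: "pm ?V b (insert {a, u} K)" using pm_replace[OF K(1) grow.hyps(3,4,5)] adj by blast
  have kc: "card (insert k K) \<le> Suc ?n" for k using K(2) fin by (simp add: card_insert_if)
  have reach: "\<exists>U' g. ureach ?V (2 * ?n + 4) U U' \<and> ust ?V u U' \<and> (g, {a, b}) \<in> U'"
  proof -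
    obtain U1 where U1: "ureach ?V (card (insert {a, b} K)) U U1" "ust ?V u U1"
      using empty_to[OF grow.prems K1] by blast
    have r1: "ureach ?V (Suc ?n) U U1" using ureach_mono[OF U1(1) kc] .
    have an: "a \<in> ?V - {u}" using grow.hyps by auto
    note cov = ustD(3)[OF U1(2)]
    obtain x where x: "x \<in> U1" "a \<in> snd x" using an unfolding cov[symmetric] by (rule UN_E)
    obtain p' q' where "snd x = {p', q'}" using ustD(5)[OF U1(2) x(1)] by blast
    then obtain y where y: "snd x = {y, a}" using doubleton_at x(2) by metis
    define g where "g = fst x"
    have gx: "(g, {y, a}) \<in> U1" using y x(1) by (metis g_def prod.collapse)
    show ?thesis
    proof (cases "y = b")
      case True
      then have "(g, {a, b}) \<in> U1" using gx by (simp add: insert_commute)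
      then show ?thesis using U1(2) ureach_mono[OF r1, of "2 * ?n + 4"] by auto
    next
      \<comment> \<open>The gourd on \<open>a\<close> does not lie on \<open>{a, b}\<close>. It is
        pulled onto \<open>{a, u}\<close>; the hole is then led to \<open>b\<close> along a matching
        containing \<open>{a, u}\<close>, so that this gourd stays put; finally it hops onto
        \<open>{a, b}\<close> and frees \<open>u\<close>.\<close>
      case False
      define U2 where "U2 = insert (g, {a, u}) (U1 - {(g, {y, a})})"
      have U2: "uhop ?V U1 U2" "ust ?V y U2" using ust_hop[OF U1(2) gx ua] by (auto simp: U2_def)
      obtain U3 where U3: "ureach ?V (card (insert {a, u} K)) U2 U3" "ust ?V b U3" "\<forall>x\<in>U2. snd x \<in> insert {a, u} K \<longrightarrow> x \<in> U3"
        using empty_to[OF U2(2) K2] by blast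
      have r3: "ureach ?V (Suc ?n) U2 U3" using ureach_mono[OF U3(1) kc] .
      have "(g, {a, u}) \<in> U3" using U3(3) by (simp add: U2_def)
      then have g3: "(g, {u, a}) \<in> U3" by (simp add: insert_commute)
      define U4 where "U4 = insert (g, {a, b}) (U3 - {(g, {u, a})})"
      have U4: "uhop ?V U3 U4" "ust ?V u U4" using ust_hop[OF U3(2) g3] adj by (auto simp: U4_def)
      have "ureach ?V (Suc ?n + 1 + Suc ?n + 1) U U4"
        using ureach_trans[OF ureach_trans[OF ureach_trans[OF r1 ureach_hop[OF U2(1)]] r3] ureach_hop[OF U4(1)]] .
      moreover have "Suc ?n + 1 + Suc ?n + 1 = 2 * ?n + 4" by simp
      moreover have "(g, {a, b}) \<in> U4" by (simp add: U4_def)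
      ultimately show ?thesis using U4(2) by metis
    qed
  qed
  then obtain U' g where U': "ureach ?V (2 * ?n + 4) U U'" "ust ?V u U'" "(g, {a, b}) \<in> U'" by blast
  define U0 where "U0 = U' - {(g, {a, b})}"
  have U0: "ust V u U0" "U' = insert (g, {a, b}) U0"
    using ust_remove[OF U'(2,3) grow.hyps(3,4,2)] U'(3) by (auto simp: U0_def)
  obtain gs where gs: "length gs = ?n" "ureach V (4 * ?n ^ 2) U0 (cu gs L)" using grow.IH U0(1) by blast
  have "ureach ?V (4 * ?n ^ 2) (insert (g, {a, b}) U0) (insert (g, {a, b}) (cu gs L))"
  proof (rule ureach_frame[OF gs(2)])
    show "\<Union>(snd ` U0) \<subseteq> V" unfolding ustD(3)[OF U0(1)] by (rule Diff_subset)
  qed (use grow.hyps in auto)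
  then have fr: "ureach ?V (4 * ?n ^ 2) U' (insert (g, {a, b}) (cu gs L))" unfolding U0(2) .
  have r: "ureach ?V ((2 * ?n + 4) + 4 * ?n ^ 2) U (insert (g, {a, b}) (cu gs L))"
    by (rule ureach_trans[OF U'(1) fr])
  have eq: "insert (g, {a, b}) (cu gs L) = cu (gs @ [g]) (L @ [(u, a, b)])"
    using gs(1) by (simp add: cu_def)
  have le: "(2 * ?n + 4) + 4 * ?n ^ 2 \<le> 4 * length (L @ [(u, a, b)]) ^ 2"
    by (simp add: power2_eq_square)
  have "ureach ?V (4 * length (L @ [(u, a, b)]) ^ 2) U (cu (gs @ [g]) (L @ [(u, a, b)]))"
    unfolding eq[symmetric] by (rule ureach_mono[OF r le])
  then show ?case using gs(1) by (intro exI[of _ "gs @ [g]"]) simp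
qed

section \<open>From unoriented hops to moves of gourds\<close>

definition up :: "'l gourd \<times> cell \<times> cell \<Rightarrow> 'l gourd \<times> cell set" where
  "up x = (fst x, {fst (snd x), snd (snd x)})"

abbreviation upos :: "'l config \<Rightarrow> 'l gourd ustate" where
  "upos C \<equiv> up ` C"

lemma covered_up: "covered C = (\<Union>x\<in>C. snd (up x))"
  unfolding covered_def up_def case_prod_unfold by simp

lemma configuration_up:
  "configuration B G C \<longleftrightarrow> finite C \<and>
     (\<forall>x\<in>C. snd (up x) \<subseteq> B \<and> adjacent (fst (snd x)) (snd (snd x))) \<and>
     (\<forall>x\<in>C. \<forall>y\<in>C. x \<noteq> y \<longrightarrow> snd (up x) \<inter> snd (up y) = {}) \<and> image_mset fst (mset_set C) = G"
  unfolding configuration_def pairwise_def up_def case_prod_unfold snd_conv insert_subset by simp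

lemma configurationD:
  assumes "configuration B G C"
  shows "finite C" "\<And>x. x \<in> C \<Longrightarrow> snd (up x) \<subseteq> B" "\<And>x. x \<in> C \<Longrightarrow> adjacent (fst (snd x)) (snd (snd x))"
    "\<And>x y. x \<in> C \<Longrightarrow> y \<in> C \<Longrightarrow> x \<noteq> y \<Longrightarrow> snd (up x) \<inter> snd (up y) = {}" "image_mset fst (mset_set C) = G"
  using assms unfolding configuration_up by simp_all

lemma up_nonempty: "snd (up x) \<noteq> {}"
  by (simp add: up_def)

lemma up_inj: "configuration B G C \<Longrightarrow> inj_on up C"
proof (rule inj_onI)
  fix x y assume c: "configuration B G C" and xy: "x \<in> C" "y \<in> C" "up x = up y"
  show "x = y"
  proof (rule ccontr)
    assume "x \<noteq> y"
    then have "snd (up x) \<inter> snd (up y) = {}" using configurationD(4)[OF c xy(1,2)] by blast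
    then show False using xy(3) up_nonempty[of y] by simp
  qed
qed

text \<open>Counting: the gourds cover all cells of \<open>V\<close> but one, which is the
  hole.\<close>

lemma config_ust:
  assumes c: "configuration V G C" and card: "card V = 2 * size G + 1"
  obtains e where "ust V e (upos C)"
proof -
  note D = configurationD[OF c]
  have fin: "finite V" using card by (intro card_ge_0_finite) simp
  have G: "size G = card C" using D(5) by (metis size_image_mset size_mset_set)
  have "card (snd (up x)) = 2" if "x \<in> C" for x
    using adjacent_neq[OF D(3)[OF that]] by (simp add: up_def)
  then have "(\<Sum>x\<in>C. card (snd (up x))) = 2 * card C" by simp
  moreover have "card (\<Union>x\<in>C. snd (up x)) = (\<Sum>x\<in>C. card (snd (up x)))"
    by (rule card_UN_disjoint) (use D in \<open>simp_all add: up_def\<close>)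
  ultimately have cc: "card (covered C) = 2 * card C" by (simp only: covered_up)
  have sub: "covered C \<subseteq> V" unfolding covered_up using D(2) by (rule UN_least)
  have "card (V - covered C) = 1"
    using card_Diff_subset[OF finite_subset[OF sub fin] sub] cc card G by simp
  then obtain e where e: "V - covered C = {e}" by (rule card_1_singletonE)
  have cov: "(\<Union>x\<in>upos C. snd x) = covered C" unfolding covered_up by simp
  have "ust V e (upos C)"
    unfolding ust_def
  proof (intro conjI)
    show "finite (upos C)" using D(1) by simp
    show "e \<in> V" using e by blast
    show "(\<Union>x\<in>upos C. snd x) = V - {e}" unfolding cov using e sub by blast
    show "disj (upos C)"
      unfolding disj_def
    proof (intro conjI ballI impI)
      fix x assume "x \<in> upos C"
      then show "snd x \<noteq> {}" using up_nonempty by (metis imageE)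
    next
      fix x y assume "x \<in> upos C" "y \<in> upos C" and ne: "x \<noteq> y"
      then obtain x0 y0 where "x0 \<in> C" "x = up x0" "y0 \<in> C" "y = up y0" by (metis imageE)
      then show "snd x \<inter> snd y = {}" using D(4)[of x0 y0] ne by metis
    qed
    show "\<forall>x\<in>upos C. \<exists>p q. snd x = {p, q} \<and> adjacent p q"
    proof
      fix x assume "x \<in> upos C"
      then obtain y where y: "x = up y" "y \<in> C" by (rule imageE)
      have "snd x = {fst (snd y), snd (snd y)}" by (simp add: y up_def)
      then show "\<exists>p q. snd x = {p, q} \<and> adjacent p q" using D(3)[OF y(2)] by blast
    qed
  qed
  then show ?thesis using that by blast
qed

text \<open>The angle at \<open>q\<close> is 180, 120 or 60 degrees, which permits a slide, a turn
  or a pivot respectively. Every unoriented hop is therefore available as a move.\<close>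

lemma turn_cases:
  assumes "adjacent p q" "adjacent q e" "e \<noteq> p"
  shows "straight p q e \<or> angle120 p q e \<or> adjacent e p"
proof -
  obtain a b where q: "q = (a, b)" by fastforce
  have "adjacent q p" using assms(1) adj_sym by blast
  then have "p \<in> {(a + 1, b), (a, b + 1), (a - 1, b + 1), (a - 1, b), (a, b - 1), (a + 1, b - 1)}"
    by (simp only: q adjacent_cases)
  moreover have "e \<in> {(a + 1, b), (a, b + 1), (a - 1, b + 1), (a - 1, b), (a, b - 1), (a + 1, b - 1)}"
    using assms(2) by (simp only: q adjacent_cases)
  ultimately show ?thesis
    using assms(3) unfolding straight_def angle120_def rot60_def q
    by (elim insertE emptyE) (simp_all add: adjacent_coords)
qed

lemma straight_sym: "straight p q e \<Longrightarrow> straight e q p"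
  unfolding straight_def using adj_sym by (metis minus_diff_eq)

lemma angle120_sym: "angle120 p q e \<Longrightarrow> angle120 e q p"
  unfolding angle120_def using adj_sym by blast

lemma gourd_move_exists:
  assumes "adjacent p q" "adjacent q e" "e \<noteq> p" "x = (p, q) \<or> x = (q, p)"
  shows "\<exists>y. gourd_move e x y \<and> {fst y, snd y} = {q, e}"
proof -
  have eq: "adjacent e q" using assms(2) adj_sym by blast
  from assms(4) show ?thesis
  proof
    assume x: "x = (p, q)"
    consider "straight p q e" | "angle120 p q e" | "adjacent e p" using turn_cases[OF assms(1-3)] by blast
    then show ?thesis
    proof cases
      case 1 show ?thesis unfolding x by (rule exI[of _ "(q, e)"]) (simp add: slide_second[OF 1])
    next
      case 2 show ?thesis unfolding x by (rule exI[of _ "(q, e)"]) (simp add: turn_second[OF 2])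
    next
      case 3 show ?thesis unfolding x by (rule exI[of _ "(e, q)"]) (simp add: pivot_first[OF 3 eq] insert_commute)
    qed
  next
    assume x: "x = (q, p)"
    consider "straight p q e" | "angle120 p q e" | "adjacent e p" using turn_cases[OF assms(1-3)] by blast
    then show ?thesis
    proof cases
      case 1 show ?thesis unfolding x by (rule exI[of _ "(e, q)"]) (simp add: slide_first[OF 1] insert_commute)
    next
      case 2 show ?thesis unfolding x by (rule exI[of _ "(e, q)"]) (simp add: turn_first[OF 2] insert_commute)
    next
      case 3 show ?thesis unfolding x by (rule exI[of _ "(q, e)"]) (simp add: pivot_second[OF eq 3])
    qed
  qed
qed

text \<open>Slides and turns are undone with the other end leading, pivots by moving the same end
  back into the vacated cell.\<close>

lemma gourd_move_rev:
  assumes "gourd_move e x y" "adjacent (fst x) (snd x)"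
  shows "\<exists>v w. {fst x, snd x} = {v, w} \<and> {fst y, snd y} = {w, e} \<and> v \<noteq> w \<and>
    adjacent (fst y) (snd y) \<and> gourd_move v y x"
  using assms
proof cases
  case (slide_second p q)
  have a: "adjacent q e" using slide_second(3) by (simp add: straight_def)
  have "gourd_move p (q, e) (p, q)" by (rule gourd_move.slide_first[OF straight_sym[OF slide_second(3)]])
  then show ?thesis using assms(2) adjacent_neq[of p q] a unfolding slide_second(1,2)
    by (intro exI[of _ p] exI[of _ q]) simp
next
  case (slide_first q p)
  have a: "adjacent e p" using slide_first(3) adj_sym by (simp add: straight_def)
  have "gourd_move q (e, p) (p, q)" by (rule gourd_move.slide_second[OF straight_sym[OF slide_first(3)]])
  then show ?thesis using assms(2) adjacent_neq[of p q] a unfolding slide_first(1,2)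
    by (intro exI[of _ q] exI[of _ p]) (simp add: insert_commute)
next
  case (turn_second p q)
  have a: "adjacent q e" using turn_second(3) by (simp add: angle120_def)
  have "gourd_move p (q, e) (p, q)" by (rule gourd_move.turn_first[OF angle120_sym[OF turn_second(3)]])
  then show ?thesis using assms(2) adjacent_neq[of p q] a unfolding turn_second(1,2)
    by (intro exI[of _ p] exI[of _ q]) simp
next
  case (turn_first q p)
  have a: "adjacent e p" using turn_first(3) adj_sym by (simp add: angle120_def)
  have "gourd_move q (e, p) (p, q)" by (rule gourd_move.turn_second[OF angle120_sym[OF turn_first(3)]])
  then show ?thesis using assms(2) adjacent_neq[of p q] a unfolding turn_first(1,2)
    by (intro exI[of _ q] exI[of _ p]) (simp add: insert_commute)
next
  case (pivot_second p q)
  have pq: "adjacent p q" using assms(2) pivot_second(1) by simp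
  have "gourd_move q (p, e) (p, q)"
    by (rule gourd_move.pivot_second[OF adj_sym[OF pq] adj_sym[OF pivot_second(4)]])
  then show ?thesis using adjacent_neq[OF pq] adj_sym[OF pivot_second(3)] unfolding pivot_second(1,2)
    by (intro exI[of _ q] exI[of _ p]) (simp add: insert_commute)
next
  case (pivot_first p q)
  have pq: "adjacent p q" using assms(2) pivot_first(1) by simp
  have "gourd_move p (e, q) (p, q)"
    by (rule gourd_move.pivot_first[OF adj_sym[OF pivot_first(3)] pq])
  then show ?thesis using adjacent_neq[OF pq] pivot_first(4) unfolding pivot_first(1,2)
    by (intro exI[of _ p] exI[of _ q]) (simp add: insert_commute)
qed

lemma moveE:
  assumes "move B C C'"
  obtains g x y e where "e \<in> B" "e \<notin> covered C" "(g, x) \<in> C" "gourd_move e x y" "C' = insert (g, y) (C - {(g, x)})"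
  using assms unfolding move_def by blast

lemma moveI:
  "e \<in> B \<Longrightarrow> e \<notin> covered C \<Longrightarrow> (g, x) \<in> C \<Longrightarrow> gourd_move e x y \<Longrightarrow> C' = insert (g, y) (C - {(g, x)}) \<Longrightarrow> move B C C'"
  unfolding move_def by blast

lemma up_Pair: "up (g, x) = (g, {fst x, snd x})"
  by (simp add: up_def)

lemma move_configuration:
  assumes c: "configuration V G C" and m: "move V C C'"
  shows "configuration V G C' \<and> move V C' C"
proof -
  note D = configurationD[OF c]
  obtain g x y e where m: "e \<in> V" "e \<notin> covered C" "(g, x) \<in> C" "gourd_move e x y" "C' = insert (g, y) (C - {(g, x)})"
    using m by (rule moveE)
  define R where "R = C - {(g, x)}"
  have C: "C = insert (g, x) R" "(g, x) \<notin> R" "C' = insert (g, y) R" using m by (auto simp: R_def)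
  have adj: "adjacent (fst x) (snd x)" using D(3)[OF m(3)] by simp
  obtain v w where vw: "{fst x, snd x} = {v, w}" "{fst y, snd y} = {w, e}" "v \<noteq> w" "adjacent (fst y) (snd y)" "gourd_move v y x"
    using gourd_move_rev[OF m(4) adj] by blast
  have ux: "snd (up (g, x)) = {v, w}" and uy: "snd (up (g, y)) = {w, e}" by (simp_all add: up_Pair vw)
  have vV: "{v, w} \<subseteq> V" using D(2)[OF m(3)] unfolding ux .
  have eC: "e \<notin> snd (up z)" if "z \<in> C" for z using m(2) that unfolding covered_up by blast
  have ev: "e \<notin> {v, w}" using eC[OF m(3)] unfolding ux .
  have oth: "snd (up z) \<inter> {v, w} = {}" "e \<notin> snd (up z)" "z \<in> C" if "z \<in> R" for z
  proof -
    show z: "z \<in> C" using that by (simp add: R_def)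
    show "e \<notin> snd (up z)" using eC[OF z] .
    have "z \<noteq> (g, x)" using that C(2) by (intro notI) simp
    then show "snd (up z) \<inter> {v, w} = {}" using D(4)[OF z m(3)] unfolding ux by blast
  qed
  have yR: "(g, y) \<notin> R"
  proof
    assume "(g, y) \<in> R"
    then have "e \<notin> snd (up (g, y))" by (rule oth(2))
    then show False unfolding uy by simp
  qed
  have fR: "finite R" using D(1) by (simp add: R_def)
  have dR: "snd (up z) \<inter> {w, e} = {}" if "z \<in> R" for z using oth(1,2)[OF that] by blast
  have "configuration V G C'"
    unfolding configuration_up
  proof (intro conjI ballI impI)
    show "finite C'" using fR by (simp add: C(3))
    show "snd (up z) \<subseteq> V" if "z \<in> C'" for z
    proof (cases "z = (g, y)")
      case True
      then show ?thesis unfolding True uy using vV m(1) by simp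
    next
      case False
      then show ?thesis using that C(3) D(2)[OF oth(3)] by blast
    qed
    show "adjacent (fst (snd z)) (snd (snd z))" if "z \<in> C'" for z
    proof (cases "z = (g, y)")
      case True
      then show ?thesis unfolding True using vw(4) by simp
    next
      case False
      then show ?thesis using that C(3) D(3)[OF oth(3)] by blast
    qed
    show "snd (up z) \<inter> snd (up z') = {}" if zz: "z \<in> C'" "z' \<in> C'" "z \<noteq> z'" for z z'
    proof -
      consider "z = (g, y)" "z' \<in> R" | "z' = (g, y)" "z \<in> R" | "z \<in> R" "z' \<in> R"
        using zz C(3) by blast
      then show ?thesis
      proof cases
        case 1 then show ?thesis unfolding 1(1) uy using dR[of z'] by blast
      next
        case 2 then show ?thesis unfolding 2(1) uy using dR[of z] by blast
      next
        case 3 then show ?thesis using D(4)[OF oth(3)[OF 3(1)] oth(3)[OF 3(2)] zz(3)] by blast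
      qed
    qed
    show "image_mset fst (mset_set C') = G"
      using D(5) C(2) yR fR unfolding C(1) C(3) by simp
  qed
  moreover have "move V C' C"
  proof (rule moveI[where e = v and g = g and x = y and y = x])
    show "v \<in> V" using vV by simp
    show "v \<notin> covered C'"
      unfolding covered_up C(3) UN_insert uy using oth(1) vw(3) ev by blast
    show "(g, y) \<in> C'" by (simp add: C(3))
    show "C = insert (g, x) (C' - {(g, y)})" using yR by (simp add: C(1,3))
  qed (rule vw(5))
  ultimately show ?thesis ..
qed

definition mreach :: "cell set \<Rightarrow> nat \<Rightarrow> 'l config \<Rightarrow> 'l config \<Rightarrow> bool" where
  "mreach V k C C' \<longleftrightarrow> (\<exists>j\<le>k. (move V ^^ j) C C')"

lemma mreach_refl: "mreach V k C C"
  unfolding mreach_def by (intro exI[of _ 0]) simp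

lemma mreach_trans: "mreach V k C C' \<Longrightarrow> mreach V l C' C'' \<Longrightarrow> mreach V (k + l) C C''"
proof -
  assume "mreach V k C C'" "mreach V l C' C''"
  then obtain i j where "i \<le> k" "j \<le> l" "(move V ^^ i) C C'" "(move V ^^ j) C' C''"
    unfolding mreach_def by blast
  moreover from this have "(move V ^^ (i + j)) C C''" unfolding relpowp_add by blast
  ultimately show ?thesis unfolding mreach_def by (intro exI[of _ "i + j"]) simp
qed

lemma mreach_mono: "mreach V k C C' \<Longrightarrow> k \<le> l \<Longrightarrow> mreach V l C C'"
  unfolding mreach_def by (meson order_trans)

lemma mreach_move: "move V C C' \<Longrightarrow> mreach V 1 C C'"
  unfolding mreach_def by (intro exI[of _ 1]) (simp add: eq_OO)

lemma mreach_configuration: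
  assumes "mreach V k C C'" "configuration V G C"
  shows "configuration V G C' \<and> mreach V k C' C"
proof -
  have "(move V ^^ j) C C' \<Longrightarrow> configuration V G C' \<and> (move V ^^ j) C' C" for j
  proof (induction j arbitrary: C')
    case (Suc j)
    obtain C1 where C1: "(move V ^^ j) C C1" "move V C1 C'" using Suc.prems by (rule relpowp_Suc_E)
    have c: "configuration V G C1" "(move V ^^ j) C1 C" using Suc.IH[OF C1(1)] by auto
    note m = move_configuration[OF c(1) C1(2)]
    show ?case using m relpowp_Suc_I2[OF _ c(2)] by blast
  qed (use assms(2) in simp)
  then show ?thesis using assms(1) unfolding mreach_def by blast
qed

lemma uhop_lift:
  assumes c: "configuration V G C" and h: "uhop V (upos C) U'"
  shows "\<exists>C'. move V C C' \<and> upos C' = U'"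
proof -
  obtain g p q e where h: "(g, {p, q}) \<in> upos C" "e \<in> V" "adjacent p q" "adjacent q e"
    "\<forall>x\<in>upos C. e \<notin> snd x" "U' = insert (g, {q, e}) (upos C - {(g, {p, q})})"
    using h unfolding uhop_def by blast
  obtain z where z: "z \<in> C" "up z = (g, {p, q})" using h(1) by (metis imageE)
  define x where "x = snd z"
  have zx: "z = (g, x)" using z(2) by (simp add: x_def up_def prod_eq_iff)
  have "{fst x, snd x} = {p, q}" using z(2) by (simp add: zx up_def)
  then have "fst x = p \<and> snd x = q \<or> fst x = q \<and> snd x = p" unfolding doubleton_eq_iff .
  then have xpq: "x = (p, q) \<or> x = (q, p)" by (simp only: prod_eq_iff fst_conv snd_conv)
  have "e \<notin> snd (g, {p, q})" using h(1,5) by (rule bspec[rotated])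
  then have "e \<noteq> p" by simp
  then obtain y where y: "gourd_move e x y" "{fst y, snd y} = {q, e}"
    using gourd_move_exists[OF h(3,4) _ xpq] by blast
  have m: "move V C (insert (g, y) (C - {z}))"
  proof (rule moveI[OF h(2) _ _ y(1)])
    show "e \<notin> covered C" unfolding covered_up using h(5) by blast
    show "(g, x) \<in> C" using z(1) zx by simp
    show "insert (g, y) (C - {z}) = insert (g, y) (C - {(g, x)})" by (simp only: zx)
  qed
  have "upos (insert (g, y) (C - {z})) = insert (g, {q, e}) (upos (C - {z}))" by (simp add: up_Pair y(2))
  also have "upos (C - {z}) = upos C - upos {z}"
    by (rule inj_on_image_set_diff[OF up_inj[OF c]]) (use z(1) in auto)
  also have "upos {z} = {(g, {p, q})}" by (simp add: z(2))
  finally show ?thesis using m h(6) by blast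
qed

text \<open>Which end lands where is left to the kind of move that the geometry permits;
  orientations are corrected afterwards.\<close>

lemma ureach_lift:
  assumes r: "ureach V k (upos C) U'" and c: "configuration V G C"
  obtains C' where "mreach V k C C'" "configuration V G C'" "upos C' = U'"
proof -
  have "(uhop V ^^ j) (upos C) U' \<Longrightarrow> \<exists>C'. (move V ^^ j) C C' \<and> configuration V G C' \<and> upos C' = U'" for j
  proof (induction j arbitrary: U')
    case 0
    then show ?case using c by (intro exI[of _ C]) simp
  next
    case (Suc j)
    obtain U1 where U1: "(uhop V ^^ j) (upos C) U1" "uhop V U1 U'" using Suc.prems by (rule relpowp_Suc_E)
    obtain C1 where C1: "(move V ^^ j) C C1" "configuration V G C1" "upos C1 = U1" using Suc.IH[OF U1(1)] by blast
    obtain C' where C': "move V C1 C'" "upos C' = U'" using uhop_lift[OF C1(2)] U1(2) C1(3) by metis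
    show ?case using relpowp_Suc_I[OF C1(1) C'(1)] move_configuration[OF C1(2) C'(1)] C'(2) by blast
  qed
  then show ?thesis using r that unfolding ureach_def mreach_def by blast
qed

lemma move_frame:
  assumes c: "configuration V G C" and m: "move V C C'" and V: "V \<subseteq> V'" and x: "snd (up x) \<inter> V = {}"
  shows "move V' (insert x C) (insert x C')"
proof -
  obtain g y z e where m: "e \<in> V" "e \<notin> covered C" "(g, y) \<in> C" "gourd_move e y z" "C' = insert (g, z) (C - {(g, y)})"
    using m by (rule moveE)
  have "snd (up (g, y)) \<subseteq> V" using configurationD(2)[OF c m(3)] .
  then have "x \<noteq> (g, y)" using x up_nonempty[of "(g, y)"] by blast
  then have eq: "insert x C' = insert (g, z) (insert x C - {(g, y)})" unfolding m(5) by blast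
  show ?thesis
  proof (rule moveI[OF _ _ _ m(4) eq])
    show "e \<in> V'" using m(1) V by blast
    show "e \<notin> covered (insert x C)" using m(1,2) x unfolding covered_up by blast
    show "(g, y) \<in> insert x C" using m(3) by simp
  qed
qed

lemma mreach_frame:
  assumes c: "configuration V G C" and r: "mreach V k C C'" and V: "V \<subseteq> V'" and x: "snd (up x) \<inter> V = {}"
  shows "mreach V' k (insert x C) (insert x C')"
proof -
  have "(move V ^^ j) C C' \<Longrightarrow> (move V' ^^ j) (insert x C) (insert x C') \<and> configuration V G C'" for j
  proof (induction j arbitrary: C')
    case (Suc j)
    obtain C1 where C1: "(move V ^^ j) C C1" "move V C1 C'" using Suc.prems by (rule relpowp_Suc_E)
    have i: "(move V' ^^ j) (insert x C) (insert x C1)" "configuration V G C1" using Suc.IH[OF C1(1)] by auto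
    show ?case using relpowp_Suc_I[OF i(1) move_frame[OF i(2) C1(2) V x]] move_configuration[OF i(2) C1(2)] by blast
  qed (use c in simp)
  then show ?thesis using r unfolding mreach_def by blast
qed

lemma move_insert:
  assumes "gourd_move e x y" "e \<in> V" "e \<notin> covered C" "e \<notin> {fst x, snd x}" "(g, x) \<notin> C"
  shows "move V (insert (g, x) C) (insert (g, y) C)"
proof (rule moveI[OF assms(2) _ _ assms(1)])
  show "e \<notin> covered (insert (g, x) C)" using assms(3,4) unfolding covered_up UN_insert up_Pair snd_conv by blast
  show "insert (g, y) C = insert (g, y) (insert (g, x) C - {(g, x)})" using assms(5) by simp
qed simp

section \<open>Correcting the orientation of parked gourds\<close>

text \<open>The hole travels to \<open>u\<close> through the rest of the cactus. Within the triangle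
  the gourd runs through \<open>(a, b)\<close>, \<open>(a, u)\<close>, \<open>(b, u)\<close>,
  \<open>(b, a)\<close>, and the journey of the hole is then reversed, which restores the other
  gourds with their orientations.\<close>

lemma flip:
  assumes c: "cact r V L" and n: "u \<in> V" "a \<notin> V" "b \<notin> V" "a \<noteq> b"
    and adj: "adjacent u a" "adjacent u b" "adjacent a b"
    and C: "configuration V G C" "upos C = cu gs L" "length gs = length L"
  shows "mreach (insert a (insert b V)) (2 * length L + 3) (insert (g, a, b) C) (insert (g, b, a) C)"
proof -
  let ?V = "insert a (insert b V)"
  obtain P where P: "fit V (trs L) r P" "\<And>u a b. (u, a, b) \<in> set L \<Longrightarrow> P {u, a, b} = {a, b}"
    using cact_fit[OF c] by metis
  obtain \<phi> where \<phi>: "cu gs L = stt (trs L) \<phi> P" using cu_stt[OF c P(2) C(3)] by metis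
  obtain P1 where P1: "fit V (trs L) u P1" "opn V (trs L) (length L) P P1 id"
    using cact_travel[OF c n(1) subset_refl P(1)] .
  have "ureach V (length L) (upos C) (stt (trs L) \<phi> P1)"
    using opn_relabel[OF P1(2) P(1), of \<phi>] by (simp only: C(2) \<phi> comp_id)
  then obtain C2 where C2: "mreach V (length L) C C2" "configuration V G C2" "upos C2 = stt (trs L) \<phi> P1"
    using ureach_lift[OF _ C(1)] by metis
  have ret: "mreach V (length L) C2 C" using mreach_configuration[OF C2(1) C(1)] by blast
  have "(\<Union>x\<in>upos C2. snd x) \<subseteq> V - {u}"
    unfolding C2(3) using P1(1) unfolding stt_def fit_def by fastforce
  then have cov: "covered C2 \<subseteq> V - {u}" unfolding covered_up by simp
  have notin: "(g, x) \<notin> C2" if "fst x \<in> {a, b}" for x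
  proof
    assume "(g, x) \<in> C2"
    then have "snd (up (g, x)) \<subseteq> V" by (rule configurationD(2)[OF C2(2)])
    then show False using that n(2,3) by (auto simp: up_Pair)
  qed
  have f1: "mreach ?V (length L) (insert (g, a, b) C) (insert (g, a, b) C2)"
    by (rule mreach_frame[OF C(1) C2(1)]) (use n in \<open>auto simp: up_Pair\<close>)
  have f2: "mreach ?V (length L) (insert (g, b, a) C2) (insert (g, b, a) C)"
    by (rule mreach_frame[OF C2(2) ret]) (use n in \<open>auto simp: up_Pair\<close>)
  have "move ?V (insert (g, a, b) C2) (insert (g, a, u) C2)"
    by (rule move_insert[OF pivot_second[OF adj(1,2)]]) (use n cov notin in auto)
  moreover have "move ?V (insert (g, a, u) C2) (insert (g, b, u) C2)"
    by (rule move_insert[OF pivot_first[OF adj_sym[OF adj(3)] adj_sym[OF adj(2)]]]) (use n cov notin in auto)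
  moreover have "move ?V (insert (g, b, u) C2) (insert (g, b, a) C2)"
    by (rule move_insert[OF pivot_second[OF adj(3) adj_sym[OF adj(1)]]]) (use n cov notin in auto)
  ultimately have "mreach ?V (1 + 1 + 1) (insert (g, a, b) C2) (insert (g, b, a) C2)"
    using mreach_trans[OF mreach_trans[OF mreach_move mreach_move] mreach_move] by metis
  then have "mreach ?V (length L + (1 + 1 + 1) + length L) (insert (g, a, b) C) (insert (g, b, a) C)"
    by (rule mreach_trans[OF mreach_trans[OF f1] f2])
  then show ?thesis by (rule mreach_mono) simp
qed

lemma Union_sub: "t \<in> \<T> \<Longrightarrow> \<Union>\<T> \<subseteq> V \<Longrightarrow> t \<subseteq> V"
  by blast

lemma cu_cells: assumes "cact r V L" "z \<in> cu gs L" shows "snd z \<subseteq> V"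
proof -
  have "(fst z, snd z) \<in> set (zip gs (map (\<lambda>(u, a, b). {a, b}) L))" using assms(2) by (simp add: cu_def)
  then have "snd z \<in> set (map (\<lambda>(u, a, b). {a, b}) L)" by (rule set_zip_rightD)
  then have "snd z \<in> (\<lambda>(u, a, b). {a, b}) ` set L" by simp
  then obtain t where t: "snd z = (\<lambda>(u, a, b). {a, b}) t" "t \<in> set L" by (rule imageE)
  have "(\<lambda>(u, a, b). {u, a, b}) t \<in> trs L" unfolding trs_def using t(2) by (rule imageI)
  then have "(\<lambda>(u, a, b). {u, a, b}) t \<subseteq> V" using cact_facts(4)[OF assms(1)] by (rule Union_sub)
  then show ?thesis unfolding t(1) by (simp add: case_prod_unfold)
qed

lemma cu_snoc: "length gs = length L \<Longrightarrow> cu (gs @ [g]) (L @ [(u, a, b)]) = insert (g, {a, b}) (cu gs L)"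
  by (simp add: cu_def)

lemma split_last:
  assumes c: "cact r V L" "a \<notin> V" "b \<notin> V" and len: "length gs = length L"
    and C: "configuration W G C" "upos C = cu (gs @ [g]) (L @ [(u, a, b)])"
  obtains x C0 G0 where "C = insert x C0" "x = (g, a, b) \<or> x = (g, b, a)" "configuration V G0 C0" "upos C0 = cu gs L"
proof -
  note D = configurationD[OF C(1)]
  have cu: "upos C = insert (g, {a, b}) (cu gs L)" using C(2) cu_snoc[OF len] by metis
  then have "(g, {a, b}) \<in> upos C" by simp
  then obtain x where x: "x \<in> C" "up x = (g, {a, b})" by (metis imageE)
  have "fst x = g" "{fst (snd x), snd (snd x)} = {a, b}" using x(2) by (simp_all add: up_def)
  then have xab: "x = (g, a, b) \<or> x = (g, b, a)"
    unfolding doubleton_eq_iff by (metis prod.collapse)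
  define C0 where "C0 = C - {x}"
  have "upos C0 = upos C - upos {x}"
    unfolding C0_def by (rule inj_on_image_set_diff[OF up_inj[OF C(1)]]) (use x(1) in auto)
  also have "\<dots> = insert (g, {a, b}) (cu gs L) - {(g, {a, b})}" by (simp add: x(2) cu)
  also have "\<dots> = cu gs L"
  proof -
    have "(g, {a, b}) \<notin> cu gs L"
    proof
      assume "(g, {a, b}) \<in> cu gs L"
      then have "snd (g, {a, b}) \<subseteq> V" by (rule cu_cells[OF c(1)])
      then show False using c(2) by simp
    qed
    then show ?thesis by simp
  qed
  finally have u0: "upos C0 = cu gs L" .
  have "configuration V (image_mset fst (mset_set C0)) C0"
    unfolding configuration_up
  proof (intro conjI ballI impI)
    show "finite C0" using D(1) by (simp add: C0_def)
    show "snd (up z) \<subseteq> V" if "z \<in> C0" for z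
    proof -
      have "up z \<in> cu gs L" unfolding u0[symmetric] using that by (rule imageI)
      then show ?thesis by (rule cu_cells[OF c(1)])
    qed
    show "adjacent (fst (snd z)) (snd (snd z))" if "z \<in> C0" for z
      using D(3)[of z] that by (simp add: C0_def)
    show "snd (up z) \<inter> snd (up z') = {}" if "z \<in> C0" "z' \<in> C0" "z \<noteq> z'" for z z'
      using D(4)[of z z'] that by (simp add: C0_def)
  qed (rule HOL.refl)
  moreover have "C = insert x C0" using x(1) by (simp add: C0_def insert_absorb)
  ultimately show ?thesis using that xab u0 by blast
qed

lemma orient:
  "cact r V L \<Longrightarrow> configuration V G C \<Longrightarrow> configuration V G' C' \<Longrightarrow> upos C = cu gs L \<Longrightarrow> upos C' = cu gs L \<Longrightarrow>
    length gs = length L \<Longrightarrow> mreach V (length L * (2 * length L + 3)) C C'"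
proof (induction arbitrary: G C G' C' gs rule: cact.induct)
  case root
  then have "upos C = {}" "upos C' = {}" by (simp_all add: cu_def)
  then have "C = C'" by simp
  then show ?case using mreach_refl by metis
next
  case (grow V L u a b)
  let ?V = "insert a (insert b V)" and ?n = "length L"
  have adj: "adjacent u a \<and> adjacent u b \<and> adjacent a b"
    by (rule lat_adj[OF grow.hyps(6,5)]) (use grow.hyps in auto)
  obtain hs g where gs: "gs = hs @ [g]" using grow.prems(5) by (cases gs rule: rev_cases) auto
  have len: "length hs = ?n" using grow.prems(5) gs by simp
  obtain x C0 G0 where x: "C = insert x C0" "x = (g, a, b) \<or> x = (g, b, a)" "configuration V G0 C0" "upos C0 = cu hs L"
    using split_last[OF grow.hyps(1,3,4) len grow.prems(1) grow.prems(3)[unfolded gs]] by metis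
  obtain x' C0' G0' where x': "C' = insert x' C0'" "x' = (g, a, b) \<or> x' = (g, b, a)" "configuration V G0' C0'" "upos C0' = cu hs L"
    using split_last[OF grow.hyps(1,3,4) len grow.prems(2) grow.prems(4)[unfolded gs]] by metis
  have "mreach V (?n * (2 * ?n + 3)) C0 C0'" using grow.IH[OF x(3) x'(3) x(4) x'(4) len] .
  then have one: "mreach ?V (?n * (2 * ?n + 3)) (insert x C0) (insert x C0')"
    by (rule mreach_frame[OF x(3)]) (use x(2) grow.hyps(3,4) in \<open>auto simp: up_Pair\<close>)
  have two: "mreach ?V (2 * ?n + 3) (insert x C0') (insert x' C0')"
  proof (cases "x = x'")
    case True
    then show ?thesis using mreach_refl by metis
  next
    case False
    then consider "x = (g, a, b)" "x' = (g, b, a)" | "x = (g, b, a)" "x' = (g, a, b)" using x(2) x'(2) by blast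
    then show ?thesis
    proof cases
      case 1
      show ?thesis unfolding 1
        by (rule flip[OF grow.hyps(1,2,3,4,5) _ _ _ x'(3,4) len]) (use adj in blast)+
    next
      case 2
      have "mreach (insert b (insert a V)) (2 * ?n + 3) (insert x C0') (insert x' C0')" unfolding 2
        by (rule flip[OF grow.hyps(1,2,4,3) grow.hyps(5)[symmetric] _ _ _ x'(3,4) len]) (use adj adj_sym in blast)+
      then show ?thesis by (simp only: insert_commute)
    qed
  qed
  have "mreach ?V (?n * (2 * ?n + 3) + (2 * ?n + 3)) C C'"
    using mreach_trans[OF one two] by (simp only: x(1) x'(1))
  then show ?case by (rule mreach_mono) (simp add: algebra_simps)
qed

lemma cu_mset:
  assumes c: "cact r V L" and C: "configuration V G C" "upos C = cu gs L" and len: "length gs = length L"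
  shows "mset gs = G"
proof -
  define ps where "ps = map (\<lambda>(u, a, b). {a, b}) L"
  have "distinct (map (\<lambda>(u, a, b). {a, b}) L)"
    using c
  proof (induction rule: cact.induct)
    case (grow V L u a b)
    have "{a, b} \<notin> set (map (\<lambda>(u, a, b). {a, b}) L)"
    proof
      assume m: "{a, b} \<in> set (map (\<lambda>(u, a, b). {a, b}) L)"
      obtain t where t: "{a, b} = (\<lambda>(u, a, b). {a, b}) t" "t \<in> set L"
        using m unfolding set_map by (rule imageE)
      have "(\<lambda>(u, a, b). {u, a, b}) t \<in> trs L" unfolding trs_def using t(2) by (rule imageI)
      then have "(\<lambda>(u, a, b). {u, a, b}) t \<subseteq> V" using cact_facts(4)[OF grow.hyps(1)] by (rule Union_sub)
      then have "{a, b} \<subseteq> V" unfolding t(1) by (simp add: case_prod_unfold)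
      then show False using grow.hyps(3) by simp
    qed
    then show ?case using grow.IH by simp
  qed simp
  then have "distinct (zip gs ps)" unfolding ps_def by (intro distinct_zipI2)
  then have "mset_set (cu gs L) = mset (zip gs ps)" unfolding cu_def ps_def by (rule mset_set_set)
  then have "image_mset fst (mset_set (cu gs L)) = mset (map fst (zip gs ps))" by simp
  also have "map fst (zip gs ps) = gs" using len by (simp add: ps_def)
  finally have "image_mset fst (mset_set (upos C)) = mset gs" by (simp only: C(2))
  moreover have "mset_set (upos C) = image_mset up (mset_set C)"
    by (rule image_mset_mset_set[OF up_inj[OF C(1)], symmetric])
  moreover have "fst \<circ> up = fst" by (rule ext) (simp add: up_def)
  ultimately have "image_mset fst (mset_set C) = mset gs" by (metis image_mset.compositionality)
  then show ?thesis using configurationD(5)[OF C(1)] by simp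
qed

text \<open>Both configurations are parked. The first is sorted into the order of the second and
  oriented like it, and the parking of the second is run backwards, as moves are reversible.\<close>

lemma cact_connects:
  assumes c: "cact r V L" and TW: "TW (trs L) W" and G: "size G = length L"
    and s: "configuration V G s" and t: "configuration V G t"
  shows "mreach V (4 * length L ^ 2 + length L * (2 * length L + 2 * W) + length L * (2 * length L + 3) + 4 * length L ^ 2) s t"
proof -
  let ?n = "length L"
  have card: "card V = 2 * size G + 1" using cact_facts(5)[OF c] G by simp
  have canon: "\<exists>gs C'. length gs = ?n \<and> mset gs = G \<and> mreach V (4 * ?n ^ 2) C C' \<and> configuration V G C' \<and> upos C' = cu gs L"
    if C: "configuration V G C" for C
  proof -
    obtain e where "ust V e (upos C)" using config_ust[OF C card] .
    then obtain gs where gs: "length gs = ?n" "ureach V (4 * ?n ^ 2) (upos C) (cu gs L)" using gather[OF c] by blast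
    obtain C' where "mreach V (4 * ?n ^ 2) C C'" "configuration V G C'" "upos C' = cu gs L"
      using ureach_lift[OF gs(2) C] .
    then show ?thesis using gs(1) cu_mset[OF c _ _ gs(1)] by blast
  qed
  obtain gs s1 where s1: "length gs = ?n" "mset gs = G" "mreach V (4 * ?n ^ 2) s s1" "configuration V G s1" "upos s1 = cu gs L"
    using canon[OF s] by blast
  obtain gt t1 where t1: "length gt = ?n" "mset gt = G" "mreach V (4 * ?n ^ 2) t t1" "configuration V G t1" "upos t1 = cu gt L"
    using canon[OF t] by blast
  have "mset gs = mset gt" using s1(2) t1(2) by simp
  then have "ureach V (?n * (2 * ?n + 2 * W)) (upos s1) (cu gt L)" unfolding s1(5) by (rule sort[OF c TW s1(1)])
  then obtain s2 where s2: "mreach V (?n * (2 * ?n + 2 * W)) s1 s2" "configuration V G s2" "upos s2 = cu gt L"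
    using ureach_lift[OF _ s1(4)] by metis
  have o: "mreach V (?n * (2 * ?n + 3)) s2 t1" by (rule orient[OF c s2(2) t1(4) s2(3) t1(5,1)])
  have b: "mreach V (4 * ?n ^ 2) t1 t" using mreach_configuration[OF t1(3) t] by blast
  show ?thesis by (rule mreach_trans[OF mreach_trans[OF mreach_trans[OF s1(3) s2(1)] o] b])
qed

section \<open>The lower bound on a strip of width two\<close>

text \<open>Zigzag numbering of two rows: cells are adjacent exactly if their numbers differ by 1 or
  2, so the board conditions become statements about intervals of numbers.\<close>

definition strip :: "nat \<Rightarrow> cell" where
  "strip i = (int (i div 2), int (i mod 2))"

lemma strip_even: "strip (2 * k) = (int k, 0)" and strip_odd: "strip (Suc (2 * k)) = (int k, 1)"
  by (simp_all add: strip_def)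

lemma parity_cases:
  fixes i :: nat
  obtains k where "i = 2 * k" | k where "i = Suc (2 * k)"
  by (metis oddE evenE Suc_eq_plus1)

lemma strip_inj: "strip i = strip j \<longleftrightarrow> i = j"
proof
  assume "strip i = strip j"
  then have "i div 2 = j div 2" "i mod 2 = j mod 2" unfolding strip_def prod.inject of_nat_eq_iff by blast+
  then show "i = j" by (metis div_mult_mod_eq)
qed simp

lemma strip_adjacent: "adjacent (strip i) (strip j) \<longleftrightarrow> j = i + 1 \<or> j = i + 2 \<or> i = j + 1 \<or> i = j + 2"
proof -
  show ?thesis
    by (cases i rule: parity_cases; cases j rule: parity_cases; simp only: strip_even strip_odd)
      (auto simp: adjacent_coords)
qed

text \<open>Each new cell touches only the last two cells, and these form an edge; the side on which
  it lies alternates with the parity of its number.\<close>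

lemma hole_free_strip: "hole_free (strip ` {..m})"
proof (induction m)
  case 0
  have "strip ` {..0} = {strip 0}" by simp
  then show ?case using hole_free_singleton by metis
next
  case (Suc m)
  have ins: "strip ` {..Suc m} = insert (strip (Suc m)) (strip ` {..m})" by (simp add: atMost_Suc)
  have new: "strip (Suc m) \<notin> strip ` {..m}" using strip_inj by auto
  have nb: "d = strip m \<or> m \<ge> 1 \<and> d = strip (m - 1)" if d: "d \<in> strip ` {..m}" "adjacent (strip (Suc m)) d" for d
  proof -
    obtain j where j: "d = strip j" "j \<le> m" using d(1) by auto
    then have "Suc m = j + 1 \<or> Suc m = j + 2" using d(2) strip_adjacent[of "Suc m" j] by auto
    then show ?thesis using j by auto
  qed
  show ?case
  proof (cases m)
    case 0
    show ?thesis unfolding ins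
      by (rule hole_free_insert_leaf[OF Suc.IH _ _ _ new, of "strip m"]) (use nb 0 in auto)
  next
    case (Suc l)
    have mem: "strip m \<in> strip ` {..m}" "strip l \<in> strip ` {..m}" using Suc by auto
    have nb': "d \<in> {strip l, strip m}" "d \<in> {strip m, strip l}"
      if "d \<in> strip ` {..m}" "adjacent (strip (Suc m)) d" for d
      using nb[OF that] Suc by auto
    have adj: "adjacent (strip l) (strip m)" "adjacent (strip m) (strip l)" using strip_adjacent Suc by auto
    have fin: "finite (strip ` {..m})" by simp
    have "strip (Suc m) = la (strip l) (strip m) \<or> strip (Suc m) = la (strip m) (strip l)"
    proof (cases l rule: parity_cases)
      case (1 k)
      have "strip (Suc m) = strip (2 * Suc k)" using Suc 1 by simp
      then have "strip (Suc m) = la (strip m) (strip l)"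
        using Suc 1 strip_even[of k] strip_odd[of k] strip_even[of "Suc k"] by (simp add: la_coords)
      then show ?thesis ..
    next
      case (2 k)
      have "strip (Suc m) = strip (Suc (2 * Suc k))" "strip m = strip (2 * Suc k)" using Suc 2 by simp_all
      then have "strip (Suc m) = la (strip l) (strip m)"
        using 2 strip_even[of "Suc k"] strip_odd[of k] strip_odd[of "Suc k"] by (simp add: la_coords)
      then show ?thesis ..
    qed
    then show ?thesis
    proof
      assume "strip (Suc m) = la (strip l) (strip m)"
      then show ?thesis unfolding ins using hole_free_insert_edge[OF Suc.IH fin mem(2,1) adj(1) _ nb'(1) new] by blast
    next
      assume "strip (Suc m) = la (strip m) (strip l)"
      then show ?thesis unfolding ins using hole_free_insert_edge[OF Suc.IH fin mem(1,2) adj(2) _ nb'(2) new] by blast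
    qed
  qed
qed

lemma strip_connected:
  assumes r: "r \<in> J" and down: "\<And>i. i \<in> J \<Longrightarrow> i \<noteq> r \<Longrightarrow> \<exists>j\<in>J. j < i \<and> adjacent (strip i) (strip j)"
  shows "board_connected (strip ` J)"
proof -
  let ?R = "board_graph (strip ` J)"
  have to: "i \<in> J \<Longrightarrow> (strip i, strip r) \<in> ?R\<^sup>*" for i
  proof (induction i rule: less_induct)
    case (less i)
    show ?case
    proof (cases "i = r")
      case False
      then obtain j where j: "j \<in> J" "j < i" "adjacent (strip i) (strip j)" using down less.prems by blast
      then have "(strip i, strip j) \<in> ?R" using less.prems unfolding board_graph_def by blast
      then show ?thesis using less.IH[OF j(2,1)] by (rule converse_rtrancl_into_rtrancl)
    qed simp
  qed
  have "sym ?R" unfolding sym_def board_graph_def using adjacent_sym by blast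
  then have "sym (?R\<^sup>*)" by (rule sym_rtrancl)
  then have "(c, d) \<in> ?R\<^sup>*" if cd: "c \<in> strip ` J" "d \<in> strip ` J" for c d
  proof -
    obtain i j where "i \<in> J" "c = strip i" "j \<in> J" "d = strip j" using cd by (metis imageE)
    then have cr: "(c, strip r) \<in> ?R\<^sup>*" and dr: "(d, strip r) \<in> ?R\<^sup>*" using to by blast+
    show ?thesis by (rule rtrancl_trans[OF cr symD[OF \<open>sym (?R\<^sup>*)\<close> dr]])
  qed
  then show ?thesis unfolding board_connected_def using r by blast
qed

lemma strip_without: "strip ` {..m} - {strip k} = strip ` ({..m} - {k})"
  using inj_on_image_set_diff[of strip UNIV "{..m}" "{k}"] strip_inj by (simp add: inj_on_def)

lemma two_connected_strip:
  assumes "m \<ge> 2" shows "two_connected (strip ` {..m})"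
  unfolding two_connected_def
proof (intro conjI ballI)
  have "card (strip ` {..m}) = Suc m" using card_image[of strip "{..m}"] strip_inj by (simp add: inj_on_def)
  then show "card (strip ` {..m}) > 2" using assms by simp
  show "board_connected (strip ` {..m})"
  proof (rule strip_connected[of 0])
    fix i assume "i \<in> {..m}" "i \<noteq> 0"
    then show "\<exists>j\<in>{..m}. j < i \<and> adjacent (strip i) (strip j)"
      using strip_adjacent by (intro bexI[of _ "i - 1"]) auto
  qed simp
  fix c assume "c \<in> strip ` {..m}"
  then obtain k where k: "c = strip k" "k \<le> m" by auto
  show "board_connected (strip ` {..m} - {c})"
    unfolding k(1) strip_without
  proof (rule strip_connected[of "if k = 0 then 1 else 0"])
    show "(if k = 0 then 1 else 0) \<in> {..m} - {k}" using assms by auto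
    fix i assume i: "i \<in> {..m} - {k}" "i \<noteq> (if k = 0 then 1 else 0)"
    show "\<exists>j\<in>{..m} - {k}. j < i \<and> adjacent (strip i) (strip j)"
    proof (cases "i - 1 = k")
      case True
      then have "i \<ge> 2" using i by (auto split: if_splits)
      then show ?thesis using i True strip_adjacent[of i "i - 2"] by (intro bexI[of _ "i - 2"]) auto
    next
      case False
      then have "i \<ge> 1" using i by (auto split: if_splits)
      then show ?thesis using i False strip_adjacent[of i "i - 1"] by (intro bexI[of _ "i - 1"]) auto
    qed
  qed
qed

text \<open>A Star of David has cells in the rows directly above and below its centre, while the
  strip has only two rows.\<close>

lemma strip_not_star: "strip ` I \<noteq> star_of_david c"
proof
  assume eq: "strip ` I = star_of_david c"
  obtain a b where c: "c = (a, b)" by fastforce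
  have "(a, b + 1) \<in> star_of_david c" "(a, b - 1) \<in> star_of_david c"
    by (simp_all add: star_of_david_def c adjacent_coords)
  then have "(a, b + 1) \<in> strip ` I" "(a, b - 1) \<in> strip ` I" using eq by simp_all
  then have "b + 1 \<in> {0, 1}" "b - 1 \<in> {0, 1}" by (auto simp: strip_def)
  then show False by auto
qed

lemma proper_strip: assumes "n \<ge> 1" shows "proper_board n (strip ` {..2 * n})"
proof -
  have "card (strip ` {..2 * n}) = Suc (2 * n)" using card_image[of strip "{..2 * n}"] strip_inj by (simp add: inj_on_def)
  moreover have two: "two_connected (strip ` {..2 * n})" using assms by (intro two_connected_strip) simp
  ultimately show ?thesis
    unfolding proper_board_def board_def using hole_free_strip strip_not_star two by (simp add: two_connected_def)
qed

text \<open>Gourd \<open>i\<close> stands upright in column \<open>f i\<close>, and the cell with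
  the number \<open>2 * n\<close> stays free. The labels \<open>2 * i\<close> and
  \<open>2 * i + 1\<close> are all different, and halving either one recovers
  \<open>i\<close>.\<close>

definition lay :: "(nat \<Rightarrow> nat) \<Rightarrow> nat \<Rightarrow> nat gourd \<times> cell \<times> cell" where
  "lay f i = ((2 * i, 2 * i + 1), strip (2 * f i), strip (2 * f i + 1))"

definition labels :: "nat \<Rightarrow> nat gourd multiset" where
  "labels n = image_mset (\<lambda>i. (2 * i, 2 * i + 1)) (mset_set {..<n})"

lemma numbered_labels: "numbered (labels n)"
proof -
  let ?A = "(\<lambda>i. 2 * i) ` {..<n}" and ?B = "(\<lambda>i. 2 * i + 1) ` {..<n}"
  have "image_mset fst (labels n) = mset_set ?A" "image_mset snd (labels n) = mset_set ?B"
    by (simp_all add: labels_def multiset.map_comp comp_def image_mset_mset_set inj_on_def image_image)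
  moreover have "count (mset_set ?A) l + count (mset_set ?B) l \<le> 1" for l :: nat
  proof -
    have "l \<notin> ?A \<or> l \<notin> ?B"
    proof -
      have "2 * i \<noteq> 2 * j + 1" for i j :: nat by presburger
      then show ?thesis by auto
    qed
    moreover have "count (mset_set ?A) l \<le> 1" "count (mset_set ?B) l \<le> 1" by (simp_all add: count_mset_set')
    ultimately show ?thesis by (auto simp: count_mset_set')
  qed
  ultimately show ?thesis unfolding numbered_def by simp
qed

lemma lay_configuration:
  assumes f: "inj_on f {..<n}" "f ` {..<n} \<subseteq> {..<n}"
  shows "configuration (strip ` {..2 * n}) (labels n) (lay f ` {..<n})"
  unfolding configuration_def
proof (intro conjI)
  have inj: "inj_on (lay f) {..<n}" by (rule inj_onI) (simp add: lay_def)
  show "finite (lay f ` {..<n})" by simp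
  show "\<forall>(g, p, q)\<in>lay f ` {..<n}. p \<in> strip ` {..2 * n} \<and> q \<in> strip ` {..2 * n} \<and> adjacent p q"
  proof
    fix x assume "x \<in> lay f ` {..<n}"
    then obtain i where i: "i < n" "x = lay f i" by auto
    then have "f i < n" using f(2) by auto
    then have "strip (2 * f i) \<in> strip ` {..2 * n}" "strip (2 * f i + 1) \<in> strip ` {..2 * n}"
      by (intro imageI; simp)+
    moreover have "adjacent (strip (2 * f i)) (strip (2 * f i + 1))" using strip_adjacent by blast
    ultimately show "case x of (g, p, q) \<Rightarrow> p \<in> strip ` {..2 * n} \<and> q \<in> strip ` {..2 * n} \<and> adjacent p q"
      unfolding i(2) lay_def prod.case by blast
  qed
  show "pairwise (\<lambda>(g, p, q) (g', p', q'). {p, q} \<inter> {p', q'} = {}) (lay f ` {..<n})"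
  proof (rule pairwiseI)
    fix x y assume "x \<in> lay f ` {..<n}" "y \<in> lay f ` {..<n}" "x \<noteq> y"
    then obtain i j where ij: "i < n" "x = lay f i" "j < n" "y = lay f j" "i \<noteq> j" by auto
    then have "f i \<noteq> f j" using f(1) by (auto simp: inj_on_def)
    then have "2 * f i \<noteq> 2 * f j" "2 * f i \<noteq> 2 * f j + 1" "2 * f i + 1 \<noteq> 2 * f j" "2 * f i + 1 \<noteq> 2 * f j + 1"
      by presburger+
    then have "{strip (2 * f i), strip (2 * f i + 1)} \<inter> {strip (2 * f j), strip (2 * f j + 1)} = {}"
      using strip_inj by (simp only: Int_insert_left insert_iff empty_iff if_False Int_empty_left) simp
    then show "(case x of (g, p, q) \<Rightarrow> \<lambda>(g', p', q'). {p, q} \<inter> {p', q'} = {}) y"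
      unfolding ij(2,4) lay_def prod.case .
  qed
  show "image_mset fst (mset_set (lay f ` {..<n})) = labels n"
    unfolding image_mset_mset_set[OF inj, symmetric]
    by (simp add: multiset.map_comp comp_def labels_def lay_def)
qed

text \<open>Total distance of the first ends to their columns in the reversed arrangement, the
  target column \<open>n - 1 - i\<close> being read off the label. A move shifts one first end by at
  most one column.\<close>

definition potential :: "nat \<Rightarrow> nat config \<Rightarrow> int" where
  "potential n C = (\<Sum>x\<in>C. \<bar>fst (fst (snd x)) - (int n - 1 - int (fst (fst x) div 2))\<bar>)"

lemma adjacent_fst:
  assumes "adjacent p q" shows "\<bar>fst p - fst q\<bar> \<le> 1"
proof -
  have "fst (q - p) \<in> {1, 0, -1}" using assms unfolding adjacent_def by (elim insertE emptyE) simp_all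
  then show ?thesis by auto
qed

lemma gourd_move_fst:
  assumes "gourd_move e x y" shows "\<bar>fst (fst x) - fst (fst y)\<bar> \<le> 1" "e \<in> {fst y, snd y}"
proof -
  have *: "\<bar>fst p - fst q\<bar> \<le> 1" if "adjacent q p" for p q using adjacent_fst[OF that] by linarith
  show "\<bar>fst (fst x) - fst (fst y)\<bar> \<le> 1"
    using assms by cases (auto simp: straight_def angle120_def simp del: adjacent_irrefl dest!: adjacent_fst)
  show "e \<in> {fst y, snd y}" using assms by cases simp_all
qed

lemma potential_move:
  assumes "move B C C'" "finite C" shows "finite C' \<and> potential n C \<le> potential n C' + 1"
proof -
  obtain g x y e where m: "e \<notin> covered C" "(g, x) \<in> C" "gourd_move e x y" "C' = insert (g, y) (C - {(g, x)})"
    using assms(1) unfolding move_def by blast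
  define R where "R = C - {(g, x)}"
  have C: "C = insert (g, x) R" "(g, x) \<notin> R" "C' = insert (g, y) R" and fin: "finite R"
    using m assms(2) by (auto simp: R_def)
  have "(g, y) \<notin> R"
  proof
    assume "(g, y) \<in> R"
    then have "(g, fst y, snd y) \<in> C" by (simp add: R_def)
    then have "{fst y, snd y} \<subseteq> covered C" unfolding covered_def by blast
    then show False using gourd_move_fst(2)[OF m(3)] m(1) by blast
  qed
  then show ?thesis
    using gourd_move_fst(1)[OF m(3)] C(2) fin unfolding C(1) C(3) by (simp add: potential_def)
qed

lemma potential_moves:
  assumes "finite C" shows "(move B ^^ k) C C' \<Longrightarrow> finite C' \<and> potential n C \<le> potential n C' + int k"
proof (induction k arbitrary: C')
  case (Suc k)
  obtain C1 where C1: "(move B ^^ k) C C1" "move B C1 C'" using Suc.prems by (rule relpowp_Suc_E)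
  have one: "finite C1" "potential n C \<le> potential n C1 + int k" using Suc.IH[OF C1(1)] by auto
  show ?case using potential_move[OF C1(2) one(1), of n] one(2) by simp
qed (use assms in simp)

lemma potential_lay: "potential n (lay f ` {..<n}) = (\<Sum>i<n. \<bar>int (f i) - (int n - 1 - int i)\<bar>)"
proof -
  have inj: "inj_on (lay f) {..<n}" by (rule inj_onI) (simp add: lay_def)
  show ?thesis unfolding potential_def sum.reindex[OF inj] by (simp add: lay_def strip_even)
qed

text \<open>Taking off the outermost pair lowers the sum by twice \<open>n - 1\<close> and the
  square by \<open>4 * (n - 1)\<close>. The 1 accounts for odd \<open>n\<close>.\<close>

lemma reversal_distance: "int n ^ 2 \<le> 2 * (\<Sum>i<n. \<bar>int i - (int n - 1 - int i)\<bar>) + 1"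
proof (induction n rule: less_induct)
  case (less n)
  show ?case
  proof (cases "n < 2")
    case True
    then have "n = 0 \<or> n = 1" by linarith
    then show ?thesis by auto
  next
    case False
    then obtain m where m: "n = Suc (Suc m)" by (metis Suc_diff_Suc add_2_eq_Suc le_Suc_ex linorder_not_less)
    let ?g = "\<lambda>i. \<bar>int i - (int n - 1 - int i)\<bar>"
    have "(\<Sum>i<n. ?g i) = ?g 0 + (\<Sum>i<m. ?g (Suc i)) + ?g (Suc m)"
      unfolding m by (simp only: sum.lessThan_Suc[of _ "Suc m"] sum.lessThan_Suc_shift[of _ m])
    also have "(\<Sum>i<m. ?g (Suc i)) = (\<Sum>i<m. \<bar>int i - (int m - 1 - int i)\<bar>)"
      by (rule sum.cong) (simp_all add: m)
    also have "?g 0 = int m + 1" by (simp add: m)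
    also have "?g (Suc m) = int m + 1" by (simp add: m)
    finally have "(\<Sum>i<n. ?g i) = 2 * int m + 2 + (\<Sum>i<m. \<bar>int i - (int m - 1 - int i)\<bar>)" by simp
    moreover have "int m ^ 2 \<le> 2 * (\<Sum>i<m. \<bar>int i - (int m - 1 - int i)\<bar>) + 1" using less.IH m by simp
    moreover have "int n ^ 2 = int m ^ 2 + 4 * int m + 4" by (simp add: m power2_eq_square algebra_simps)
    ultimately show ?thesis by linarith
  qed
qed

lemma strip_needs:
  assumes n: "n \<ge> 1" and k: "(move B ^^ k) (lay id ` {..<n}) (lay (\<lambda>i. n - 1 - i) ` {..<n})"
  shows "n ^ 2 div 4 \<le> k"
proof -
  have "potential n (lay (\<lambda>i. n - 1 - i) ` {..<n}) = 0"
    unfolding potential_lay by (rule sum.neutral) (auto simp: of_nat_diff)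
  then have "(\<Sum>i<n. \<bar>int i - (int n - 1 - int i)\<bar>) \<le> int k"
    using potential_moves[OF _ k, of n] by (simp add: potential_lay)
  then have "int n ^ 2 \<le> 2 * int k + 1" using reversal_distance[of n] by linarith
  then have "int (n ^ 2) \<le> int (2 * k + 1)" by simp
  then have le: "n ^ 2 \<le> 2 * k + 1" by (simp only: of_nat_le_iff)
  show ?thesis using le by linarith
qed

lemma lower_bound:
  assumes "n \<ge> 1"
  shows "\<exists>B (G :: nat gourd multiset) s t. proper_board n B \<and> size G = n \<and> numbered G \<and>
    configuration B G s \<and> configuration B G t \<and> (\<forall>k. (move B ^^ k) s t \<longrightarrow> n ^ 2 div 4 \<le> k)"
proof (intro exI conjI allI impI)
  show "proper_board n (strip ` {..2 * n})" using proper_strip assms .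
  show "size (labels n) = n" by (simp add: labels_def)
  show "numbered (labels n)" by (rule numbered_labels)
  show "configuration (strip ` {..2 * n}) (labels n) (lay id ` {..<n})"
    by (rule lay_configuration) auto
  show "configuration (strip ` {..2 * n}) (labels n) (lay (\<lambda>i. n - 1 - i) ` {..<n})"
    by (rule lay_configuration) (auto simp: inj_on_def)
  show "n ^ 2 div 4 \<le> k" if "(move (strip ` {..2 * n}) ^^ k) (lay id ` {..<n}) (lay (\<lambda>i. n - 1 - i) ` {..<n})" for k
    using strip_needs[OF assms that] .
qed

section \<open>Assembling the two bounds\<close>

text \<open>The constant is \<open>4 + 1082 + 5 + 4\<close>: parking at both ends costs 4 each,
  sorting \<open>2 + 2 * 540\<close>, and orienting \<open>2 + 3\<close>.\<close>

lemma upper_bound: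
  assumes B: "proper_board n B" and G: "size G = n" and s: "configuration B G s" and t: "configuration B G t"
  shows "mreach B (1095 * n ^ 2) s t"
proof -
  have p: "finite B" "card B = 2 * n + 1" "hole_free B" "two_connected B" "\<And>c. B \<noteq> star_of_david c"
    using B unfolding proper_board_def board_def by blast+
  interpret region B
    by unfold_locales (use p(1,4) hole_free_complement_connected[OF p(3)] in blast)+
  obtain D where D: "good B D" "\<And>v. \<not> inner D v" using good_without_inner p(5) by blast
  have "B \<noteq> {}" using p(2) by (intro notI) simp
  then obtain x z ps E where poly: "adjacent x z" "poly x z ps E" "distinct (x # ps @ [z])" "set (x # ps @ [z]) = B"
    using good_poly[OF D] by metis
  obtain L W where L: "cact x B L" "TW (trs L) W" "W \<le> 540 * n" "length L = n"
    using poly_cact[OF poly(2,1,3,4) p(2)] by metis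
  have "mreach B (4 * n ^ 2 + n * (2 * n + 2 * W) + n * (2 * n + 3) + 4 * n ^ 2) s t"
    using cact_connects[OF L(1,2) _ s t] G L(4) by simp
  moreover have "4 * n ^ 2 + n * (2 * n + 2 * W) + n * (2 * n + 3) + 4 * n ^ 2 \<le> 1095 * n ^ 2"
  proof -
    have sum: "4 * q + x + y + 4 * q \<le> 1095 * q" if "x \<le> 1082 * q" "y \<le> 5 * q" for q x y :: nat
      using that by simp
    have "n * (2 * n + 2 * W) \<le> n * (1082 * n)" using L(3) by (intro mult_le_mono2) simp
    then have "n * (2 * n + 2 * W) \<le> 1082 * n ^ 2" by (simp only: power2_eq_square mult.left_commute)
    moreover have "n * (2 * n + 3) \<le> 5 * n ^ 2"
      using le_square[of n] by (simp add: power2_eq_square algebra_simps)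
    ultimately show ?thesis by (rule sum)
  qed
  ultimately show ?thesis by (rule mreach_mono)
qed

lemma quarter_square_bigomega: "(\<lambda>n. real (n ^ 2 div 4)) \<in> \<Omega>(\<lambda>n. real n ^ 2)"
proof (rule landau_omega.bigI)
  show "(0::real) < 1 / 8" by simp
  show "\<forall>\<^sub>F n in at_top. norm (real (n ^ 2 div 4)) \<ge> 1 / 8 * norm (real n ^ 2)"
    unfolding eventually_at_top_linorder
  \<comment> \<open>From \<open>n = 3\<close> on the quotient by 4 is at least 1, so the remainder,
    at most 3, is absorbed by doubling 4 to 8.\<close>
  proof (intro exI[of _ 3] allI impI)
    fix n :: nat assume "3 \<le> n"
    then have "3 ^ 2 \<le> n ^ 2" by (rule power_mono) simp
    then have "n ^ 2 \<le> 8 * (n ^ 2 div 4)" by simp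
    then have "real (n ^ 2) \<le> real (8 * (n ^ 2 div 4))" by (simp only: of_nat_le_iff)
    then show "1 / 8 * norm (real n ^ 2) \<le> norm (real (n ^ 2 div 4))" by simp
  qed
qed


theorem theorem4:
  "(\<exists>f :: nat \<Rightarrow> nat. (\<lambda>n. real (f n)) \<in> O(\<lambda>n. real n ^ 2) \<and>
      (\<forall>n B (G :: 'l gourd multiset) s t.
         proper_board n B \<and> size G = n \<and> configuration B G s \<and> configuration B G t \<longrightarrow>
         (\<exists>k \<le> f n. (move B ^^ k) s t))) \<and>
   (\<exists>h :: nat \<Rightarrow> nat. (\<lambda>n. real (h n)) \<in> \<Omega>(\<lambda>n. real n ^ 2) \<and>
      (\<forall>n \<ge> 1. \<exists>B (G :: nat gourd multiset) s t.
         proper_board n B \<and> size G = n \<and> numbered G \<and>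
         configuration B G s \<and> configuration B G t \<and>
         (\<forall>k. (move B ^^ k) s t \<longrightarrow> h n \<le> k)))"
proof (rule conjI)
  show "\<exists>f :: nat \<Rightarrow> nat. (\<lambda>n. real (f n)) \<in> O(\<lambda>n. real n ^ 2) \<and>
      (\<forall>n B (G :: 'l gourd multiset) s t.
         proper_board n B \<and> size G = n \<and> configuration B G s \<and> configuration B G t \<longrightarrow>
         (\<exists>k \<le> f n. (move B ^^ k) s t))"
  proof (intro exI[of _ "\<lambda>n. 1095 * n ^ 2"] conjI)
    show "(\<lambda>n. real (1095 * n ^ 2)) \<in> O(\<lambda>n. real n ^ 2)"
      by (intro bigoI[of _ 1095]) simp
  qed (use upper_bound in \<open>unfold mreach_def, blast\<close>)
  show "\<exists>h :: nat \<Rightarrow> nat. (\<lambda>n. real (h n)) \<in> \<Omega>(\<lambda>n. real n ^ 2) \<and>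
      (\<forall>n \<ge> 1. \<exists>B (G :: nat gourd multiset) s t.
         proper_board n B \<and> size G = n \<and> numbered G \<and>
         configuration B G s \<and> configuration B G t \<and>
         (\<forall>k. (move B ^^ k) s t \<longrightarrow> h n \<le> k))"
    by (intro exI[of _ "\<lambda>n. n ^ 2 div 4"] conjI quarter_square_bigomega allI impI lower_bound)
qed

end
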